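(* Let $r=(12)$, $s=(23)$, $t=(34)$ be the standard Coxeter generators of $S_4$, and let $L(rt)$ be the simple highest weight $\mathfrak{sl}_4$-module with highest weight $rt(\rho)-\rho$. Then Kostant's problem has a negative answer for $L(rt)$, i.e. the natural injection $$U(\mathfrak{sl}_4)/\mathrm{Ann}(L(rt))\hookrightarrow\mathscr{L}(L(rt),L(rt))$$ is not surjective.
   Context: $\mathfrak{sl}_4$ is the complex simple Lie algebra of traceless $4\times4$ matrices with its standard triangular decomposition; $S_4$ is its Weyl group, acting on the dual of the diagonal Cartan subalgebra by permuting the coordinates, with $r,s,t$ the simple reflections; $\rho$ is the half-sum of all positive roots. For a module $M$ over a complex reductive finite-dimensional Lie algebra $\mathfrak{g}$, $\mathrm{Ann}(M)$ is its annihilator in the universal enveloping algebra $U(\mathfrak{g})$, and $\mathscr{L}(M,M)$ is the $U(\mathfrak{g})$-bimodule of all $\mathbb{C}$-linear endomorphisms $f$ of $M$ on which the adjoint action is locally finite, i.e. those $f$ lying in a finite-dimensional subspace of $\mathrm{End}_{\mathbb{C}}(M)$ stable under the adjoint action $(x.f)(m)=x(f(m))-f(xm)$, $x\in\mathfrak{g}$, $m\in M$. The action of $U(\mathfrak{g})$ on $M$ induces the natural injection $U(\mathfrak{g})/\mathrm{Ann}(M)\hookrightarrow\mathscr{L}(M,M)$; Kostant's problem for $M$ asks whether this injection is surjective. *)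

theory Defs
  imports
    "HOL-Analysis.Analysis"
    "HOL-Library.Poly_Mapping"
    "HOL-Library.Function_Algebras"
begin

section \<open>Complex Lie algebras\<close>

class complex_lie_algebra = ab_group_add +
  fixes lie_scale :: "complex \<Rightarrow> 'a \<Rightarrow> 'a"
    and lie_bracket :: "'a \<Rightarrow> 'a \<Rightarrow> 'a"
  assumes lie_scale_right_distrib: "lie_scale c (x + y) = lie_scale c x + lie_scale c y"
    and lie_scale_left_distrib: "lie_scale (c + d) x = lie_scale c x + lie_scale d x"
    and lie_scale_scale: "lie_scale c (lie_scale d x) = lie_scale (c * d) x"
    and lie_scale_one: "lie_scale 1 x = x"
    and bracket_add_left: "lie_bracket (x + y) z = lie_bracket x z + lie_bracket y z"
    and bracket_add_right: "lie_bracket x (y + z) = lie_bracket x y + lie_bracket x z"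
    and bracket_scale_left: "lie_bracket (lie_scale c x) y = lie_scale c (lie_bracket x y)"
    and bracket_scale_right: "lie_bracket x (lie_scale c y) = lie_scale c (lie_bracket x y)"
    and bracket_self: "lie_bracket x x = 0"
    and jacobi: "lie_bracket x (lie_bracket y z) + lie_bracket y (lie_bracket z x)
                   + lie_bracket z (lie_bracket x y) = 0"


section \<open>The universal enveloping algebra\<close>

text \<open>
  The free unital associative algebra on the underlying set of a Lie algebra is the monoid
  algebra of words.  The monoid of words is written additively because this is how
  \<^type>\<open>poly_mapping\<close> obtains its convolution product.
\<close>

datatype 'g word = Word (letters: "'g list")

instantiation word :: (type) monoid_add
begin
definition zero_word :: "'a word" where "0 = Word []"
definition plus_word :: "'a word \<Rightarrow> 'a word \<Rightarrow> 'a word"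
  where "u + v = Word (letters u @ letters v)"
instance by standard (simp_all add: zero_word_def plus_word_def)
end

type_synonym 'g free_alg = "'g word \<Rightarrow>\<^sub>0 complex"

definition free_const :: "complex \<Rightarrow> 'g free_alg"
  where "free_const c = Poly_Mapping.single 0 c"

definition free_gen :: "'g \<Rightarrow> 'g free_alg"
  where "free_gen x = Poly_Mapping.single (Word [x]) 1"

text \<open>
  The first two families of relations make the generators depend linearly on the element of the
  Lie algebra, so that the quotient by them is the tensor algebra.
\<close>

inductive_set uea_relations :: "'g::complex_lie_algebra free_alg set" where
  add: "free_gen (x + y) - (free_gen x + free_gen y) \<in> uea_relations"
| scale: "free_gen (lie_scale c x) - free_const c * free_gen x \<in> uea_relations"
| bracket: "free_gen x * free_gen y - free_gen y * free_gen x - free_gen (lie_bracket x y)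
              \<in> uea_relations"

inductive_set uea_ideal :: "'g::complex_lie_algebra free_alg set" where
  zero: "0 \<in> uea_ideal"
| add: "p \<in> uea_ideal \<Longrightarrow> q \<in> uea_ideal \<Longrightarrow> p + q \<in> uea_ideal"
| gen: "g \<in> uea_relations \<Longrightarrow> a * g * b \<in> uea_ideal"

lemma uea_ideal_mult:
  assumes "p \<in> uea_ideal"
  shows "a * p * b \<in> uea_ideal"
  using assms
proof induction
  case zero
  then show ?case by (simp add: uea_ideal.zero)
next
  case (add p q)
  then show ?case by (simp add: algebra_simps uea_ideal.add)
next
  case (gen g c d)
  then show ?case using uea_ideal.gen[of g "a * c" "d * b"] by (simp add: mult.assoc)
qed

lemma uea_ideal_minus: "p \<in> uea_ideal \<Longrightarrow> - p \<in> uea_ideal"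
  using uea_ideal_mult[of p "- 1" 1] by simp

lemma uea_ideal_diff: "p \<in> uea_ideal \<Longrightarrow> q \<in> uea_ideal \<Longrightarrow> p - q \<in> uea_ideal"
  using uea_ideal.add[of p "- q"] uea_ideal_minus[of q] by simp

definition uea_rel :: "'g::complex_lie_algebra free_alg \<Rightarrow> 'g free_alg \<Rightarrow> bool"
  where "uea_rel p q \<longleftrightarrow> p - q \<in> uea_ideal"

lemma equivp_uea_rel: "equivp uea_rel"
proof (rule equivpI)
  show "reflp uea_rel"
    by (simp add: reflp_def uea_rel_def uea_ideal.zero)
  show "symp uea_rel"
    using uea_ideal_minus by (fastforce simp: symp_def uea_rel_def)
  show "transp uea_rel"
    using uea_ideal.add by (fastforce simp: transp_def uea_rel_def)
qed

quotient_type (overloaded) 'g uea = "'g::complex_lie_algebra free_alg" / uea_rel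
  by (rule equivp_uea_rel)

instantiation uea :: (complex_lie_algebra) ring
begin

lift_definition zero_uea :: "'a uea" is 0 .

lift_definition plus_uea :: "'a uea \<Rightarrow> 'a uea \<Rightarrow> 'a uea" is "(+)"
  unfolding uea_rel_def by (metis add_diff_add uea_ideal.add)

lift_definition minus_uea :: "'a uea \<Rightarrow> 'a uea \<Rightarrow> 'a uea" is "(-)"
proof -
  fix p p' q q' :: "'a free_alg"
  assume *: "uea_rel p p'" "uea_rel q q'"
  have "(p - q) - (p' - q') = (p - p') - (q - q')" by simp
  with * show "uea_rel (p - q) (p' - q')"
    unfolding uea_rel_def by (metis uea_ideal_diff)
qed

lift_definition uminus_uea :: "'a uea \<Rightarrow> 'a uea" is uminus
proof -
  fix p q :: "'a free_alg"
  assume "uea_rel p q"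
  then show "uea_rel (- p) (- q)"
    unfolding uea_rel_def using uea_ideal_minus[of "p - q"] by simp
qed

lift_definition times_uea :: "'a uea \<Rightarrow> 'a uea \<Rightarrow> 'a uea" is "(*)"
proof -
  fix p p' q q' :: "'a free_alg"
  assume *: "uea_rel p p'" "uea_rel q q'"
  have "p * q - p' * q' = 1 * (p - p') * q + p' * (q - q') * 1"
    by (simp add: algebra_simps)
  with * show "uea_rel (p * q) (p' * q')"
    unfolding uea_rel_def by (metis uea_ideal.add uea_ideal_mult)
qed

instance
  by standard (transfer; simp add: uea_rel_def algebra_simps uea_ideal.zero)+

end

instantiation uea :: (complex_lie_algebra) monoid_mult
begin
lift_definition one_uea :: "'a uea" is 1 .
instance
  by standard (transfer; simp add: uea_rel_def uea_ideal.zero mult.assoc)+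
end

lift_definition uea_const :: "complex \<Rightarrow> 'g::complex_lie_algebra uea" is free_const .

lift_definition uea_gen :: "'g::complex_lie_algebra \<Rightarrow> 'g uea" is free_gen .

lemma uea_gen_add: "uea_gen (x + y) = uea_gen x + uea_gen y"
  by transfer
    (use uea_ideal.gen[OF uea_relations.add, of 1 _ _ 1] in \<open>simp add: uea_rel_def\<close>)

lemma uea_gen_scale: "uea_gen (lie_scale c x) = uea_const c * uea_gen x"
  by transfer
    (use uea_ideal.gen[OF uea_relations.scale, of 1 _ _ 1] in \<open>simp add: uea_rel_def\<close>)

lemma uea_gen_bracket: "uea_gen (lie_bracket x y) = uea_gen x * uea_gen y - uea_gen y * uea_gen x"
proof -
  have "uea_gen x * uea_gen y - uea_gen y * uea_gen x = uea_gen (lie_bracket x y)"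
    by transfer
      (use uea_ideal.gen[OF uea_relations.bracket, of 1 _ _ 1] in \<open>simp add: uea_rel_def\<close>)
  then show ?thesis ..
qed


section \<open>Modules over Lie algebras\<close>

locale lie_module = vector_space scale
  for scale :: "complex \<Rightarrow> 'v::ab_group_add \<Rightarrow> 'v" +
  fixes act :: "'g::complex_lie_algebra \<Rightarrow> 'v \<Rightarrow> 'v"
  assumes act_add_right: "act x (v + w) = act x v + act x w"
    and act_scale_right: "act x (scale c v) = scale c (act x v)"
    and act_add_left: "act (x + y) v = act x v + act y v"
    and act_scale_left: "act (lie_scale c x) v = scale c (act x v)"
    and act_bracket: "act (lie_bracket x y) v = act x (act y v) - act y (act x v)"
begin

definition word_act :: "'g word \<Rightarrow> 'v \<Rightarrow> 'v"
  where "word_act w v = foldr act (letters w) v"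

definition free_act :: "'g free_alg \<Rightarrow> 'v \<Rightarrow> 'v"
  where "free_act p v = (\<Sum>w\<in>Poly_Mapping.keys p. scale (Poly_Mapping.lookup p w) (word_act w v))"

text \<open>
  The action of the universal enveloping algebra.  By \<open>uea_act_abs\<close> below it does not depend on the
  representative chosen by \<open>rep_uea\<close>.
\<close>

definition uea_act :: "'g uea \<Rightarrow> 'v \<Rightarrow> 'v"
  where "uea_act u = free_act (rep_uea u)"

definition submodule :: "'v set \<Rightarrow> bool"
  where "submodule N \<longleftrightarrow> subspace N \<and> (\<forall>x. \<forall>v\<in>N. act x v \<in> N)"

definition simple_module :: bool
  where "simple_module \<longleftrightarrow>
    (UNIV :: 'v set) \<noteq> {0} \<and> (\<forall>N. submodule N \<longrightarrow> N = {0} \<or> N = UNIV)"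

definition Ann :: "'g uea set"
  where "Ann = {u. \<forall>v. uea_act u v = 0}"

definition ad :: "'g \<Rightarrow> ('v \<Rightarrow> 'v) \<Rightarrow> 'v \<Rightarrow> 'v"
  where "ad x f = (\<lambda>m. act x (f m) - f (act x m))"

definition End :: "('v \<Rightarrow> 'v) set"
  where "End = {f. Vector_Spaces.linear scale scale f}"

definition End_scale :: "complex \<Rightarrow> ('v \<Rightarrow> 'v) \<Rightarrow> 'v \<Rightarrow> 'v"
  where "End_scale c f = (\<lambda>v. scale c (f v))"

definition finite_dim_subspace_of_End :: "('v \<Rightarrow> 'v) set \<Rightarrow> bool"
  where "finite_dim_subspace_of_End S \<longleftrightarrow>
    S \<subseteq> End \<and> (\<exists>B. finite B \<and> S = module.span End_scale B)"

definition locally_finite_End :: "('v \<Rightarrow> 'v) set"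
  where "locally_finite_End =
    {f \<in> End. \<exists>S. finite_dim_subspace_of_End S \<and> (\<forall>x. \<forall>g\<in>S. ad x g \<in> S) \<and> f \<in> S}"

definition Ann_rel :: "('g uea \<times> 'g uea) set"
  where "Ann_rel = {(u, u'). u - u' \<in> Ann}"

definition uea_mod_Ann :: "'g uea set set"
  where "uea_mod_Ann = UNIV // Ann_rel"

text \<open>
  All elements of a coset of \<open>Ann\<close> act by the same endomorphism (\<open>natural_map_coset\<close> below), which is
  the value of the natural map at this coset.
\<close>

definition natural_map :: "'g uea set \<Rightarrow> 'v \<Rightarrow> 'v"
  where "natural_map C = the_elem (uea_act ` C)"

definition kostant_positive :: bool
  where "kostant_positive \<longleftrightarrow>
    (\<forall>f\<in>locally_finite_End. \<exists>C\<in>uea_mod_Ann. natural_map C = f)"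

lemma End_vector_space: "vector_space End_scale"
  by unfold_locales
    (auto simp: End_scale_def fun_eq_iff scale_right_distrib scale_left_distrib)

lemma act_zero_right [simp]: "act x 0 = 0"
  using act_add_right[of x 0 0] by simp

lemma word_act_plus: "word_act (u + w) v = word_act u (word_act w v)"
  by (simp add: word_act_def plus_word_def)

lemma word_act_add: "word_act w (v + v') = word_act w v + word_act w v'"
proof -
  have "foldr act xs (v + v') = foldr act xs v + foldr act xs v'" for xs
    by (induction xs) (simp_all add: act_add_right)
  then show ?thesis by (simp add: word_act_def)
qed

lemma word_act_scale: "word_act w (scale c v) = scale c (word_act w v)"
proof -
  have "foldr act xs (scale c v) = scale c (foldr act xs v)" for xs
    by (induction xs) (simp_all add: act_scale_right)
  then show ?thesis by (simp add: word_act_def)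
qed

lemma free_act_superset:
  assumes "finite K" "Poly_Mapping.keys p \<subseteq> K"
  shows "free_act p v = (\<Sum>w\<in>K. scale (Poly_Mapping.lookup p w) (word_act w v))"
  unfolding free_act_def
  by (rule sum.mono_neutral_left) (use assms in \<open>auto simp: in_keys_iff\<close>)

lemma free_act_single: "free_act (Poly_Mapping.single w c) v = scale c (word_act w v)"
  by (cases "c = 0") (simp_all add: free_act_def)

lemma free_act_zero [simp]: "free_act 0 v = 0"
  by (simp add: free_act_def)

lemma free_act_add: "free_act (p + q) v = free_act p v + free_act q v"
proof -
  let ?K = "Poly_Mapping.keys p \<union> Poly_Mapping.keys q"
  have "free_act (p + q) v = (\<Sum>w\<in>?K. scale (Poly_Mapping.lookup (p + q) w) (word_act w v))"
    by (rule free_act_superset) (use keys_add[of p q] in auto)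
  also have "\<dots> = free_act p v + free_act q v"
    by (simp add: lookup_add scale_left_distrib sum.distrib
        free_act_superset[of ?K p] free_act_superset[of ?K q])
  finally show ?thesis .
qed

lemma free_act_diff: "free_act (p - q) v = free_act p v - free_act q v"
  using free_act_add[of "p - q" q v] by simp

lemma free_act_linear:
  "free_act p (v + w) = free_act p v + free_act p w"
  "free_act p (scale c v) = scale c (free_act p v)"
  by (simp_all add: free_act_def word_act_add word_act_scale scale_right_distrib sum.distrib
      scale_sum_right mult.commute)

lemma free_alg_induct [case_names single add]:
  fixes p :: "'g free_alg"
  assumes single: "\<And>w c. P (Poly_Mapping.single w c)"
    and add: "\<And>p q. P p \<Longrightarrow> P q \<Longrightarrow> P (p + q)"
  shows "P p"
proof -
  have "P (\<Sum>w\<in>K. Poly_Mapping.single w (Poly_Mapping.lookup p w))" if "finite K" for K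
    using that
  proof induction
    case empty
    show ?case using single[of 0 0] by simp
  next
    case (insert w K)
    then show ?case by (simp add: add single)
  qed
  moreover have "(\<Sum>w\<in>Poly_Mapping.keys p. Poly_Mapping.single w (Poly_Mapping.lookup p w)) = p"
    by (rule poly_mapping_eqI)
      (simp add: lookup_sum lookup_single when_def in_keys_iff)
  ultimately show ?thesis by (metis finite_keys)
qed

lemma free_act_mult: "free_act (p * q) v = free_act p (free_act q v)"
proof (induction p rule: free_alg_induct)
  case (single w c)
  show ?case
  proof (induction q rule: free_alg_induct)
    case (single w' c')
    show ?case
      by (simp add: mult_single free_act_single word_act_plus word_act_scale)
  next
    case (add p q)
    then show ?case by (simp add: distrib_left free_act_add free_act_linear)
  qed
next
  case (add p q)
  then show ?case by (simp add: distrib_right free_act_add)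
qed

lemma free_act_gen: "free_act (free_gen x) v = act x v"
  by (simp add: free_gen_def free_act_single word_act_def)

lemma free_act_const: "free_act (free_const c) v = scale c v"
  by (simp add: free_const_def free_act_single word_act_def zero_word_def)

lemma free_act_relations: "p \<in> uea_relations \<Longrightarrow> free_act p v = 0"
  by (induction rule: uea_relations.induct)
    (simp_all add: free_act_diff free_act_add free_act_mult free_act_gen free_act_const
      act_add_left act_scale_left act_bracket)

lemma free_act_zero_right [simp]: "free_act p 0 = 0"
  using free_act_linear(1)[of p 0 0] by simp

lemma free_act_ideal: "p \<in> uea_ideal \<Longrightarrow> free_act p v = 0"
  by (induction arbitrary: v rule: uea_ideal.induct)
    (simp_all add: free_act_add free_act_mult free_act_relations)

lemma uea_act_abs: "uea_act (abs_uea p) = free_act p"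
proof
  fix v
  have "uea_rel (rep_uea (abs_uea p)) p"
    by (rule Quotient_rep_abs[OF Quotient_uea]) (simp add: uea_rel_def uea_ideal.zero)
  then have "free_act (rep_uea (abs_uea p) - p) v = 0"
    by (simp add: uea_rel_def free_act_ideal)
  then show "uea_act (abs_uea p) v = free_act p v"
    by (simp add: uea_act_def free_act_diff)
qed

lemma uea_act_gen: "uea_act (uea_gen x) v = act x v"
  by (simp add: uea_gen.abs_eq uea_act_abs free_act_gen)

lemma uea_act_const: "uea_act (uea_const c) v = scale c v"
  by (simp add: uea_const.abs_eq uea_act_abs free_act_const)

lemma uea_act_one: "uea_act 1 v = v"
  using free_act_const[of 1 v]
  by (simp add: one_uea.abs_eq uea_act_abs free_const_def)

lemma uea_act_add: "uea_act (a + b) v = uea_act a v + uea_act b v"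
  by (induction a; induction b) (simp add: plus_uea.abs_eq uea_act_abs free_act_add)

lemma uea_act_diff: "uea_act (a - b) v = uea_act a v - uea_act b v"
  by (induction a; induction b) (simp add: minus_uea.abs_eq uea_act_abs free_act_diff)

lemma uea_act_mult: "uea_act (a * b) v = uea_act a (uea_act b v)"
  by (induction a; induction b) (simp add: times_uea.abs_eq uea_act_abs free_act_mult)

lemma Ann_rel_iff: "(a, b) \<in> Ann_rel \<longleftrightarrow> uea_act a = uea_act b"
  by (auto simp: Ann_rel_def Ann_def uea_act_diff)

lemma natural_map_coset: "natural_map (Ann_rel `` {u}) = uea_act u"
proof -
  have "uea_act ` (Ann_rel `` {u}) = {uea_act u}"
    by (auto simp: Ann_rel_iff)
  then show ?thesis by (simp add: natural_map_def)
qed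

lemma inj_on_natural_map: "inj_on natural_map uea_mod_Ann"
proof (rule inj_onI)
  fix C D
  assume "C \<in> uea_mod_Ann" "D \<in> uea_mod_Ann" and *: "natural_map C = natural_map D"
  then obtain u w where "C = Ann_rel `` {u}" "D = Ann_rel `` {w}"
    by (auto simp: uea_mod_Ann_def quotient_def)
  with * show "C = D"
    by (auto simp: natural_map_coset Ann_rel_iff)
qed

end


section \<open>The special linear Lie algebra\<close>

typedef 'n sl = "{A :: complex^'n^'n. trace A = 0}"
  morphisms sl_mat Abs_sl
  by (rule exI[of _ 0]) (simp add: trace_def)

lemma matrix_add_rdistrib: "(A + B) ** C = A ** C + B ** (C :: 'a::semiring_1^_^_)"
  by (simp add: vec_eq_iff matrix_matrix_mult_def distrib_right sum.distrib)

lemma matrix_diff_ldistrib: "C ** (A - B) = C ** A - C ** (B :: 'a::ring_1^_^_)"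
  by (simp add: vec_eq_iff matrix_matrix_mult_def right_diff_distrib sum_subtractf)

lemma matrix_diff_rdistrib: "(A - B) ** C = A ** C - B ** (C :: 'a::ring_1^_^_)"
  by (simp add: vec_eq_iff matrix_matrix_mult_def left_diff_distrib sum_subtractf)

setup_lifting type_definition_sl

instantiation sl :: (finite) complex_lie_algebra
begin

lift_definition zero_sl :: "'a sl" is 0
  by (simp add: trace_def)

lift_definition plus_sl :: "'a sl \<Rightarrow> 'a sl \<Rightarrow> 'a sl" is "(+)"
  by (simp add: trace_add)

lift_definition minus_sl :: "'a sl \<Rightarrow> 'a sl \<Rightarrow> 'a sl" is "(-)"
  by (simp add: trace_sub)

lift_definition uminus_sl :: "'a sl \<Rightarrow> 'a sl" is uminus
  by (simp add: trace_def sum_negf)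

lift_definition lie_scale_sl :: "complex \<Rightarrow> 'a sl \<Rightarrow> 'a sl" is "\<lambda>c A. \<chi> i j. c * A $ i $ j"
  by (simp add: trace_def flip: sum_distrib_left)

lift_definition lie_bracket_sl :: "'a sl \<Rightarrow> 'a sl \<Rightarrow> 'a sl" is "\<lambda>A B. A ** B - B ** A"
  by (simp only: trace_sub) (subst trace_mul_sym, simp)

instance
proof
  fix x y z :: "'a sl" and c d :: complex
  show "x + y + z = x + (y + z)" "x + y = y + x" "0 + x = x" "- x + x = 0" "x - y = x + - y"
    by (transfer; simp)+
  show "lie_scale c (x + y) = lie_scale c x + lie_scale c y"
    "lie_scale (c + d) x = lie_scale c x + lie_scale d x"
    "lie_scale c (lie_scale d x) = lie_scale (c * d) x"
    "lie_scale 1 x = x"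
    by (transfer; simp add: vec_eq_iff algebra_simps)+
  show "lie_bracket (x + y) z = lie_bracket x z + lie_bracket y z"
    "lie_bracket x (y + z) = lie_bracket x y + lie_bracket x z"
    by (transfer; simp add: matrix_add_ldistrib matrix_add_rdistrib)+
  show "lie_bracket (lie_scale c x) y = lie_scale c (lie_bracket x y)"
    "lie_bracket x (lie_scale c y) = lie_scale c (lie_bracket x y)"
    by (transfer;
        simp add: vec_eq_iff matrix_matrix_mult_def right_diff_distrib sum_distrib_left mult.left_commute
          mult.assoc)+
  show "lie_bracket x x = 0"
    by (transfer; simp)
  show "lie_bracket x (lie_bracket y z) + lie_bracket y (lie_bracket z x)
          + lie_bracket z (lie_bracket x y) = 0"
  proof transfer
    fix A B C :: "complex^'a^'a"
    show "A ** (B ** C - C ** B) - (B ** C - C ** B) ** A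
        + (B ** (C ** A - A ** C) - (C ** A - A ** C) ** B)
        + (C ** (A ** B - B ** A) - (A ** B - B ** A) ** C) = 0"
      by (simp add: matrix_diff_ldistrib matrix_diff_rdistrib matrix_mul_assoc)
  qed
qed

end

text \<open>
  Weights are represented by coordinate vectors: \<open>mu\<close> stands for the linear form
  \<open>diag(h\<^sub>i) \<mapsto> (\<Sum>i. mu\<^sub>i h\<^sub>i)\<close> on the diagonal Cartan subalgebra.
\<close>

definition diagonal_sl :: "'n::finite sl \<Rightarrow> bool"
  where "diagonal_sl h \<longleftrightarrow> (\<forall>i j. i \<noteq> j \<longrightarrow> sl_mat h $ i $ j = 0)"

definition strictly_upper_sl :: "'n::{finite,linorder} sl \<Rightarrow> bool"
  where "strictly_upper_sl x \<longleftrightarrow> (\<forall>i j. \<not> i < j \<longrightarrow> sl_mat x $ i $ j = 0)"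

definition weight_eval :: "complex^'n \<Rightarrow> 'n::finite sl \<Rightarrow> complex"
  where "weight_eval mu h = (\<Sum>i\<in>UNIV. mu $ i * sl_mat h $ i $ i)"

definition positive_roots :: "(complex^'n::{finite,linorder}) set"
  where "positive_roots = {axis i 1 - axis j 1 | i j. i < j}"

definition half_sum_positive_roots :: "complex^'n::{finite,linorder}"
  where "half_sum_positive_roots = (1 / 2) *s (\<Sum>\<alpha>\<in>positive_roots. \<alpha>)"

definition weyl_act :: "('n \<Rightarrow> 'n) \<Rightarrow> complex^'n \<Rightarrow> complex^'n"
  where "weyl_act w mu = (\<chi> i. mu $ (inv w i))"

definition highest_weight_module ::
    "(complex \<Rightarrow> 'v::ab_group_add \<Rightarrow> 'v) \<Rightarrow> ('n sl \<Rightarrow> 'v \<Rightarrow> 'v) \<Rightarrow> complex^'n::{finite,linorder} \<Rightarrow> bool"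
  where "highest_weight_module scl act mu \<longleftrightarrow>
    lie_module scl act \<and>
    (\<exists>v. v \<noteq> 0 \<and>
         (\<forall>x. strictly_upper_sl x \<longrightarrow> act x v = 0) \<and>
         (\<forall>h. diagonal_sl h \<longrightarrow> act h v = scl (weight_eval mu h) v) \<and>
         (\<forall>m. \<exists>u. m = lie_module.uea_act scl act u v))"

definition simple_highest_weight_module ::
    "(complex \<Rightarrow> 'v::ab_group_add \<Rightarrow> 'v) \<Rightarrow> ('n sl \<Rightarrow> 'v \<Rightarrow> 'v) \<Rightarrow> complex^'n::{finite,linorder} \<Rightarrow> bool"
  where "simple_highest_weight_module scl act mu \<longleftrightarrow>
    highest_weight_module scl act mu \<and> lie_module.simple_module scl act"

text \<open>
  The index type \<^typ>\<open>4\<close> consists of \<open>0 < 1 < 2 < 3\<close>, so that \<open>i\<close> stands for the coordinate \<open>i + 1\<close>.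
\<close>

definition refl_r :: "4 \<Rightarrow> 4" where "refl_r = Transposition.transpose 0 1"
definition refl_s :: "4 \<Rightarrow> 4" where "refl_s = Transposition.transpose 1 2"
definition refl_t :: "4 \<Rightarrow> 4" where "refl_t = Transposition.transpose 2 3"

end

theory Submission
  imports Defs
begin

text \<open>
  The highest weight is \<open>\<lambda> = (-1, 1, -1, 1)\<close>.  The module \<open>L\<close> has an endomorphism \<open>f\<close> that is a
  lowest weight vector, of weight \<open>(-1, -1, -1, 3)\<close>, of a copy of \<open>S\<^sup>4(\<complex>\<^sup>4) \<otimes> det\<^sup>-\<^sup>1\<close> in
  \<open>End(L)\<close> under the adjoint action.  It is a fraction \<open>f = c\<^sup>-\<^sup>1 \<theta>\<^sup>2\<close> of two elements of \<open>U(sl\<^sub>4)\<close>: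
  \<open>c = E31 E42 - E32 E41\<close> is central in \<open>U(n\<^sub>-)\<close> and acts injectively on \<open>L\<close>, the cubic element \<open>\<theta>\<close>
  commutes with \<open>n\<^sub>-\<close>, and \<open>\<theta>\<^sup>2 L \<subseteq> c L\<close> follows from \<open>\<theta>\<^sup>2 v\<^sub>0 = c q\<close> for an explicit
  vector \<open>q\<close>.  As \<open>f\<close> commutes with \<open>n\<^sub>-\<close>, \<open>E12\<close> and \<open>E23\<close>, it generates a finite-dimensional module.

  If \<open>f\<close> were the action of some \<open>u\<close> in \<open>U(sl\<^sub>4)\<close>, then \<open>u\<close> would act on the localization of \<open>L\<close> at
  \<open>E21\<close>, commuting with \<open>E21\<close>, and map \<open>v\<^sub>1 = E21\<^sup>-\<^sup>1 v\<^sub>0\<close> to \<open>E21\<^sup>-\<^sup>1 q\<close>.  But \<open>v\<^sub>1\<close> is again a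
  highest weight vector, and the submodule it generates contains no nonzero vector of the weight
  of \<open>E21\<^sup>-\<^sup>1 q\<close> that is killed by \<open>E12\<close> and \<open>E23\<close>, as \<open>E21\<^sup>-\<^sup>1 q\<close> is.
\<close>

section \<open>Matrix units\<close>

lemma exhaust_index: "(i::4) = 0 \<or> i = 1 \<or> i = 2 \<or> i = 3"
  using exhaust_4[of i] by auto

lemma all_index: "(\<forall>i::4. P i) \<longleftrightarrow> P 0 \<and> P 1 \<and> P 2 \<and> P 3"
  by (metis exhaust_index)

lemma ex_index: "(\<exists>i::4. P i) \<longleftrightarrow> P 0 \<or> P 1 \<or> P 2 \<or> P 3"
  by (metis exhaust_index)

lemma sum_index: "sum f (UNIV :: 4 set) = f 0 + f 1 + f 2 + f 3"
proof -
  have *: "(UNIV :: 4 set) = {0, 1, 2, 3}" using exhaust_index by auto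
  show ?thesis by (subst *) (simp add: add.assoc)
qed

lemma less_index: "(0::4) < 1" "(0::4) < 2" "(0::4) < 3" "(1::4) < 2" "(1::4) < 3" "(2::4) < 3"
  "\<not> (1::4) < 0" "\<not> (2::4) < 0" "\<not> (3::4) < 0" "\<not> (2::4) < 1" "\<not> (3::4) < 1" "\<not> (3::4) < 2"
  by (simp_all add: less_bit0_def bit0.Rep_numeral bit0.Rep_0 bit0.Rep_1)

lift_definition matrix_unit :: "'n::finite \<Rightarrow> 'n \<Rightarrow> 'n sl"
  is "\<lambda>i j. if i = j then 0 else (\<chi> k l. if k = i \<and> l = j then 1 else 0)"
  by (auto simp: trace_def intro!: sum.neutral)

lift_definition coroot :: "'n::finite \<Rightarrow> 'n \<Rightarrow> 'n sl"
  is "\<lambda>i j. \<chi> k l. if k = l then (if k = i then 1 else 0) - (if k = j then 1 else 0) else 0"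
  by (simp add: trace_def sum_subtractf)

definition "E12 = (matrix_unit 0 1 :: 4 sl)"
definition "E13 = (matrix_unit 0 2 :: 4 sl)"
definition "E14 = (matrix_unit 0 3 :: 4 sl)"
definition "E23 = (matrix_unit 1 2 :: 4 sl)"
definition "E24 = (matrix_unit 1 3 :: 4 sl)"
definition "E34 = (matrix_unit 2 3 :: 4 sl)"
definition "E21 = (matrix_unit 1 0 :: 4 sl)"
definition "E31 = (matrix_unit 2 0 :: 4 sl)"
definition "E41 = (matrix_unit 3 0 :: 4 sl)"
definition "E32 = (matrix_unit 2 1 :: 4 sl)"
definition "E42 = (matrix_unit 3 1 :: 4 sl)"
definition "E43 = (matrix_unit 3 2 :: 4 sl)"
definition "H1 = (coroot 0 1 :: 4 sl)"
definition "H2 = (coroot 1 2 :: 4 sl)"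
definition "H3 = (coroot 2 3 :: 4 sl)"

lemmas basis_defs = E12_def E13_def E14_def E23_def E24_def E34_def E21_def E31_def E41_def
  E32_def E42_def E43_def H1_def H2_def H3_def

text \<open>The coroot coefficients are the partial sums of the diagonal; the third is written
  \<open>- m $ 3 $ 3\<close> by tracelessness.\<close>

lemma sl_basis_expansion:
  "x = (let m = sl_mat x in
     lie_scale (m $ 0 $ 1) E12 + lie_scale (m $ 0 $ 2) E13 + lie_scale (m $ 0 $ 3) E14
     + lie_scale (m $ 1 $ 2) E23 + lie_scale (m $ 1 $ 3) E24 + lie_scale (m $ 2 $ 3) E34
     + lie_scale (m $ 1 $ 0) E21 + lie_scale (m $ 2 $ 0) E31 + lie_scale (m $ 3 $ 0) E41
     + lie_scale (m $ 2 $ 1) E32 + lie_scale (m $ 3 $ 1) E42 + lie_scale (m $ 3 $ 2) E43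
     + lie_scale (m $ 0 $ 0) H1 + lie_scale (m $ 0 $ 0 + m $ 1 $ 1) H2
     + lie_scale (- m $ 3 $ 3) H3)"
  unfolding basis_defs Let_def
  by transfer (auto simp: vec_eq_iff all_index trace_def sum_index add_eq_0_iff)

lemma bracket_table:
  "lie_bracket E32 E31 = 0"
  "lie_bracket E41 E31 = 0"
  "lie_bracket E41 E32 = 0"
  "lie_bracket E42 E31 = 0"
  "lie_bracket E42 E32 = 0"
  "lie_bracket E42 E41 = 0"
  "lie_bracket E21 E31 = 0"
  "lie_bracket E21 E32 = - E31"
  "lie_bracket E21 E41 = 0"
  "lie_bracket E21 E42 = - E41"
  "lie_bracket E43 E31 = E41"
  "lie_bracket E43 E32 = E42"
  "lie_bracket E43 E41 = 0"
  "lie_bracket E43 E42 = 0"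
  "lie_bracket E43 E21 = 0"
  "lie_bracket H1 E31 = - E31"
  "lie_bracket H1 E32 = E32"
  "lie_bracket H1 E41 = - E41"
  "lie_bracket H1 E42 = E42"
  "lie_bracket H1 E21 = - lie_scale 2 E21"
  "lie_bracket H1 E43 = 0"
  "lie_bracket H2 E31 = - E31"
  "lie_bracket H2 E32 = - lie_scale 2 E32"
  "lie_bracket H2 E41 = 0"
  "lie_bracket H2 E42 = - E42"
  "lie_bracket H2 E21 = E21"
  "lie_bracket H2 E43 = E43"
  "lie_bracket H2 H1 = 0"
  "lie_bracket H3 E31 = E31"
  "lie_bracket H3 E32 = E32"
  "lie_bracket H3 E41 = - E41"
  "lie_bracket H3 E42 = - E42"
  "lie_bracket H3 E21 = 0"
  "lie_bracket H3 E43 = - lie_scale 2 E43"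
  "lie_bracket H3 H1 = 0"
  "lie_bracket H3 H2 = 0"
  "lie_bracket E13 E31 = H1 + H2"
  "lie_bracket E13 E32 = E12"
  "lie_bracket E13 E41 = - E43"
  "lie_bracket E13 E42 = 0"
  "lie_bracket E13 E21 = - E23"
  "lie_bracket E13 E43 = 0"
  "lie_bracket E13 H1 = - E13"
  "lie_bracket E13 H2 = - E13"
  "lie_bracket E13 H3 = E13"
  "lie_bracket E14 E31 = - E34"
  "lie_bracket E14 E32 = 0"
  "lie_bracket E14 E41 = H1 + H2 + H3"
  "lie_bracket E14 E42 = E12"
  "lie_bracket E14 E21 = - E24"
  "lie_bracket E14 E43 = E13"
  "lie_bracket E14 H1 = - E14"
  "lie_bracket E14 H2 = 0"
  "lie_bracket E14 H3 = - E14"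
  "lie_bracket E14 E13 = 0"
  "lie_bracket E24 E31 = 0"
  "lie_bracket E24 E32 = - E34"
  "lie_bracket E24 E41 = E21"
  "lie_bracket E24 E42 = H2 + H3"
  "lie_bracket E24 E21 = 0"
  "lie_bracket E24 E43 = E23"
  "lie_bracket E24 H1 = E24"
  "lie_bracket E24 H2 = - E24"
  "lie_bracket E24 H3 = - E24"
  "lie_bracket E24 E13 = 0"
  "lie_bracket E24 E14 = 0"
  "lie_bracket E12 E31 = - E32"
  "lie_bracket E12 E32 = 0"
  "lie_bracket E12 E41 = - E42"
  "lie_bracket E12 E42 = 0"
  "lie_bracket E12 E21 = H1"
  "lie_bracket E12 E43 = 0"
  "lie_bracket E12 H1 = - lie_scale 2 E12"
  "lie_bracket E12 H2 = E12"
  "lie_bracket E12 H3 = 0"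
  "lie_bracket E12 E13 = 0"
  "lie_bracket E12 E14 = 0"
  "lie_bracket E12 E24 = E14"
  "lie_bracket E23 E31 = E21"
  "lie_bracket E23 E32 = H2"
  "lie_bracket E23 E41 = 0"
  "lie_bracket E23 E42 = - E43"
  "lie_bracket E23 E21 = 0"
  "lie_bracket E23 E43 = 0"
  "lie_bracket E23 H1 = E23"
  "lie_bracket E23 H2 = - lie_scale 2 E23"
  "lie_bracket E23 H3 = E23"
  "lie_bracket E23 E13 = 0"
  "lie_bracket E23 E14 = 0"
  "lie_bracket E23 E24 = 0"
  "lie_bracket E23 E12 = - E13"
  "lie_bracket E34 E31 = 0"
  "lie_bracket E34 E32 = 0"
  "lie_bracket E34 E41 = E31"
  "lie_bracket E34 E42 = E32"
  "lie_bracket E34 E21 = 0"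
  "lie_bracket E34 E43 = H3"
  "lie_bracket E34 H1 = 0"
  "lie_bracket E34 H2 = E34"
  "lie_bracket E34 H3 = - lie_scale 2 E34"
  "lie_bracket E34 E13 = - E14"
  "lie_bracket E34 E14 = 0"
  "lie_bracket E34 E24 = 0"
  "lie_bracket E34 E12 = 0"
  "lie_bracket E34 E23 = - E24"
  unfolding basis_defs
  by (transfer; simp add: vec_eq_iff all_index matrix_matrix_mult_def sum_index)+

context lie_module
begin

lemma act_zero_left: "act 0 v = 0"
  using act_add_left[of 0 0 v] by simp

lemma act_minus_left: "act (- x) v = - act x v"
  using act_add_left[of x "- x" v] by (simp add: act_zero_left eq_neg_iff_add_eq_0 add.commute)

lemma act_diff_left: "act (x - y) v = act x v - act y v"
  using act_add_left[of x "- y" v] by (simp add: act_minus_left)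

lemma act_minus_right: "act x (- v) = - act x v"
  using act_add_right[of x v "- v"] by (simp add: eq_neg_iff_add_eq_0 add.commute)

lemma act_diff_right: "act x (v - w) = act x v - act x w"
  using act_add_right[of x v "- w"] by (simp add: act_minus_right)

end

locale sl4_module = lie_module scale act
  for scale :: "complex \<Rightarrow> 'v::ab_group_add \<Rightarrow> 'v" and act :: "4 sl \<Rightarrow> 'v \<Rightarrow> 'v"
begin

lemmas act_linear = act_add_left act_add_right act_diff_left act_diff_right act_minus_left
  act_minus_right act_scale_left act_scale_right act_zero_left

lemma act_swap: "act x (act y v) = act y (act x v) + act (lie_bracket x y) v"
  by (simp add: act_bracket)

text \<open>Fix the order E31, E32, E41, E42, E21, E43, H1, H2, H3, E13, E14, E24, E12, E23, E34.
  There is one rule for each pair out of order, so rewriting brings every product to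
  Poincare-Birkhoff-Witt normal form: the raising elements reach a highest weight vector first, then
  the Cartan elements.\<close>

lemma normal_order:
  "act E32 (act E31 v) = act E31 (act E32 v)"
  "act E41 (act E31 v) = act E31 (act E41 v)"
  "act E41 (act E32 v) = act E32 (act E41 v)"
  "act E42 (act E31 v) = act E31 (act E42 v)"
  "act E42 (act E32 v) = act E32 (act E42 v)"
  "act E42 (act E41 v) = act E41 (act E42 v)"
  "act E21 (act E31 v) = act E31 (act E21 v)"
  "act E21 (act E32 v) = act E32 (act E21 v) - act E31 v"
  "act E21 (act E41 v) = act E41 (act E21 v)"
  "act E21 (act E42 v) = act E42 (act E21 v) - act E41 v"
  "act E43 (act E31 v) = act E31 (act E43 v) + act E41 v"
  "act E43 (act E32 v) = act E32 (act E43 v) + act E42 v"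
  "act E43 (act E41 v) = act E41 (act E43 v)"
  "act E43 (act E42 v) = act E42 (act E43 v)"
  "act E43 (act E21 v) = act E21 (act E43 v)"
  "act H1 (act E31 v) = act E31 (act H1 v) - act E31 v"
  "act H1 (act E32 v) = act E32 (act H1 v) + act E32 v"
  "act H1 (act E41 v) = act E41 (act H1 v) - act E41 v"
  "act H1 (act E42 v) = act E42 (act H1 v) + act E42 v"
  "act H1 (act E21 v) = act E21 (act H1 v) - scale 2 (act E21 v)"
  "act H1 (act E43 v) = act E43 (act H1 v)"
  "act H2 (act E31 v) = act E31 (act H2 v) - act E31 v"
  "act H2 (act E32 v) = act E32 (act H2 v) - scale 2 (act E32 v)"
  "act H2 (act E41 v) = act E41 (act H2 v)"
  "act H2 (act E42 v) = act E42 (act H2 v) - act E42 v"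
  "act H2 (act E21 v) = act E21 (act H2 v) + act E21 v"
  "act H2 (act E43 v) = act E43 (act H2 v) + act E43 v"
  "act H2 (act H1 v) = act H1 (act H2 v)"
  "act H3 (act E31 v) = act E31 (act H3 v) + act E31 v"
  "act H3 (act E32 v) = act E32 (act H3 v) + act E32 v"
  "act H3 (act E41 v) = act E41 (act H3 v) - act E41 v"
  "act H3 (act E42 v) = act E42 (act H3 v) - act E42 v"
  "act H3 (act E21 v) = act E21 (act H3 v)"
  "act H3 (act E43 v) = act E43 (act H3 v) - scale 2 (act E43 v)"
  "act H3 (act H1 v) = act H1 (act H3 v)"
  "act H3 (act H2 v) = act H2 (act H3 v)"
  "act E13 (act E31 v) = act E31 (act E13 v) + act H1 v + act H2 v"
  "act E13 (act E32 v) = act E32 (act E13 v) + act E12 v"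
  "act E13 (act E41 v) = act E41 (act E13 v) - act E43 v"
  "act E13 (act E42 v) = act E42 (act E13 v)"
  "act E13 (act E21 v) = act E21 (act E13 v) - act E23 v"
  "act E13 (act E43 v) = act E43 (act E13 v)"
  "act E13 (act H1 v) = act H1 (act E13 v) - act E13 v"
  "act E13 (act H2 v) = act H2 (act E13 v) - act E13 v"
  "act E13 (act H3 v) = act H3 (act E13 v) + act E13 v"
  "act E14 (act E31 v) = act E31 (act E14 v) - act E34 v"
  "act E14 (act E32 v) = act E32 (act E14 v)"
  "act E14 (act E41 v) = act E41 (act E14 v) + act H1 v + act H2 v + act H3 v"
  "act E14 (act E42 v) = act E42 (act E14 v) + act E12 v"
  "act E14 (act E21 v) = act E21 (act E14 v) - act E24 v"
  "act E14 (act E43 v) = act E43 (act E14 v) + act E13 v"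
  "act E14 (act H1 v) = act H1 (act E14 v) - act E14 v"
  "act E14 (act H2 v) = act H2 (act E14 v)"
  "act E14 (act H3 v) = act H3 (act E14 v) - act E14 v"
  "act E14 (act E13 v) = act E13 (act E14 v)"
  "act E24 (act E31 v) = act E31 (act E24 v)"
  "act E24 (act E32 v) = act E32 (act E24 v) - act E34 v"
  "act E24 (act E41 v) = act E41 (act E24 v) + act E21 v"
  "act E24 (act E42 v) = act E42 (act E24 v) + act H2 v + act H3 v"
  "act E24 (act E21 v) = act E21 (act E24 v)"
  "act E24 (act E43 v) = act E43 (act E24 v) + act E23 v"
  "act E24 (act H1 v) = act H1 (act E24 v) + act E24 v"
  "act E24 (act H2 v) = act H2 (act E24 v) - act E24 v"
  "act E24 (act H3 v) = act H3 (act E24 v) - act E24 v"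
  "act E24 (act E13 v) = act E13 (act E24 v)"
  "act E24 (act E14 v) = act E14 (act E24 v)"
  "act E12 (act E31 v) = act E31 (act E12 v) - act E32 v"
  "act E12 (act E32 v) = act E32 (act E12 v)"
  "act E12 (act E41 v) = act E41 (act E12 v) - act E42 v"
  "act E12 (act E42 v) = act E42 (act E12 v)"
  "act E12 (act E21 v) = act E21 (act E12 v) + act H1 v"
  "act E12 (act E43 v) = act E43 (act E12 v)"
  "act E12 (act H1 v) = act H1 (act E12 v) - scale 2 (act E12 v)"
  "act E12 (act H2 v) = act H2 (act E12 v) + act E12 v"
  "act E12 (act H3 v) = act H3 (act E12 v)"
  "act E12 (act E13 v) = act E13 (act E12 v)"
  "act E12 (act E14 v) = act E14 (act E12 v)"
  "act E12 (act E24 v) = act E24 (act E12 v) + act E14 v"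
  "act E23 (act E31 v) = act E31 (act E23 v) + act E21 v"
  "act E23 (act E32 v) = act E32 (act E23 v) + act H2 v"
  "act E23 (act E41 v) = act E41 (act E23 v)"
  "act E23 (act E42 v) = act E42 (act E23 v) - act E43 v"
  "act E23 (act E21 v) = act E21 (act E23 v)"
  "act E23 (act E43 v) = act E43 (act E23 v)"
  "act E23 (act H1 v) = act H1 (act E23 v) + act E23 v"
  "act E23 (act H2 v) = act H2 (act E23 v) - scale 2 (act E23 v)"
  "act E23 (act H3 v) = act H3 (act E23 v) + act E23 v"
  "act E23 (act E13 v) = act E13 (act E23 v)"
  "act E23 (act E14 v) = act E14 (act E23 v)"
  "act E23 (act E24 v) = act E24 (act E23 v)"
  "act E23 (act E12 v) = act E12 (act E23 v) - act E13 v"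
  "act E34 (act E31 v) = act E31 (act E34 v)"
  "act E34 (act E32 v) = act E32 (act E34 v)"
  "act E34 (act E41 v) = act E41 (act E34 v) + act E31 v"
  "act E34 (act E42 v) = act E42 (act E34 v) + act E32 v"
  "act E34 (act E21 v) = act E21 (act E34 v)"
  "act E34 (act E43 v) = act E43 (act E34 v) + act H3 v"
  "act E34 (act H1 v) = act H1 (act E34 v)"
  "act E34 (act H2 v) = act H2 (act E34 v) + act E34 v"
  "act E34 (act H3 v) = act H3 (act E34 v) - scale 2 (act E34 v)"
  "act E34 (act E13 v) = act E13 (act E34 v) - act E14 v"
  "act E34 (act E14 v) = act E14 (act E34 v)"
  "act E34 (act E24 v) = act E24 (act E34 v)"
  "act E34 (act E12 v) = act E12 (act E34 v)"
  "act E34 (act E23 v) = act E23 (act E34 v) - act E24 v"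
  by (subst act_swap, simp add: bracket_table act_linear)+

end

type_synonym exponents = "nat \<times> nat \<times> nat \<times> nat \<times> nat \<times> nat"

text \<open>The numbers of simple roots \<open>\<alpha>\<^sub>1, \<alpha>\<^sub>2, \<alpha>\<^sub>3\<close> subtracted by a monomial.\<close>

fun root_content :: "exponents \<Rightarrow> nat \<times> nat \<times> nat" where
  "root_content (e31, e32, e41, e42, e21, e43) = (e31 + e41 + e21, e31 + e32 + e41 + e42, e41 + e42 + e43)"


section \<open>Linear functionals as a device for vector identities\<close>

context lie_module
begin

definition linear_functional :: "('v \<Rightarrow> complex) \<Rightarrow> bool"
  where "linear_functional \<phi> \<longleftrightarrow>
    (\<forall>v w. \<phi> (v + w) = \<phi> v + \<phi> w) \<and> (\<forall>c v. \<phi> (scale c v) = c * \<phi> v)"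

lemma linear_functional_simps:
  assumes "linear_functional \<phi>"
  shows "\<phi> (v + w) = \<phi> v + \<phi> w" "\<phi> (scale c v) = c * \<phi> v" "\<phi> (- v) = - \<phi> v"
    "\<phi> (v - w) = \<phi> v - \<phi> w" "\<phi> 0 = 0"
proof -
  show add: "\<phi> (v + w) = \<phi> v + \<phi> w" and scale: "\<phi> (scale c v) = c * \<phi> v" for c v w
    using assms by (simp_all add: linear_functional_def)
  show neg: "\<phi> (- v) = - \<phi> v" for v
    using scale[of "-1" v] by simp
  show "\<phi> (v - w) = \<phi> v - \<phi> w"
    using add[of v "- w"] by (simp add: neg)
  show "\<phi> 0 = 0" using scale[of 0 0] by simp
qed

text \<open>The coordinates with respect to a basis separate vectors. Applying a functional turns an
  identity between vectors into one between complex numbers, where ring normalization can collect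
  coefficients.\<close>

lemma eq_by_functionals:
  assumes "\<And>\<phi>. linear_functional \<phi> \<Longrightarrow> \<phi> x = \<phi> y"
  shows "x = y"
proof -
  obtain B where B: "independent B" "span B = UNIV"
    using basis_exists[of UNIV] by (metis UNIV_I subset_antisym subset_UNIV)
  have "representation B x b = representation B y b" for b
    by (rule assms) (simp add: linear_functional_def B representation_add representation_scale)
  then have "representation B x = representation B y" by auto
  then show ?thesis
    using B by (metis UNIV_I sum_nonzero_representation_eq)
qed

lemma submoduleI:
  assumes "subspace N" "\<And>x v. v \<in> N \<Longrightarrow> act x v \<in> N"
  shows "submodule N"
  using assms by (simp add: submodule_def)

end

section \<open>Submodules generated by singular vectors\<close>

context sl4_module
begin

text \<open>The simple root vectors generate the Lie algebra, and a subspace stable under two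
  elements is stable under their bracket.\<close>

lemma submodule_by_generators:
  assumes N: "subspace N"
    and gen: "\<And>v x. v \<in> N \<Longrightarrow> x \<in> {E21, E32, E43, E12, E23, E34} \<Longrightarrow> act x v \<in> N"
  shows "submodule N"
proof (rule submoduleI[OF N])
  fix x v assume v: "v \<in> N"
  have br: "act (lie_bracket y z) w \<in> N" if "w \<in> N"
    "\<And>w. w \<in> N \<Longrightarrow> act y w \<in> N" "\<And>w. w \<in> N \<Longrightarrow> act z w \<in> N" for y z w
    using that by (simp add: act_bracket subspace_diff[OF N])
  have g: "act E21 w \<in> N" "act E32 w \<in> N" "act E43 w \<in> N" "act E12 w \<in> N" "act E23 w \<in> N"
    "act E34 w \<in> N" if "w \<in> N" for w
    using gen that by auto
  have "lie_bracket E32 E21 = E31" "lie_bracket E43 E32 = E42" "lie_bracket E12 E23 = E13"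
    "lie_bracket E23 E34 = E24" "lie_bracket E12 E21 = H1" "lie_bracket E23 E32 = H2"
    "lie_bracket E34 E43 = H3" "lie_bracket E43 E31 = E41" "lie_bracket E12 E24 = E14"
    unfolding basis_defs
    by (transfer; simp add: vec_eq_iff all_index matrix_matrix_mult_def sum_index)+
  note e = this
  have g1: "act E31 w \<in> N" "act E42 w \<in> N" "act E13 w \<in> N" "act E24 w \<in> N"
    "act H1 w \<in> N" "act H2 w \<in> N" "act H3 w \<in> N" if "w \<in> N" for w
    using br[OF that g(2) g(1)] br[OF that g(3) g(2)] br[OF that g(4) g(5)] br[OF that g(5) g(6)]
      br[OF that g(4) g(1)] br[OF that g(5) g(2)] br[OF that g(6) g(3)] by (simp_all add: e)
  have g2: "act E41 w \<in> N" "act E14 w \<in> N" if "w \<in> N" for w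
    using br[OF that g(3) g1(1)] br[OF that g(4) g1(4)] by (simp_all add: e)
  show "act x v \<in> N"
    by (subst sl_basis_expansion[of x])
      (simp add: Let_def act_add_left act_scale_left subspace_add[OF N] subspace_scale[OF N] v g g1 g2
        del: scale_minus_left)
qed

text \<open>This is \<open>U(n_-) w\<close>, built from the three simple lowering elements so that
  inductions have few cases.\<close>

inductive_set lower_closure :: "'v \<Rightarrow> 'v set" for w where
  base: "w \<in> lower_closure w"
| add: "u \<in> lower_closure w \<Longrightarrow> v \<in> lower_closure w \<Longrightarrow> u + v \<in> lower_closure w"
| scale: "v \<in> lower_closure w \<Longrightarrow> scale c v \<in> lower_closure w"
| lower: "v \<in> lower_closure w \<Longrightarrow> x \<in> {E21, E32, E43} \<Longrightarrow> act x v \<in> lower_closure w"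

lemma lower_closure_minus: "v \<in> lower_closure w \<Longrightarrow> - v \<in> lower_closure w"
  using lower_closure.scale[of v w "-1"] by simp

lemma lower_closure_diff: "u \<in> lower_closure w \<Longrightarrow> v \<in> lower_closure w \<Longrightarrow> u - v \<in> lower_closure w"
  using lower_closure.add[of u w "- v"] lower_closure_minus by simp

lemma lower_closure_zero: "0 \<in> lower_closure w"
  using lower_closure.scale[OF lower_closure.base, of 0] by simp

definition singular :: "complex \<Rightarrow> complex \<Rightarrow> complex \<Rightarrow> 'v \<Rightarrow> bool"
  where "singular k1 k2 k3 w \<longleftrightarrow> act E12 w = 0 \<and> act E23 w = 0 \<and> act E34 w = 0 \<and>
    act H1 w = scale k1 w \<and> act H2 w = scale k2 w \<and> act H3 w = scale k3 w"

lemma lower_closure_cartan: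
  assumes "singular k1 k2 k3 w" "v \<in> lower_closure w"
  shows "act H1 v \<in> lower_closure w" "act H2 v \<in> lower_closure w" "act H3 v \<in> lower_closure w"
proof -
  note [intro] = lower_closure.add lower_closure.scale lower_closure_diff lower_closure_minus
  have lo: "u \<in> lower_closure w \<Longrightarrow> act E21 u \<in> lower_closure w"
    "u \<in> lower_closure w \<Longrightarrow> act E32 u \<in> lower_closure w"
    "u \<in> lower_closure w \<Longrightarrow> act E43 u \<in> lower_closure w" for u
    by (simp_all add: lower_closure.lower)
  have "act H1 v \<in> lower_closure w \<and> act H2 v \<in> lower_closure w \<and> act H3 v \<in> lower_closure w"
    using assms(2)
  proof (induction rule: lower_closure.induct)
    case base
    then show ?case
      using assms(1) by (simp add: singular_def lower_closure.base lower_closure.scale)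
  next
    case (lower v x)
    then show ?case
      by (elim insertE emptyE) (simp_all add: normal_order, (blast intro: lo)+)
  qed (simp_all add: act_linear lower_closure.add lower_closure.scale)
  then show "act H1 v \<in> lower_closure w" "act H2 v \<in> lower_closure w" "act H3 v \<in> lower_closure w"
    by auto
qed

lemma lower_closure_raise:
  assumes "singular k1 k2 k3 w" "v \<in> lower_closure w"
  shows "act E12 v \<in> lower_closure w" "act E23 v \<in> lower_closure w" "act E34 v \<in> lower_closure w"
proof -
  note [intro] = lower_closure.add lower_closure.scale lower_closure_diff lower_closure_minus
    lower_closure_cartan[OF assms(1)]
  have lo: "u \<in> lower_closure w \<Longrightarrow> act E21 u \<in> lower_closure w"
    "u \<in> lower_closure w \<Longrightarrow> act E32 u \<in> lower_closure w"
    "u \<in> lower_closure w \<Longrightarrow> act E43 u \<in> lower_closure w" for u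
    by (simp_all add: lower_closure.lower)
  have "act E12 v \<in> lower_closure w \<and> act E23 v \<in> lower_closure w \<and> act E34 v \<in> lower_closure w"
    using assms(2)
  proof (induction rule: lower_closure.induct)
    case base
    then show ?case
      using assms(1) by (simp add: singular_def lower_closure_zero)
  next
    case (lower v x)
    then show ?case
      by (elim insertE emptyE) (simp_all add: normal_order, (blast intro: lo)+)
  qed (simp_all add: act_linear lower_closure.add lower_closure.scale)
  then show "act E12 v \<in> lower_closure w" "act E23 v \<in> lower_closure w" "act E34 v \<in> lower_closure w"
    by auto
qed

text \<open>The triangular decomposition at work: on a singular vector the raising and Cartan parts
  contribute only scalars, so \<open>U(n_-) w\<close> is already stable under everything.\<close>

lemma submodule_lower_closure:
  assumes "singular k1 k2 k3 w"
  shows "submodule (lower_closure w)"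
  by (rule submodule_by_generators)
    (auto simp: subspace_def lower_closure_raise[OF assms] lower_closure.add lower_closure.scale
      lower_closure.lower lower_closure_zero)

subsection \<open>Poincare-Birkhoff-Witt monomials and weights\<close>

text \<open>With \<open>z\<close> standing for \<open>[x, y]\<close> and commuting with
  \<open>y\<close>, each of the \<open>n\<close> factors contributes the same term. At
  \<open>n = 0\<close> the truncated exponent is harmless, its coefficient being 0.\<close>

lemma act_power:
  assumes "\<And>u. act x (act y u) = act y (act x u) + act z u" "\<And>u. act z (act y u) = act y (act z u)"
  shows "act x (((act y) ^^ n) u) = ((act y) ^^ n) (act x u) + scale (of_nat n) (((act y) ^^ (n - 1)) (act z u))"
proof (induction n)
  case (Suc n)
  have z: "act z (((act y) ^^ k) u) = ((act y) ^^ k) (act z u)" for k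
    by (induction k) (simp_all add: assms(2))
  have "act y (((act y) ^^ (n - 1)) (act z u)) = ((act y) ^^ n) (act z u)" if "n \<noteq> 0"
    using that by (cases n) simp_all
  then show ?case
    by (cases "n = 0") (simp_all add: assms(1) Suc act_add_right act_scale_right z scale_left_distrib)
qed simp

lemma act_power_commute:
  assumes "\<And>u. act x (act y u) = act y (act x u)"
  shows "act x (((act y) ^^ n) u) = ((act y) ^^ n) (act x u)"
  by (induction n) (simp_all add: assms)

lemma power_linear:
  "((act y) ^^ n) (u + v) = ((act y) ^^ n) u + ((act y) ^^ n) v"
  "((act y) ^^ n) (scale c u) = scale c (((act y) ^^ n) u)"
  by (induction n) (simp_all add: act_add_right act_scale_right)

lemma weight_power:
  assumes "\<And>u. act h (act y u) = act y (act h u) + scale r (act y u)" "act h u = scale k u"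
  shows "act h (((act y) ^^ n) u) = scale (k + of_nat n * r) (((act y) ^^ n) u)"
proof (induction n)
  case (Suc n)
  have *: "k + of_nat (Suc n) * r = (k + of_nat n * r) + r" by (simp add: algebra_simps)
  show ?case
    unfolding * scale_left_distrib[of "k + of_nat n * r" r]
    by (simp only: funpow.simps o_apply assms(1) Suc act_scale_right)
qed (simp add: assms)

lemma power_minus: "((act y) ^^ n) (- u) = - ((act y) ^^ n) u"
  using power_linear(2)[where y = y and n = n and c = "-1" and u = u] by simp

lemma power_diff: "((act y) ^^ n) (u - v) = ((act y) ^^ n) u - ((act y) ^^ n) v"
  using power_linear(1)[where y = y and n = n and u = u and v = "- v"] by (simp add: power_minus)

lemma act_sum: "act x (sum s F) = (\<Sum>i\<in>F. act x (s i))"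
  by (induction F rule: infinite_finite_induct) (simp_all add: act_add_right)

text \<open>The factors follow \<open>normal_order\<close>. With \<open>E21\<close> and
  \<open>E43\<close> next to \<open>w\<close>, a monomial containing \<open>E21\<close> will fall
  into the image of \<open>embed\<close> when \<open>w\<close> is the vector \<open>v1\<close>
  below.\<close>

fun pbw :: "'v \<Rightarrow> exponents \<Rightarrow> 'v" where
  "pbw w (e31, e32, e41, e42, e21, e43) =
    ((act E31) ^^ e31) (((act E32) ^^ e32) (((act E41) ^^ e41) (((act E42) ^^ e42)
      (((act E21) ^^ e21) (((act E43) ^^ e43) w)))))"

text \<open>The correction terms come from moving \<open>E21\<close> past \<open>E32\<close> and
  \<open>E42\<close>, and \<open>E43\<close> past \<open>E31\<close> and \<open>E32\<close>.
  Truncated exponents occur only with coefficient 0.\<close>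

lemma pbw_lower:
  "act E32 (pbw w (a, b, c, d, i, j)) = pbw w (a, Suc b, c, d, i, j)"
  "act E21 (pbw w (a, b, c, d, i, j)) = pbw w (a, b, c, d, Suc i, j)
    - scale (of_nat b) (pbw w (Suc a, b - 1, c, d, i, j))
    - scale (of_nat d) (pbw w (a, b, Suc c, d - 1, i, j))"
  "act E43 (pbw w (a, b, c, d, i, j)) = pbw w (a, b, c, d, i, Suc j)
    + scale (of_nat a) (pbw w (a - 1, b, Suc c, d, i, j))
    + scale (of_nat b) (pbw w (a, b - 1, c, Suc d, i, j))"
proof -
  have c: "act E32 (((act E31) ^^ n) u) = ((act E31) ^^ n) (act E32 u)"
    "act E41 (((act E31) ^^ n) u) = ((act E31) ^^ n) (act E41 u)"
    "act E41 (((act E32) ^^ n) u) = ((act E32) ^^ n) (act E41 u)"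
    "act E42 (((act E31) ^^ n) u) = ((act E31) ^^ n) (act E42 u)"
    "act E42 (((act E32) ^^ n) u) = ((act E32) ^^ n) (act E42 u)"
    "act E42 (((act E41) ^^ n) u) = ((act E41) ^^ n) (act E42 u)"
    "act E21 (((act E31) ^^ n) u) = ((act E31) ^^ n) (act E21 u)"
    "act E21 (((act E41) ^^ n) u) = ((act E41) ^^ n) (act E21 u)"
    "act E43 (((act E41) ^^ n) u) = ((act E41) ^^ n) (act E43 u)"
    "act E43 (((act E42) ^^ n) u) = ((act E42) ^^ n) (act E43 u)"
    "act E43 (((act E21) ^^ n) u) = ((act E21) ^^ n) (act E43 u)"
    "act E31 (((act E32) ^^ n) u) = ((act E32) ^^ n) (act E31 u)"
    "act E41 (((act E42) ^^ n) u) = ((act E42) ^^ n) (act E41 u)"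
    "act E31 (((act E31) ^^ n) u) = ((act E31) ^^ n) (act E31 u)"
    "act E41 (((act E41) ^^ n) u) = ((act E41) ^^ n) (act E41 u)" for n u
    by (rule act_power_commute, simp add: normal_order)+
  have d: "act E21 (((act E32) ^^ n) u) = ((act E32) ^^ n) (act E21 u)
      - scale (of_nat n) (((act E32) ^^ (n - 1)) (act E31 u))"
    "act E21 (((act E42) ^^ n) u) = ((act E42) ^^ n) (act E21 u)
      - scale (of_nat n) (((act E42) ^^ (n - 1)) (act E41 u))"
    "act E43 (((act E31) ^^ n) u) = ((act E31) ^^ n) (act E43 u)
      + scale (of_nat n) (((act E31) ^^ (n - 1)) (act E41 u))"
    "act E43 (((act E32) ^^ n) u) = ((act E32) ^^ n) (act E43 u)
      + scale (of_nat n) (((act E32) ^^ (n - 1)) (act E42 u))" for n u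
    using act_power[of E21 E32 "- E31" n u] act_power[of E21 E42 "- E41" n u]
      act_power[of E43 E31 E41 n u] act_power[of E43 E32 E42 n u]
    by (simp_all add: normal_order act_minus_left act_minus_right power_minus)
  show "act E32 (pbw w (a, b, c, d, i, j)) = pbw w (a, Suc b, c, d, i, j)"
    by (simp add: c)
  show "act E21 (pbw w (a, b, c, d, i, j)) = pbw w (a, b, c, d, Suc i, j)
    - scale (of_nat b) (pbw w (Suc a, b - 1, c, d, i, j))
    - scale (of_nat d) (pbw w (a, b, Suc c, d - 1, i, j))"
    by (simp add: c d power_linear power_diff algebra_simps)
  show "act E43 (pbw w (a, b, c, d, i, j)) = pbw w (a, b, c, d, i, Suc j)
    + scale (of_nat a) (pbw w (a - 1, b, Suc c, d, i, j))
    + scale (of_nat b) (pbw w (a, b - 1, c, Suc d, i, j))"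
    by (simp add: c d power_linear)
qed

text \<open>The spanning half of the Poincare-Birkhoff-Witt theorem for \<open>n_-\<close>: the span
  of the monomials contains \<open>w\<close> and is stable under the simple lowering
  elements.\<close>

lemma lower_closure_subset_pbw: "lower_closure w \<subseteq> span (range (pbw w))"
proof
  fix v assume "v \<in> lower_closure w"
  then show "v \<in> span (range (pbw w))"
  proof (induction rule: lower_closure.induct)
    case base
    have "pbw w (0, 0, 0, 0, 0, 0) = w" by simp
    then show ?case by (metis rangeI span_base)
  next
    case (lower v x)
    have gen: "act x b \<in> span (range (pbw w))" if b: "b \<in> range (pbw w)" for b
    proof -
      obtain e where "b = pbw w e" using b by blast
      moreover obtain e31 e32 e41 e42 e21 e43 where "e = (e31, e32, e41, e42, e21, e43)"
        by (cases e)
      ultimately have "b = pbw w (e31, e32, e41, e42, e21, e43)" by simp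
      then show ?thesis
        using lower(2)
        by (elim insertE emptyE; simp only: pbw_lower; intro span_add span_diff span_scale span_base rangeI)
    qed
    have "act x u \<in> span (range (pbw w))" if "u \<in> span (range (pbw w))" for u
      using that
      by (induction rule: span_induct_alt)
        (simp_all add: gen act_add_right act_scale_right span_zero span_add span_scale)
    then show ?case using lower(3) .
  qed (simp_all add: span_add span_scale)
qed

definition has_weight :: "'v \<Rightarrow> complex \<Rightarrow> complex \<Rightarrow> complex \<Rightarrow> bool"
  where "has_weight v k1 k2 k3 \<longleftrightarrow>
    act H1 v = scale k1 v \<and> act H2 v = scale k2 v \<and> act H3 v = scale k3 v"

lemma pbw_weight:
  assumes "has_weight w k1 k2 k3" "root_content e = (n1, n2, n3)"
  shows "has_weight (pbw w e) (k1 - 2 * of_nat n1 + of_nat n2)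
    (k2 + of_nat n1 - 2 * of_nat n2 + of_nat n3) (k3 + of_nat n2 - 2 * of_nat n3)"
proof -
  obtain a b c d i j where e: "e = (a, b, c, d, i, j)" by (cases e)
  have k: "act H1 w = scale k1 w" "act H2 w = scale k2 w" "act H3 w = scale k3 w"
    using assms(1) by (simp_all add: has_weight_def)
  have n: "n1 = a + c + i" "n2 = a + b + c + d" "n3 = c + d + j" using assms(2) e by auto
  have "act H1 (pbw w e) = scale (k1 + of_nat j * 0 + of_nat i * (- 2) + of_nat d * 1 + of_nat c * (- 1)
      + of_nat b * 1 + of_nat a * (- 1)) (pbw w e)"
    unfolding e pbw.simps by (intro weight_power k; simp add: normal_order)
  moreover have "act H2 (pbw w e) = scale (k2 + of_nat j * 1 + of_nat i * 1 + of_nat d * (- 1) + of_nat c * 0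
      + of_nat b * (- 2) + of_nat a * (- 1)) (pbw w e)"
    unfolding e pbw.simps by (intro weight_power k; simp add: normal_order)
  moreover have "act H3 (pbw w e) = scale (k3 + of_nat j * (- 2) + of_nat i * 0 + of_nat d * (- 1)
      + of_nat c * (- 1) + of_nat b * 1 + of_nat a * 1) (pbw w e)"
    unfolding e pbw.simps by (intro weight_power k; simp add: normal_order)
  ultimately show ?thesis
    unfolding has_weight_def by (simp add: n algebra_simps)
qed

text \<open>Terms of the wrong weight are removed one at a time. If \<open>b\<close> has eigenvalue
  \<open>l b\<close> under some \<open>h\<close> that acts on \<open>m\<close> by \<open>k\<close>,
  the operator \<open>(h - l b) / (k - l b)\<close> fixes \<open>m\<close> and kills the term at
  \<open>b\<close>.\<close>

lemma weight_component:
  assumes "finite F" "has_weight m k1 k2 k3" "m = (\<Sum>x\<in>F. s x)"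
    and s: "\<And>x. x \<in> F \<Longrightarrow> has_weight (s x) (l1 x) (l2 x) (l3 x)"
  shows "\<exists>c. m = (\<Sum>x | x \<in> F \<and> l1 x = k1 \<and> l2 x = k2 \<and> l3 x = k3. scale (c x) (s x))"
proof -
  let ?G = "{x \<in> F. l1 x = k1 \<and> l2 x = k2 \<and> l3 x = k3}"
  have main: "\<exists>c. m = (\<Sum>x\<in>?G. scale (c x) (s x))"
    if "finite B" "B \<subseteq> F - ?G" "m = (\<Sum>x\<in>?G. scale (c x) (s x)) + (\<Sum>x\<in>B. scale (c x) (s x))" for B c
    using that
  proof (induction B arbitrary: c rule: finite_induct)
    case empty
    then show ?case by auto
  next
    case (insert b B)
    have reduce: "\<exists>c. m = (\<Sum>x\<in>?G. scale (c x) (s x))"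
      if h: "act h m = scale k m" "\<And>x. x \<in> F \<Longrightarrow> act h (s x) = scale (l x) (s x)"
        "\<And>x. x \<in> ?G \<Longrightarrow> l x = k" and b: "l b \<noteq> k" for h k and l :: "'a \<Rightarrow> complex"
    proof -
      \<comment> \<open>The coefficients after applying that operator: those in \<open>?G\<close>
        are unchanged, as \<open>l x = k\<close> there.\<close>
      let ?c = "\<lambda>x. (l x - l b) / (k - l b) * c x"
      have sub: "B \<subseteq> F" "b \<in> F" "?G \<subseteq> F" using insert.prems(1) by auto
      have lin: "act h (\<Sum>x\<in>A. scale (c x) (s x)) - scale (l b) (\<Sum>x\<in>A. scale (c x) (s x))
          = (\<Sum>x\<in>A. scale ((l x - l b) * c x) (s x))" if "A \<subseteq> F" for A
        unfolding act_sum scale_sum_right sum_subtractf[symmetric]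
        by (rule sum.cong) (use that in \<open>auto simp: act_scale_right h(2) subset_iff algebra_simps\<close>)
      have ib: "(\<Sum>x\<in>insert b B. scale ((l x - l b) * c x) (s x)) = (\<Sum>x\<in>B. scale ((l x - l b) * c x) (s x))"
        using insert.hyps by simp
      have "scale (k - l b) m = act h m - scale (l b) m"
        by (simp add: h(1) scale_left_diff_distrib)
      also have "\<dots> = (\<Sum>x\<in>?G. scale ((l x - l b) * c x) (s x)) + (\<Sum>x\<in>B. scale ((l x - l b) * c x) (s x))"
        unfolding ib[symmetric]
        using lin[OF sub(3)] lin[of "insert b B"] sub(1,2)
        by (subst (1 2) insert.prems(2)) (simp add: act_add_right scale_right_distrib algebra_simps)
      finally have "scale (inverse (k - l b)) (scale (k - l b) m)
          = scale (inverse (k - l b)) ((\<Sum>x\<in>?G. scale ((l x - l b) * c x) (s x))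
            + (\<Sum>x\<in>B. scale ((l x - l b) * c x) (s x)))" by simp
      then have "m = (\<Sum>x\<in>?G. scale (?c x) (s x)) + (\<Sum>x\<in>B. scale (?c x) (s x))"
        using b by (simp add: scale_right_distrib scale_sum_right divide_inverse ac_simps)
      then show ?thesis using insert.prems(1) by (intro insert.IH[of ?c]) auto
    qed
    have "l1 b \<noteq> k1 \<or> l2 b \<noteq> k2 \<or> l3 b \<noteq> k3" using insert.prems(1) by auto
    then show ?case
    proof (elim disjE)
      assume "l1 b \<noteq> k1"
      then show ?thesis
        by (intro reduce[of H1 k1 l1]) (use assms(2) s in \<open>auto simp: has_weight_def\<close>)
    next
      assume "l2 b \<noteq> k2"
      then show ?thesis
        by (intro reduce[of H2 k2 l2]) (use assms(2) s in \<open>auto simp: has_weight_def\<close>)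
    next
      assume "l3 b \<noteq> k3"
      then show ?thesis
        by (intro reduce[of H3 k3 l3]) (use assms(2) s in \<open>auto simp: has_weight_def\<close>)
    qed
  qed
  have "sum s F = sum s ?G + sum s (F - ?G)"
    using sum.subset_diff[of ?G F s] assms(1) by (simp add: add.commute)
  then have "m = (\<Sum>x\<in>?G. scale 1 (s x)) + (\<Sum>x\<in>F - ?G. scale 1 (s x))"
    by (simp add: assms(3))
  then show ?thesis
    using assms(1) by (intro main[of "F - ?G" "\<lambda>_. 1"]) auto
qed

lemma lower_closure_weight:
  assumes "has_weight w k1 k2 k3" "v \<in> lower_closure w" "has_weight v l1 l2 l3"
  shows "\<exists>F c. finite F \<and> v = (\<Sum>e\<in>F. scale (c e) (pbw w e)) \<and>
    (\<forall>e\<in>F. \<forall>n1 n2 n3. root_content e = (n1, n2, n3) \<longrightarrow>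
      l1 = k1 - 2 * of_nat n1 + of_nat n2 \<and> l2 = k2 + of_nat n1 - 2 * of_nat n2 + of_nat n3 \<and>
      l3 = k3 + of_nat n2 - 2 * of_nat n3)"
proof -
  have "v \<in> span (range (pbw w))" using assms(2) lower_closure_subset_pbw by blast
  then obtain T r where T: "finite T" "T \<subseteq> range (pbw w)" "v = (\<Sum>b\<in>T. scale (r b) b)"
    unfolding span_explicit mem_Collect_eq by (elim exE conjE) (rule that)
  \<comment> \<open>Different exponents may give the same vector, so one exponent is chosen for each
    vector of \<open>T\<close>.\<close>
  obtain F where F': "T = pbw w ` F" "inj_on (pbw w) F"
    using T(2) unfolding subset_image_inj by (elim exE conjE) (rule that)
  then have "finite F" using T(1) finite_imageD by blast
  note F = this F'
  let ?s = "\<lambda>e. scale (r (pbw w e)) (pbw w e)"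
  have v: "v = (\<Sum>e\<in>F. ?s e)"
    unfolding T(3) F(2) by (subst sum.reindex[OF F(3)]) simp
  define m1 where "m1 e = k1 - 2 * of_nat (fst (root_content e)) + of_nat (fst (snd (root_content e)))" for e
  define m2 where "m2 e = k2 + of_nat (fst (root_content e)) - 2 * of_nat (fst (snd (root_content e)))
    + of_nat (snd (snd (root_content e)))" for e
  define m3 where "m3 e = k3 + of_nat (fst (snd (root_content e))) - 2 * of_nat (snd (snd (root_content e)))" for e
  have "has_weight (?s e) (m1 e) (m2 e) (m3 e)" for e
  proof -
    have "has_weight (pbw w e) (m1 e) (m2 e) (m3 e)"
      unfolding m1_def m2_def m3_def by (rule pbw_weight[OF assms(1)]) simp
    then show ?thesis by (simp add: has_weight_def act_scale_right scale_left_commute)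
  qed
  from weight_component[OF F(1) assms(3) v this]
  obtain c where c: "v = (\<Sum>e | e \<in> F \<and> m1 e = l1 \<and> m2 e = l2 \<and> m3 e = l3. scale (c e) (?s e))"
    by auto
  show ?thesis
    by (rule exI[of _ "{e \<in> F. m1 e = l1 \<and> m2 e = l2 \<and> m3 e = l3}"],
        rule exI[of _ "\<lambda>e. c e * r (pbw w e)"])
      (use F(1) c in \<open>auto simp: m1_def m2_def m3_def\<close>)
qed

text \<open>The combination \<open>3 * k1 + 4 * k2 + 3 * k3\<close> is the pairing with the sum of
  the positive coroots; subtracting a simple root lowers it by 2. If \<open>w\<close> were nonzero,
  simplicity would put \<open>v\<close> into \<open>U(n_-) w\<close>, although \<open>v\<close> lies
  strictly higher than \<open>w\<close>.\<close>

lemma singular_below_eq_zero: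
  assumes "simple_module" "singular k1 k2 k3 v" "v \<noteq> 0" "singular l1 l2 l3 w"
    and height: "3 * k1 + 4 * k2 + 3 * k3 = 3 * l1 + 4 * l2 + 3 * l3 + 2 * of_nat (Suc n)"
  shows "w = 0"
proof (rule ccontr)
  assume "w \<noteq> 0"
  have "submodule (lower_closure w)" by (rule submodule_lower_closure) fact
  with \<open>w \<noteq> 0\<close> have "lower_closure w = UNIV"
    using assms(1) lower_closure.base[of w] unfolding simple_module_def by blast
  then have "v \<in> lower_closure w" by simp
  moreover have "has_weight w l1 l2 l3" "has_weight v k1 k2 k3"
    using assms by (simp_all add: singular_def has_weight_def)
  ultimately have "\<exists>F c. finite F \<and> v = (\<Sum>e\<in>F. scale (c e) (pbw w e)) \<and>
    (\<forall>e\<in>F. \<forall>n1 n2 n3. root_content e = (n1, n2, n3) \<longrightarrow>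
      k1 = l1 - 2 * of_nat n1 + of_nat n2 \<and> k2 = l2 + of_nat n1 - 2 * of_nat n2 + of_nat n3 \<and>
      k3 = l3 + of_nat n2 - 2 * of_nat n3)"
    using lower_closure_weight[of w l1 l2 l3 v k1 k2 k3] by simp
  then obtain F c where F: "finite F" "v = (\<Sum>e\<in>F. scale (c e) (pbw w e))"
    "\<And>e n1 n2 n3. e \<in> F \<Longrightarrow> root_content e = (n1, n2, n3) \<Longrightarrow>
      k1 = l1 - 2 * of_nat n1 + of_nat n2 \<and> k2 = l2 + of_nat n1 - 2 * of_nat n2 + of_nat n3 \<and>
      k3 = l3 + of_nat n2 - 2 * of_nat n3"
    by blast
  have "F \<noteq> {}" using F(2) \<open>v \<noteq> 0\<close> by auto
  then obtain e where "e \<in> F" by blast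
  moreover obtain n1 n2 n3 where "root_content e = (n1, n2, n3)" by (cases "root_content e")
  ultimately have "k1 = l1 - 2 * of_nat n1 + of_nat n2" "k2 = l2 + of_nat n1 - 2 * of_nat n2 + of_nat n3"
    "k3 = l3 + of_nat n2 - 2 * of_nat n3" using F(3) by blast+
  with height have "2 * of_nat (n1 + n2 + n3 + Suc n) = (0 :: complex)"
    by (simp add: algebra_simps)
  then show False by (simp only: mult_eq_0_iff of_nat_eq_0_iff) simp
qed

end

section \<open>The elements \<open>c\<close> and \<open>theta\<close>\<close>

context sl4_module
begin

text \<open>The element \<open>c\<close> and the element \<open>\<theta>\<close>; the latter is minus the 2 by 2 minor, in the columns 1
  and 2, of the last rows of \<open>E\<close> and \<open>E\<^sup>2\<close>, where \<open>E\<close> is the matrix of the \<open>E\<^sub>i\<^sub>j\<close>.\<close>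

definition minor :: "'v \<Rightarrow> 'v"
  where "minor v = act E31 (act E42 v) - act E32 (act E41 v)"

definition theta :: "'v \<Rightarrow> 'v"
  where "theta v = act E43 (minor v) + act E42 (act E42 (act E21 v)) + act E41 (act E42 (act H1 v))
    - act E41 (act E41 (act E12 v))"

lemma minor_linear:
  "minor (v + w) = minor v + minor w" "minor (v - w) = minor v - minor w"
  "minor (- v) = - minor v" "minor (scale c v) = scale c (minor v)" "minor 0 = 0"
  by (simp_all add: minor_def act_linear scale_right_diff_distrib)

lemma theta_linear:
  "theta (v + w) = theta v + theta w" "theta (scale c v) = scale c (theta v)"
  by (simp_all add: theta_def minor_def act_linear algebra_simps)

text \<open>The entries of the lower left 2 by 2 block commute with each other, and \<open>c\<close>
  is the determinant of that block. Hence it is invariant under both diagonal copies of sl2; its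
  weight on \<open>H2\<close> is -2.\<close>

lemma minor_commute:
  "minor (act E21 v) = act E21 (minor v)" "minor (act E32 v) = act E32 (minor v)"
  "minor (act E43 v) = act E43 (minor v)" "minor (act E12 v) = act E12 (minor v)"
  "minor (act E34 v) = act E34 (minor v)" "minor (act H1 v) = act H1 (minor v)"
  "minor (act H2 v) = act H2 (minor v) + scale 2 (minor v)" "minor (act H3 v) = act H3 (minor v)"
  by (rule eq_by_functionals,
      simp add: minor_def act_linear normal_order linear_functional_simps algebra_simps)+

lemma theta_commute:
  "theta (act E21 v) = act E21 (theta v)" "theta (act E32 v) = act E32 (theta v)"
  "theta (act E43 v) = act E43 (theta v)" "theta (act E12 v) = act E12 (theta v)"
  "theta (act H1 v) = act H1 (theta v)" "theta (act H2 v) = act H2 (theta v) + theta v"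
  "theta (act H3 v) = act H3 (theta v) + scale 2 (theta v)"
  by (rule eq_by_functionals,
      simp add: theta_def minor_def act_linear normal_order linear_functional_simps algebra_simps)+

end

section \<open>The simple module\<close>

text \<open>The numbers -2, 2, -2 are the successive coordinate differences of (-1, 1, -1,
  1).\<close>

locale highest_weight_rt = sl4_module scale act
  for scale :: "complex \<Rightarrow> 'v::ab_group_add \<Rightarrow> 'v" and act :: "4 sl \<Rightarrow> 'v \<Rightarrow> 'v" +
  fixes v0 :: 'v
  assumes simple: simple_module
    and v0_nonzero: "v0 \<noteq> 0"
    and v0_singular: "singular (- 2) 2 (- 2) v0"
begin

lemma v0_simps [simp]:
  "act E12 v0 = 0" "act E23 v0 = 0" "act E34 v0 = 0"
  "act H1 v0 = scale (- 2) v0" "act H2 v0 = scale 2 v0" "act H3 v0 = scale (- 2) v0"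
  using v0_singular by (simp_all add: singular_def)

lemmas test_functional = act_linear normal_order linear_functional_simps algebra_simps

text \<open>The following vectors are singular in the Verma module, the last one only modulo the others.\<close>

lemma relation_W:
  "act E32 (act E21 (act E43 v0)) - scale 2 (act E31 (act E43 v0))
    + scale 2 (act E42 (act E21 v0)) - scale 4 (act E41 v0) = 0" (is "?w = 0")
proof (rule singular_below_eq_zero[OF simple v0_singular v0_nonzero])
  show "singular (- 3) 2 (- 3) ?w"
    unfolding singular_def by (intro conjI eq_by_functionals) (simp_all add: test_functional)
  show "3 * (- 2) + 4 * 2 + 3 * (- 2) = 3 * (- 3) + 4 * 2 + 3 * (- 3) + 2 * (of_nat (Suc 2) :: complex)"
    by simp
qed

lemma relation_Z:
  "scale 6 (act E42 (act E42 v0)) + scale 6 (act E32 (act E42 (act E43 v0)))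
    + act E32 (act E32 (act E43 (act E43 v0))) = 0" (is "?w = 0")
proof (rule singular_below_eq_zero[OF simple v0_singular v0_nonzero])
  show "singular 0 0 (- 4) ?w"
    unfolding singular_def by (intro conjI eq_by_functionals) (simp_all add: test_functional)
  show "3 * (- 2) + 4 * 2 + 3 * (- 2) = 3 * 0 + 4 * 0 + 3 * (- 4) + 2 * (of_nat (Suc 3) :: complex)"
    by simp
qed

text \<open>The mirror image of \<open>relation_Z\<close> under the diagram automorphism, which
  exchanges \<open>E21\<close> and \<open>E43\<close> and sends \<open>E42\<close> to
  \<open>- E31\<close>.\<close>

lemma relation_Z':
  "scale 6 (act E31 (act E31 v0)) - scale 6 (act E31 (act E32 (act E21 v0)))
    + act E32 (act E32 (act E21 (act E21 v0))) = 0" (is "?w = 0")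
proof (rule singular_below_eq_zero[OF simple v0_singular v0_nonzero])
  show "singular (- 4) 0 0 ?w"
    unfolding singular_def by (intro conjI eq_by_functionals) (simp_all add: test_functional)
  show "3 * (- 2) + 4 * 2 + 3 * (- 2) = 3 * (- 4) + 4 * 0 + 3 * 0 + 2 * (of_nat (Suc 3) :: complex)"
    by simp
qed

lemma relation_X:
  "act E31 (act E31 (act E32 (act E43 (act E43 v0)))) + scale 6 (act E31 (act E31 (act E42 (act E43 v0))))
    + scale 6 (act E31 (act E42 (act E42 (act E21 v0))))
    - act E32 (act E42 (act E42 (act E21 (act E21 v0)))) = 0" (is "?w = 0")
proof (rule singular_below_eq_zero[OF simple v0_singular v0_nonzero])
  let ?W = "act E32 (act E21 (act E43 v0)) - scale 2 (act E31 (act E43 v0))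
    + scale 2 (act E42 (act E21 v0)) - scale 4 (act E41 v0)"
  let ?Z = "scale 6 (act E42 (act E42 v0)) + scale 6 (act E32 (act E42 (act E43 v0)))
    + act E32 (act E32 (act E43 (act E43 v0)))"
  let ?Z' = "scale 6 (act E31 (act E31 v0)) - scale 6 (act E31 (act E32 (act E21 v0)))
    + act E32 (act E32 (act E21 (act E21 v0)))"
  \<comment> \<open>Raising the vector gives combinations of elements of \<open>U(n_-)\<close>
    applied to the three earlier relations, hence 0 in the simple module.\<close>
  have "act E12 ?w = scale (- 2) (act E31 ?Z)"
    by (rule eq_by_functionals) (simp add: test_functional)
  moreover have "act E23 ?w = scale 2 (act E42 (act E21 ?W)) + scale 2 (act E31 (act E43 ?W))"
    by (rule eq_by_functionals) (simp add: test_functional)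
  moreover have "act E34 ?w = scale (- 2) (act E42 ?Z')"
    by (rule eq_by_functionals) (simp add: test_functional)
  moreover have "act H1 ?w = scale (- 3) ?w" "act H2 ?w = scale 0 ?w" "act H3 ?w = scale (- 3) ?w"
    by (rule eq_by_functionals, simp add: test_functional)+
  ultimately show "singular (- 3) 0 (- 3) ?w"
    unfolding singular_def by (simp only: relation_W relation_Z relation_Z' act_zero_right scale_zero_right) simp
  show "3 * (- 2) + 4 * 2 + 3 * (- 2) = 3 * (- 3) + 4 * 0 + 3 * (- 3) + 2 * (of_nat (Suc 6) :: complex)"
    by simp
qed

text \<open>
  The solution, unique modulo the relations, of \<open>E12 q = E23 q = 0\<close> in weight \<open>\<lambda> + (-1, -1, -1, 3)\<close>,
  normalized by \<open>c q = \<theta>\<^sup>2 v\<^sub>0\<close>.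
\<close>

definition q :: 'v
  where "q = scale 8 (act E41 (act E42 (act E43 v0))) + scale 2 (act E32 (act E41 (act E43 (act E43 v0))))
    - scale 10 (act E42 (act E42 (act E21 (act E43 v0))))
    - scale 5 (act E32 (act E42 (act E21 (act E43 (act E43 v0)))))
    - scale (1 / 2) (act E32 (act E32 (act E21 (act E43 (act E43 (act E43 v0))))))"

text \<open>Normal ordering with only the highest weight equations does not make the two sides
  equal. Their difference is \<open>?cert\<close>, a combination of elements of
  \<open>U(n_-)\<close> applied to the relations W, Z and X.\<close>

lemma minor_q: "minor q = theta (theta v0)"
proof -
  let ?W = "act E32 (act E21 (act E43 v0)) - scale 2 (act E31 (act E43 v0))
    + scale 2 (act E42 (act E21 v0)) - scale 4 (act E41 v0)"
  let ?Z = "scale 6 (act E42 (act E42 v0)) + scale 6 (act E32 (act E42 (act E43 v0)))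
    + act E32 (act E32 (act E43 (act E43 v0)))"
  let ?X = "act E31 (act E31 (act E32 (act E43 (act E43 v0)))) + scale 6 (act E31 (act E31 (act E42 (act E43 v0))))
    + scale 6 (act E31 (act E42 (act E42 (act E21 v0))))
    - act E32 (act E42 (act E42 (act E21 (act E21 v0))))"
  let ?cert = "- act E42 (act E42 (act E42 (act E21 ?W))) + scale 3 (act E41 (act E42 (act E42 ?W)))
    + scale 3 (act E32 (act E41 (act E42 (act E43 ?W))))
    + scale (1 / 2) (act E32 (act E32 (act E41 (act E43 (act E43 ?W)))))
    - scale 3 (act E31 (act E42 (act E42 (act E43 ?W))))
    - scale (1 / 2) (act E31 (act E32 (act E42 (act E43 (act E43 ?W)))))
    + act E41 (act E41 ?Z) + act E31 (act E41 (act E43 ?Z)) - act E42 (act E43 ?X)"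
  have "minor q - theta (theta v0) = ?cert"
    by (rule eq_by_functionals) (simp add: q_def theta_def minor_def test_functional)
  also have "\<dots> = 0"
    unfolding relation_W relation_Z relation_X by simp
  finally show ?thesis by simp
qed

lemma E23_q: "act E23 q = 0"
  by (rule eq_by_functionals) (simp add: q_def test_functional)

text \<open>Every monomial of \<open>q\<close> lowers by the third simple root exactly three times,
  so a fourth \<open>E34\<close> leads above the highest weight.\<close>

lemma E34_q: "act E34 (act E34 (act E34 (act E34 q))) = 0"
  by (rule eq_by_functionals) (simp add: q_def test_functional)

lemma cartan_q: "act H1 q = scale (- 2) q" "act H2 q = scale 2 q" "act H3 q = scale (- 6) q"
  by (rule eq_by_functionals, simp add: q_def test_functional)+

text \<open>A word of raising elements that returns to the highest weight sends \<open>q\<close> to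
  a nonzero multiple of \<open>v0\<close>.\<close>

lemma q_nonzero: "q \<noteq> 0"
proof
  assume "q = 0"
  have "act E34 (act E23 (act E12 (act E34 (act E23 (act E34 q))))) = scale (- 8) v0"
    by (rule eq_by_functionals) (simp add: q_def test_functional)
  with \<open>q = 0\<close> v0_nonzero show False by simp
qed

end

lemma two_not_nat: "- 2 \<noteq> (of_nat j :: complex)"
proof
  assume "- 2 = (of_nat j :: complex)"
  then have "of_nat (j + 2) = (0 :: complex)" by simp
  then show False by (simp only: of_nat_eq_0_iff)
qed

section \<open>Injectivity of ad-nilpotent elements on the simple module\<close>

context sl4_module
begin

text \<open>The hypothesis \<open>ad\<close> says that the triple commutator of \<open>Z\<close>
  with \<open>x\<close> vanishes. With \<open>Y = [Z, x]\<close> and \<open>W = [Z, Y]\<close>, the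
  operator \<open>W\<close> commutes with \<open>Z\<close> and preserves the torsion exponent,
  \<open>Y\<close> raises it by at most 1, and \<open>x\<close> by at most 2.\<close>

lemma torsion_step:
  assumes add: "\<And>v w. Z (v + w) = Z v + Z w"
    and ad: "\<And>v. Z (Z (Z (act x v))) - scale 3 (Z (Z (act x (Z v)))) + scale 3 (Z (act x (Z (Z v))))
      - act x (Z (Z (Z v))) = 0"
    and "(Z ^^ k) v = 0"
  shows "(Z ^^ (k + 2)) (act x v) = 0"
proof -
  have Z0: "Z 0 = 0" using add[of 0 0] by simp
  have Zk0: "(Z ^^ n) 0 = 0" for n by (induction n) (simp_all add: Z0)
  have Zadd: "(Z ^^ n) (v + w) = (Z ^^ n) v + (Z ^^ n) w" for n v w
    by (induction n arbitrary: v w) (simp_all add: add)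
  have diff: "Z (v - w) = Z v - Z w" for v w
    using add[of "v - w" w] by simp
  have sw: "Z ((Z ^^ n) v) = (Z ^^ n) (Z v)" for n v by (simp add: funpow_swap1)
  define Y where "Y v = Z (act x v) - act x (Z v)" for v
  define W where "W v = Z (Y v) - Y (Z v)" for v
  have three: "scale 3 v = v + v + v" for v
    using scale_left_distrib[of 2 1 v] scale_left_distrib[of 1 1 v] by simp
  have ZW: "Z (W v) = W (Z v)" for v
    using ad[of v] by (simp add: W_def Y_def diff add three algebra_simps)
  have A: "(Z ^^ n) (W v) = 0" if "(Z ^^ n) v = 0" for n v
  proof -
    have "(Z ^^ n) (W v) = W ((Z ^^ n) v)" by (induction n) (simp_all add: ZW)
    then show ?thesis using that by (simp add: W_def Y_def Z0)
  qed
  have B: "(Z ^^ Suc n) (Y v) = 0" if "(Z ^^ n) v = 0" for n v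
    using that
  proof (induction n arbitrary: v)
    case 0
    then show ?case by (simp add: Y_def Z0)
  next
    case (Suc n)
    have "Z (Y v) = Y (Z v) + W v" by (simp add: W_def)
    then have "(Z ^^ Suc (Suc n)) (Y v) = (Z ^^ Suc n) (Y (Z v)) + (Z ^^ Suc n) (W v)"
      by (simp add: sw Zadd add)
    moreover have "(Z ^^ n) (Z v) = 0" using Suc.prems by (simp add: sw)
    ultimately show ?case using Suc.IH A[OF Suc.prems] by simp
  qed
  have "(Z ^^ Suc (Suc n)) (act x v) = 0" if "(Z ^^ n) v = 0" for n v
    using that
  proof (induction n arbitrary: v)
    case 0
    then show ?case by (simp add: Z0)
  next
    case (Suc n)
    have "Z (act x v) = act x (Z v) + Y v" by (simp add: Y_def)
    then have "(Z ^^ Suc (Suc (Suc n))) (act x v) = (Z ^^ Suc (Suc n)) (act x (Z v)) + (Z ^^ Suc (Suc n)) (Y v)"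
      by (simp add: sw Zadd add)
    moreover have "(Z ^^ n) (Z v) = 0" using Suc.prems by (simp add: sw)
    ultimately show ?case using Suc.IH B[OF Suc.prems] by simp
  qed
  then show ?thesis using assms(3) by simp
qed

text \<open>By \<open>torsion_step\<close> the vectors killed by some power of \<open>Z\<close> form
  a submodule. It omits \<open>w\<close>, so it is zero by simplicity.\<close>

lemma ad_nilpotent_injective:
  assumes simple_module
    and add: "\<And>v w. Z (v + w) = Z v + Z w" and scale: "\<And>c v. Z (scale c v) = scale c (Z v)"
    and ad: "\<And>x v. x \<in> {E21, E32, E43, E12, E23, E34} \<Longrightarrow>
      Z (Z (Z (act x v))) - scale 3 (Z (Z (act x (Z v)))) + scale 3 (Z (act x (Z (Z v))))
      - act x (Z (Z (Z v))) = 0"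
    and nontorsion: "\<And>k. (Z ^^ k) w \<noteq> 0"
  shows "inj Z"
proof -
  have Z0: "Z 0 = 0" using add[of 0 0] by simp
  have Zk0: "(Z ^^ n) 0 = 0" for n by (induction n) (simp_all add: Z0)
  have Zadd: "(Z ^^ n) (v + w) = (Z ^^ n) v + (Z ^^ n) w" for n v w
    by (induction n arbitrary: v w) (simp_all add: add)
  have Zscale: "(Z ^^ n) (scale c v) = scale c ((Z ^^ n) v)" for n c v
    by (induction n arbitrary: v) (simp_all add: scale)
  have mono: "(Z ^^ (m + n)) v = 0" if "(Z ^^ n) v = 0" for m n v
    using that by (simp add: funpow_add Zk0)
  let ?T = "{v. \<exists>k. (Z ^^ k) v = 0}"
  have "subspace ?T"
  proof (rule subspaceI)
    show "0 \<in> ?T" using Zk0 by auto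
  next
    fix u v assume "u \<in> ?T" "v \<in> ?T"
    then obtain m n where "(Z ^^ m) u = 0" "(Z ^^ n) v = 0" by auto
    then have "(Z ^^ (m + n)) (u + v) = 0"
      using mono[of m u n] mono[of n v m] by (simp add: Zadd add.commute)
    then show "u + v \<in> ?T" by blast
  next
    fix c v assume "v \<in> ?T"
    then show "scale c v \<in> ?T" by (auto simp: Zscale)
  qed
  moreover have "act x v \<in> ?T" if "v \<in> ?T" "x \<in> {E21, E32, E43, E12, E23, E34}" for v x
    using that torsion_step[of Z x, OF add ad] by blast
  ultimately have "submodule ?T" by (rule submodule_by_generators)
  moreover have "w \<notin> ?T" using nontorsion by simp
  ultimately have T: "?T = {0}" using assms(1) unfolding simple_module_def by blast
  show ?thesis
  proof (rule injI)
    fix u v assume "Z u = Z v"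
    then have "(Z ^^ 1) (u - v) = 0" using add[of "u - v" v] by simp
    then have "u - v \<in> ?T" by blast
    then show "u = v" using T by simp
  qed
qed

end

context sl4_module
begin

text \<open>The classical formula \<open>e f^(n+1) v = (n+1) (k-n) f^n v\<close>; its coefficient
  never vanishes when \<open>k\<close> is not a natural number.\<close>

lemma sl2_power_nonzero:
  assumes "act e v = 0" "act h v = scale k v"
    and ef: "\<And>u. act e (act f u) = act f (act e u) + act h u"
    and hf: "\<And>u. act h (act f u) = act f (act h u) - scale 2 (act f u)"
    and "v \<noteq> 0" and k: "\<And>j. k \<noteq> of_nat j"
  shows "((act f) ^^ n) v \<noteq> 0"
proof -
  have h: "act h (((act f) ^^ n) v) = scale (k - 2 * of_nat n) (((act f) ^^ n) v)" for n
  proof (induction n)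
    case (Suc n)
    have *: "k - 2 * of_nat (Suc n) = (k - 2 * of_nat n) - 2" by simp
    show ?case
      unfolding * scale_left_diff_distrib[of "k - 2 * of_nat n" 2]
      by (simp only: funpow.simps o_apply hf Suc act_scale_right)
  qed (simp add: assms)
  have e: "act e (((act f) ^^ Suc n) v) = scale (of_nat (Suc n) * (k - of_nat n)) (((act f) ^^ n) v)" for n
  proof (induction n)
    case 0
    then show ?case by (simp add: ef assms)
  next
    case (Suc n)
    have "of_nat (Suc (Suc n)) * (k - of_nat (Suc n))
        = of_nat (Suc n) * (k - of_nat n) + (k - 2 * of_nat (Suc n))"
      by (simp add: algebra_simps)
    then show ?case
      by (simp only: scale_left_distrib funpow.simps(2)[of "Suc n"] o_apply[of "act f" "(act f) ^^ Suc n"]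
          ef Suc act_scale_right h) simp
  qed
  show ?thesis
  proof (induction n)
    case 0
    show ?case using assms by simp
  next
    case (Suc n)
    have "of_nat (Suc n) * (k - of_nat n) \<noteq> 0" using k[of n] by (simp del: of_nat_Suc)
    then show ?case using e[of n] Suc by (metis act_zero_right scale_eq_0_iff)
  qed
qed

end

context highest_weight_rt
begin

lemma E43_power_nonzero: "((act E43) ^^ m) v0 \<noteq> 0"
  by (rule sl2_power_nonzero[of E34 _ H3 "- 2" E43])
    (simp_all only: v0_simps v0_nonzero normal_order act_linear two_not_nat not_False_eq_True)

text \<open>Since \<open>E43\<close> commutes with \<open>E12\<close> and \<open>H1\<close>, every
  \<open>E43^m v0\<close> is again a highest weight vector of weight -2 for the first sl2.\<close>

lemma power_nonzero: "((act E21) ^^ n) (((act E43) ^^ m) v0) \<noteq> 0"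
proof (rule sl2_power_nonzero[of E12 _ H1 "- 2" E21])
  show "act E12 (((act E43) ^^ m) v0) = 0"
    by (induction m) (simp_all add: normal_order)
  show "act H1 (((act E43) ^^ m) v0) = scale (- 2) (((act E43) ^^ m) v0)"
    by (induction m) (simp_all add: normal_order act_linear)
qed (simp_all only: E43_power_nonzero normal_order act_linear two_not_nat not_False_eq_True)

lemma inj_E21: "inj (act E21)"
proof (rule ad_nilpotent_injective[OF simple act_add_right act_scale_right])
  show "act E21 (act E21 (act E21 (act x v))) - scale 3 (act E21 (act E21 (act x (act E21 v))))
      + scale 3 (act E21 (act x (act E21 (act E21 v)))) - act x (act E21 (act E21 (act E21 v))) = 0"
    if "x \<in> {E21, E32, E43, E12, E23, E34}" for x v
    using that by (intro eq_by_functionals) (elim insertE emptyE; simp add: test_functional)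
  show "((act E21) ^^ k) v0 \<noteq> 0" for k
    using power_nonzero[of k 0] by simp
qed

text \<open>Modulo the left ideal of \<open>E23\<close>, the top power of \<open>ad E23\<close> turns \<open>c\<^sup>k\<close> into a multiple of
  \<open>E21\<^sup>k E43\<^sup>k\<close>.\<close>

lemma minor_power_nonzero: "(minor ^^ k) v0 \<noteq> 0"
proof -
  let ?e = "act E23"
  define c1 where "c1 v = act E21 (act E42 v) - act E31 (act E43 v) - act E41 (act H2 v)" for v
  define c2 where "c2 v = act E41 (act E23 v) - act E21 (act E43 v)" for v
  have e1: "?e (minor v) = minor (?e v) + c1 v" and e2: "?e (c1 v) = c1 (?e v) + scale 2 (c2 v)"
    and e3: "?e (c2 v) = c2 (?e v)" for v
    by (rule eq_by_functionals, simp add: minor_def c1_def c2_def test_functional)+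
  \<comment> \<open>The Leibniz rule, as \<open>ad E23\<close> sends \<open>c\<close> to
    \<open>c1\<close>, \<open>c1\<close> to \<open>2 c2\<close> and \<open>c2\<close> to 0. In the
    use below only the last term survives, and there \<open>c2\<close> reduces to
    \<open>- E21 E43\<close>.\<close>
  have pow: "(?e ^^ Suc (Suc n)) (minor v) = minor ((?e ^^ Suc (Suc n)) v)
    + scale (of_nat n + 2) (c1 ((?e ^^ Suc n) v))
    + scale ((of_nat n + 2) * (of_nat n + 1)) (c2 ((?e ^^ n) v))" for n v
  proof (induction n)
    case 0
    show ?case
      by (rule eq_by_functionals) (simp add: e1 e2 act_linear linear_functional_simps algebra_simps)
  next
    case (Suc n)
    show ?case
      by (subst funpow.simps(2), subst o_apply, subst Suc, rule eq_by_functionals)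
        (simp add: e1 e2 e3 act_linear linear_functional_simps algebra_simps)
  qed
  have "\<exists>r. r \<noteq> 0 \<and> (?e ^^ (2 * k)) ((minor ^^ k) v0) = scale r (((act E21) ^^ k) (((act E43) ^^ k) v0))"
  proof (induction k)
    case 0
    show ?case by (rule exI[of _ 1]) simp
  next
    case (Suc k)
    then obtain r where r: "r \<noteq> 0"
      "(?e ^^ (2 * k)) ((minor ^^ k) v0) = scale r (((act E21) ^^ k) (((act E43) ^^ k) v0))"
      by auto
    have "?e (((act E43) ^^ k) v0) = 0"
      by (induction k) (simp_all add: normal_order)
    then have kill: "?e (((act E21) ^^ k) (((act E43) ^^ k) v0)) = 0"
    proof -
      have "?e (((act E21) ^^ n) u) = ((act E21) ^^ n) (?e u)" for n u
        by (induction n) (simp_all add: normal_order)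
      moreover have "((act E21) ^^ n) 0 = 0" for n by (induction n) simp_all
      ultimately show ?thesis using \<open>?e (((act E43) ^^ k) v0) = 0\<close> by simp
    qed
    have swap: "act E43 (((act E21) ^^ n) u) = ((act E21) ^^ n) (act E43 u)" for n u
      by (induction n) (simp_all add: normal_order)
    have "(?e ^^ (2 * Suc k)) ((minor ^^ Suc k) v0)
      = (?e ^^ Suc (Suc (2 * k))) (minor ((minor ^^ k) v0))" by simp
    also have "\<dots> = scale (- ((of_nat (2 * k) + 2) * (of_nat (2 * k) + 1) * r))
        (((act E21) ^^ Suc k) (((act E43) ^^ Suc k) v0))"
      unfolding pow using r(2) kill
      by (simp add: act_linear minor_linear c1_def c2_def swap normal_order mult.assoc)
    finally have "(?e ^^ (2 * Suc k)) ((minor ^^ Suc k) v0)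
      = scale (- ((of_nat (2 * k) + 2) * (of_nat (2 * k) + 1) * r))
        (((act E21) ^^ Suc k) (((act E43) ^^ Suc k) v0))" .
    moreover have "- ((of_nat (2 * k) + 2) * (of_nat (2 * k) + 1) * r) \<noteq> 0"
    proof -
      have "(of_nat (2 * k) + 2) * (of_nat (2 * k) + 1) = (of_nat ((2 * k + 2) * (2 * k + 1)) :: complex)"
        by (simp only: of_nat_mult of_nat_add of_nat_numeral of_nat_1)
      also have "\<dots> \<noteq> 0" by (simp only: of_nat_eq_0_iff) simp
      finally show ?thesis using r(1) by simp
    qed
    ultimately show ?case by blast
  qed
  then obtain r where "r \<noteq> 0" "(?e ^^ (2 * k)) ((minor ^^ k) v0) = scale r (((act E21) ^^ k) (((act E43) ^^ k) v0))"
    by auto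
  moreover have "(?e ^^ n) 0 = 0" for n by (induction n) simp_all
  ultimately show ?thesis using power_nonzero[of k k] by (metis scale_eq_0_iff)
qed

text \<open>Among the generators only \<open>E23\<close> fails to commute with \<open>c\<close>. Its
  double commutator with \<open>c\<close> is a multiple of \<open>E41 c\<close>, which commutes with
  \<open>c\<close>.\<close>

lemma inj_minor: "inj minor"
proof (rule ad_nilpotent_injective[OF simple minor_linear(1) minor_linear(4) _ minor_power_nonzero])
  show "minor (minor (minor (act x v))) - scale 3 (minor (minor (act x (minor v))))
      + scale 3 (minor (act x (minor (minor v)))) - act x (minor (minor (minor v))) = 0"
    if "x \<in> {E21, E32, E43, E12, E23, E34}" for x v
  proof (cases "x = E23")
    case True
    show ?thesis
      unfolding True by (rule eq_by_functionals) (simp add: minor_def test_functional)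
  next
    case False
    then show ?thesis
      using that by (intro eq_by_functionals)
        (elim insertE emptyE; simp add: minor_commute linear_functional_simps)
  qed
qed

end

section \<open>Locally finite endomorphisms\<close>

context lie_module
begin

lemma lie_scale_zero: "lie_scale 0 (x :: 'g) = 0"
  using lie_scale_left_distrib[of 0 0 x] by simp

lemma End_iff: "f \<in> End \<longleftrightarrow> (\<forall>v w. f (v + w) = f v + f w) \<and> (\<forall>c v. f (scale c v) = scale c (f v))"
proof -
  have "Vector_Spaces.linear scale scale f \<longleftrightarrow>
      (\<forall>v w. f (v + w) = f v + f w) \<and> (\<forall>c v. f (scale c v) = scale c (f v))"
    by (simp add: Vector_Spaces.linear_def vector_space_axioms module_hom_axioms_def module_hom_def
        module_axioms)
  then show ?thesis by (simp add: End_def)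
qed

lemma End_diff:
  assumes "f \<in> End"
  shows "f (v - w) = f v - f w"
proof -
  have "f (v - w + w) = f (v - w) + f w" using assms unfolding End_iff by blast
  then show ?thesis by simp
qed

lemma ad_End:
  assumes "f \<in> End"
  shows "ad x f \<in> End"
  using assms
  by (simp add: End_iff ad_def act_add_right act_scale_right scale_right_diff_distrib)

lemma ad_add_left: "f \<in> End \<Longrightarrow> ad (x + y) f = ad x f + ad y f"
  by (simp add: fun_eq_iff End_iff ad_def act_add_left)

lemma ad_scale_left: "f \<in> End \<Longrightarrow> ad (lie_scale c x) f = End_scale c (ad x f)"
  by (simp add: fun_eq_iff End_iff ad_def End_scale_def act_scale_left scale_right_diff_distrib)

lemma ad_bracket: "f \<in> End \<Longrightarrow> ad (lie_bracket x y) f = ad x (ad y f) - ad y (ad x f)"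
  by (simp add: fun_eq_iff ad_def act_bracket End_diff act_diff_right algebra_simps)

lemma ad_neg_left: "f \<in> End \<Longrightarrow> ad (- x) f = - ad x f"
  using ad_add_left[of f x "- x"] ad_scale_left[of f 0 x]
  by (simp add: lie_scale_zero End_scale_def fun_eq_iff eq_neg_iff_add_eq_0 add.commute)

lemma ad_add_right: "ad x (f + g) = ad x f + ad x g"
  by (simp add: fun_eq_iff ad_def act_add_right)

lemma ad_scale_right: "ad x (End_scale c f) = End_scale c (ad x f)"
  by (simp add: fun_eq_iff ad_def End_scale_def act_scale_right scale_right_diff_distrib)

end

context sl4_module
begin

text \<open>
  A weight vector of \<open>End\<close> on which \<open>gl\<^sub>3\<close> acts by a character and which commutes with
  \<open>E41\<close>, \<open>E42\<close>, \<open>E43\<close> generates a finite-dimensional representation as soon as it is killed by a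
  power of \<open>ad E34\<close>: the commuting operators \<open>ad E14\<close>, \<open>ad E24\<close>, \<open>ad E34\<close> span the whole orbit.
\<close>

lemma bracket_table_raising:
  "lie_bracket E23 E24 = 0" "lie_bracket E23 E14 = 0" "lie_bracket E23 E34 = E24"
  "lie_bracket E13 E14 = 0" "lie_bracket E13 E24 = 0" "lie_bracket E13 E34 = E14"
  "lie_bracket E34 E24 = 0" "lie_bracket E34 E14 = 0" "lie_bracket E14 E24 = 0" "lie_bracket E24 E14 = 0"
  unfolding basis_defs
  by (transfer; simp add: vec_eq_iff all_index matrix_matrix_mult_def sum_index)+

definition orbit_vector :: "('v \<Rightarrow> 'v) \<Rightarrow> nat \<Rightarrow> nat \<Rightarrow> nat \<Rightarrow> 'v \<Rightarrow> 'v"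
  where "orbit_vector f a b c = ((ad E14) ^^ a) (((ad E24) ^^ b) (((ad E34) ^^ c) f))"

lemma ad_zero: "ad x 0 = 0"
  by (simp add: fun_eq_iff ad_def)

lemma ad_commute:
  assumes "f \<in> End" "lie_bracket x y = 0"
  shows "ad x (ad y f) = ad y (ad x f)"
proof -
  have "f 0 = 0" using End_diff[OF assms(1), of 0 0] by simp
  then have "ad 0 f = 0" by (simp add: fun_eq_iff ad_def act_zero_left)
  then show ?thesis using ad_bracket[OF assms(1), of x y] assms(2) by simp
qed

lemma ad_power_End: "f \<in> End \<Longrightarrow> ((ad x) ^^ n) f \<in> End"
  by (induction n) (simp_all add: ad_End)

lemma ad_power_commute:
  assumes "f \<in> End" "lie_bracket x y = 0"
  shows "ad x (((ad y) ^^ n) f) = ((ad y) ^^ n) (ad x f)"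
proof (induction n)
  case (Suc n)
  have "ad x (ad y (((ad y) ^^ n) f)) = ad y (ad x (((ad y) ^^ n) f))"
    by (rule ad_commute[OF ad_power_End[OF assms(1)] assms(2)])
  then show ?case by (simp add: Suc)
qed simp

lemma orbit_vector_End: "f \<in> End \<Longrightarrow> orbit_vector f a b c \<in> End"
  by (simp add: orbit_vector_def ad_power_End)

lemma orbit_vector_Suc:
  assumes "f \<in> End"
  shows "ad E14 (orbit_vector f a b c) = orbit_vector f (Suc a) b c"
    "ad E24 (orbit_vector f a b c) = orbit_vector f a (Suc b) c"
    "ad E34 (orbit_vector f a b c) = orbit_vector f a b (Suc c)"
proof -
  have br: "lie_bracket E24 E14 = 0" "lie_bracket E34 E14 = 0" "lie_bracket E34 E24 = 0"
    by (simp_all add: bracket_table)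
  show "ad E14 (orbit_vector f a b c) = orbit_vector f (Suc a) b c"
    by (simp add: orbit_vector_def)
  show "ad E24 (orbit_vector f a b c) = orbit_vector f a (Suc b) c"
    by (simp add: orbit_vector_def ad_power_commute br ad_power_End assms)
  show "ad E34 (orbit_vector f a b c) = orbit_vector f a b (Suc c)"
    by (simp add: orbit_vector_def ad_power_commute br ad_power_End assms)
qed

lemma ad_power_scale: "((ad x) ^^ n) (End_scale c f) = End_scale c (((ad x) ^^ n) f)"
  by (induction n) (simp_all add: ad_scale_right)

lemma ad_raise_power:
  assumes f: "f \<in> End" and e: "ad e f = 0" "lie_bracket e y = g" "lie_bracket y g = 0"
  shows "ad e (((ad y) ^^ Suc n) f) = End_scale (of_nat (Suc n)) (ad g (((ad y) ^^ n) f))"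
proof -
  have step: "ad e (ad y h) = ad y (ad e h) + ad g h" if "h \<in> End" for h
    using ad_bracket[OF that, of e y] by (simp add: e(2))
  show ?thesis
  proof (induction n)
    case 0
    show ?case using step[OF f] e(1) ad_zero[of y] by (simp add: End_scale_def fun_eq_iff)
  next
    case (Suc n)
    let ?X = "((ad y) ^^ n) f"
    have X: "?X \<in> End" by (rule ad_power_End[OF f])
    have "ad e (((ad y) ^^ Suc (Suc n)) f) = ad y (ad e (((ad y) ^^ Suc n) f)) + ad g (ad y ?X)"
      using step[OF ad_power_End[OF f, of "Suc n" y]] by simp
    also have "\<dots> = End_scale (of_nat (Suc n)) (ad g (ad y ?X)) + ad g (ad y ?X)"
      unfolding Suc by (simp only: ad_scale_right ad_commute[OF X e(3)])
    also have "\<dots> = End_scale (of_nat (Suc (Suc n))) (ad g (ad y ?X))"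
      by (simp only: End_scale_def fun_eq_iff plus_fun_apply of_nat_Suc[of "Suc n"] scale_left_distrib
          scale_one add.commute) simp
    finally show ?case by simp
  qed
qed

text \<open>Applying \<open>ad E23\<close> and \<open>ad E13\<close> to \<open>(ad E34)\<^sup>n f = 0\<close> trades \<open>E34\<close> for \<open>E24\<close> and \<open>E14\<close>.\<close>

lemma orbit_vector_vanish:
  assumes f: "f \<in> End" and e: "ad E13 f = 0" "ad E23 f = 0"
    and top: "((ad E34) ^^ n) f = 0"
  shows "a + b + c = n \<Longrightarrow> orbit_vector f a b c = 0"
proof (induction a arbitrary: c)
  case 0
  then show ?case
  proof (induction b arbitrary: c)
    case 0
    then show ?case using top by (simp add: orbit_vector_def)
  next
    case (Suc b)
    then have "((ad E24) ^^ b) (((ad E34) ^^ Suc c) f) = 0"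
      using Suc.IH[of "Suc c"] by (simp only: orbit_vector_def funpow_0 add_Suc add_Suc_right)
    then have "ad E23 (((ad E24) ^^ b) (((ad E34) ^^ Suc c) f)) = 0"
      by (simp only: ad_zero)
    moreover have "ad E23 (((ad E24) ^^ b) (((ad E34) ^^ Suc c) f))
        = ((ad E24) ^^ b) (ad E23 (((ad E34) ^^ Suc c) f))"
      by (rule ad_power_commute[OF ad_power_End[OF f]]) (simp add: bracket_table_raising)
    moreover have "ad E23 (((ad E34) ^^ Suc c) f) = End_scale (of_nat (Suc c)) (ad E24 (((ad E34) ^^ c) f))"
      by (rule ad_raise_power[OF f e(2)]) (simp_all add: bracket_table bracket_table_raising)
    ultimately have "End_scale (of_nat (Suc c)) (((ad E24) ^^ Suc b) (((ad E34) ^^ c) f)) = 0"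
      by (simp add: ad_power_scale funpow_swap1 del: of_nat_Suc)
    then show ?case
      by (simp add: orbit_vector_def End_scale_def fun_eq_iff del: of_nat_Suc)
  qed
next
  case (Suc a)
  let ?Y = "\<lambda>c. ((ad E24) ^^ b) (((ad E34) ^^ c) f)"
  have Y: "?Y c \<in> End" for c by (intro ad_power_End f)
  have "((ad E14) ^^ a) (?Y (Suc c)) = 0"
    using Suc.IH[of "Suc c"] Suc.prems by (simp only: orbit_vector_def add_Suc add_Suc_right)
  then have "ad E13 (((ad E14) ^^ a) (?Y (Suc c))) = 0"
    by (simp only: ad_zero)
  moreover have "ad E13 (((ad E14) ^^ a) (?Y (Suc c))) = ((ad E14) ^^ a) (ad E13 (?Y (Suc c)))"
    by (rule ad_power_commute[OF Y]) (simp add: bracket_table_raising)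
  moreover have "ad E13 (?Y (Suc c)) = ((ad E24) ^^ b) (ad E13 (((ad E34) ^^ Suc c) f))"
    by (rule ad_power_commute[OF ad_power_End[OF f]]) (simp add: bracket_table_raising)
  moreover have "ad E13 (((ad E34) ^^ Suc c) f) = End_scale (of_nat (Suc c)) (ad E14 (((ad E34) ^^ c) f))"
    by (rule ad_raise_power[OF f e(1)]) (simp_all add: bracket_table bracket_table_raising)
  moreover have "((ad E24) ^^ b) (ad E14 (((ad E34) ^^ c) f)) = ad E14 (?Y c)"
    by (rule ad_power_commute[OF ad_power_End[OF f], symmetric]) (simp add: bracket_table_raising)
  ultimately have "End_scale (of_nat (Suc c)) (((ad E14) ^^ Suc a) (?Y c)) = 0"
    by (simp add: ad_power_scale funpow_swap1 del: of_nat_Suc)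
  then show ?case
    by (simp add: orbit_vector_def End_scale_def fun_eq_iff del: of_nat_Suc)
qed

lemma generated_locally_finite:
  assumes f: "f \<in> End"
    and zero: "\<And>x. x \<in> {E12, E13, E23, E21, E31, E41, E32, E42, E43} \<Longrightarrow> ad x f = 0"
    and weight: "\<And>x. x \<in> {H1, H2, H3} \<Longrightarrow> \<exists>k. ad x f = End_scale k f"
    and top: "((ad E34) ^^ n) f = 0"
  shows "f \<in> locally_finite_End"
proof -
  interpret E: vector_space End_scale by (rule End_vector_space)
  let ?B = "{orbit_vector f a b c | a b c. a + b + c \<le> n}"
  let ?S = "E.span ?B"
  have "?B \<subseteq> (\<lambda>(a, b, c). orbit_vector f a b c) ` ({..n} \<times> {..n} \<times> {..n})"
    by (auto intro!: image_eqI[where x = "(_, _, _)"])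
  then have fin: "finite ?B" by (rule finite_subset) simp
  have in_S: "orbit_vector f a b c \<in> ?S" if "a + b + c \<le> n" for a b c
    by (rule E.span_base) (use that in blast)
  have f_S: "f \<in> ?S" using in_S[of 0 0 0] by (simp add: orbit_vector_def)
  have S_End: "g \<in> End" if "g \<in> ?S" for g
    using that
  proof (induction rule: E.span_induct_alt)
    case base
    show ?case by (simp add: End_iff)
  next
    case (step c x y)
    then have "x \<in> End" using orbit_vector_End[OF f] by auto
    with step show ?case
      by (simp add: End_iff End_scale_def scale_right_distrib mult.commute algebra_simps)
  qed
  have stable: "ad x g \<in> ?S" if "\<And>b. b \<in> ?B \<Longrightarrow> ad x b \<in> ?S" "g \<in> ?S" for x g
    using that(2)
  proof (induction rule: E.span_induct_alt)
    case base
    show ?case by (simp only: ad_zero E.span_zero)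
  next
    case (step c b y)
    have "ad x (End_scale c b + y) = End_scale c (ad x b) + ad x y"
      by (simp only: ad_add_right ad_scale_right)
    then show ?case
      using E.span_add[OF E.span_scale[OF that(1)[OF step(1)], of c] step(2)] by (simp only:)
  qed
  \<comment> \<open>One raising step may leave the range of degrees, but the vectors of degree
    \<open>n\<close> vanish already, and with them those of degree \<open>Suc n\<close>.\<close>
  have top_S: "orbit_vector f a b c \<in> ?S" if "a + b + c \<le> Suc n" for a b c
  proof (cases "a + b + c \<le> n")
    case False
    have "orbit_vector f a b c = 0"
    proof -
      have "(a > 0 \<and> (a - 1) + b + c = n) \<or> (b > 0 \<and> a + (b - 1) + c = n) \<or> (c > 0 \<and> a + b + (c - 1) = n)"
        using that False by auto
      moreover note ad_zero
      moreover note van = orbit_vector_vanish[OF f zero zero top, simplified]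
      ultimately show ?thesis
        using van[of "a - 1" b c] van[of a "b - 1" c] van[of a b "c - 1"]
          orbit_vector_Suc[OF f, of "a - 1" b c] orbit_vector_Suc[OF f, of a "b - 1" c]
          orbit_vector_Suc[OF f, of a b "c - 1"] by auto
    qed
    then show ?thesis by (simp add: E.span_zero)
  qed (rule in_S)
  have raise_S: "ad E14 g \<in> ?S" "ad E24 g \<in> ?S" "ad E34 g \<in> ?S" if "g \<in> ?S" for g
    by (rule stable[OF _ that]; clarify; simp add: orbit_vector_Suc[OF f]; rule top_S; simp)+
  have basis_S: "ad x g \<in> ?S" if "g \<in> End" and
    "\<And>y. y \<in> {E12, E13, E14, E23, E24, E34, E21, E31, E41, E32, E42, E43, H1, H2, H3} \<Longrightarrow> ad y g \<in> ?S"
    for x g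
    by (subst sl_basis_expansion[of x], unfold Let_def ad_add_left[OF that(1)] ad_scale_left[OF that(1)])
      (intro E.span_add E.span_scale that(2); simp only: insert_iff simp_thms)
  \<comment> \<open>The induction is over all \<open>x\<close> at once: moving \<open>x\<close> past
    one raising operator produces the bracket, another Lie algebra element acting on a vector of
    lower degree.\<close>
  have orbit_S: "ad x (orbit_vector f a b c) \<in> ?S" if "a + b + c = m" "m \<le> n" for x a b c m
    using that
  proof (induction m arbitrary: x a b c)
    case 0
    then have abc: "orbit_vector f a b c = f" by (simp add: orbit_vector_def)
    have z: "0 \<in> ?S" by (rule E.span_zero)
    have cartan: "ad y f \<in> ?S" if "y \<in> {H1, H2, H3}" for y
      using weight[OF that] f_S by (auto intro: E.span_scale)
    have lower: "ad y f \<in> ?S" if "y \<in> {E12, E13, E23, E21, E31, E41, E32, E42, E43}" for y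
      using zero[OF that] z by simp
    show ?case
      unfolding abc
      by (rule basis_S[OF f])
        (elim insertE emptyE; (simp only: raise_S[OF f_S])?; (rule cartan lower; simp)?)
  next
    case (Suc m)
    have step: "ad x (ad y g) \<in> ?S"
      if "g \<in> End" "y \<in> {E14, E24, E34}" "ad x g \<in> ?S" "ad (lie_bracket x y) g \<in> ?S" for y g
    proof -
      have "ad x (ad y g) = ad y (ad x g) + ad (lie_bracket x y) g"
        using ad_bracket[OF that(1), of x y] by simp
      moreover have "ad y (ad x g) \<in> ?S" using that(2,3) raise_S by auto
      ultimately show ?thesis using that(4) by (simp add: E.span_add)
    qed
    have IH: "ad y (orbit_vector f a b c) \<in> ?S" if "a + b + c = m" for y a b c
      using Suc.IH that Suc.prems(2) by simp
    consider a' where "a = Suc a'" | b' where "b = Suc b'" | c' where "c = Suc c'"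
      using Suc.prems(1) by (cases a; cases b; cases c) auto
    then show ?case
    proof cases
      case 1
      then show ?thesis
        using step[OF orbit_vector_End[OF f], of E14 a' b c] IH Suc.prems
        by (simp add: orbit_vector_Suc[OF f])
    next
      case 2
      then show ?thesis
        using step[OF orbit_vector_End[OF f], of E24 a b' c] IH Suc.prems
        by (simp add: orbit_vector_Suc[OF f])
    next
      case 3
      then show ?thesis
        using step[OF orbit_vector_End[OF f], of E34 a b c'] IH Suc.prems
        by (simp add: orbit_vector_Suc[OF f])
    qed
  qed
  have "\<forall>x. \<forall>g\<in>?S. ad x g \<in> ?S"
    using stable orbit_S by blast
  moreover have "finite_dim_subspace_of_End ?S"
    unfolding finite_dim_subspace_of_End_def using S_End fin by blast
  ultimately show ?thesis
    unfolding locally_finite_End_def using f f_S by blast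
qed

end

section \<open>The locally finite endomorphism \<open>f\<close>, called \<open>extra\<close>\<close>

context highest_weight_rt
begin

lemma lower_closure_v0: "lower_closure v0 = UNIV"
  using submodule_lower_closure[OF v0_singular] simple lower_closure.base[of v0] v0_nonzero
  unfolding simple_module_def by blast

lemma lower_induct [case_names base add scale lower]:
  assumes "P v0" "\<And>u v. P u \<Longrightarrow> P v \<Longrightarrow> P (u + v)" "\<And>c v. P v \<Longrightarrow> P (scale c v)"
    "\<And>x v. x \<in> {E21, E32, E43} \<Longrightarrow> P v \<Longrightarrow> P (act x v)"
  shows "P v"
proof -
  have "v \<in> lower_closure v0" by (simp add: lower_closure_v0)
  then show ?thesis
    by (induction rule: lower_closure.induct) (use assms in blast)+
qed

definition extra :: "'v \<Rightarrow> 'v"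
  where "extra v = (THE x. minor x = theta (theta v))"

text \<open>The vectors \<open>v\<close> with \<open>theta (theta v)\<close> in the image of
  \<open>c\<close> include \<open>v0\<close> by \<open>minor_q\<close>, and \<open>n_-\<close>
  preserves them because it commutes with \<open>c\<close> and \<open>theta\<close>. Injectivity of
  \<open>c\<close> gives uniqueness.\<close>

lemma minor_extra: "minor (extra v) = theta (theta v)"
proof -
  have "\<exists>x. minor x = theta (theta v)"
  proof (induction v rule: lower_induct)
    case base
    then show ?case using minor_q by blast
  next
    case (add u v)
    then show ?case by (metis minor_linear(1) theta_linear(1))
  next
    case (scale c v)
    then show ?case by (metis minor_linear(4) theta_linear(2))
  next
    case (lower x v)
    then obtain w where w: "minor w = theta (theta v)" by blast
    have "minor (act x w) = theta (theta (act x v))"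
      using lower(1) by (auto simp: minor_commute theta_commute w)
    then show ?case by blast
  qed
  then have "\<exists>!x. minor x = theta (theta v)" using inj_minor unfolding inj_def by metis
  then show ?thesis unfolding extra_def by (rule theI')
qed

lemma extra_eqI: "minor x = theta (theta v) \<Longrightarrow> extra v = x"
  using minor_extra[of v] inj_minor unfolding inj_def by metis

lemma extra_linear: "extra (v + w) = extra v + extra w" "extra (scale c v) = scale c (extra v)"
  by (rule extra_eqI, simp add: minor_linear theta_linear minor_extra)+

lemma extra_End: "extra \<in> End"
  by (simp add: End_iff extra_linear)

lemma extra_v0: "extra v0 = q"
  by (rule extra_eqI) (rule minor_q)

lemma extra_zero: "extra 0 = 0"
  using extra_linear(2)[of 0 0] by simp

text \<open>On (\<open>H1\<close>, \<open>H2\<close>, \<open>H3\<close>) the weights of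
  \<open>c\<close> and \<open>theta\<close> are (0, -2, 0) and (0, -1, -2), so that of
  \<open>f\<close> is (0, 0, -4).\<close>

lemma extra_commute:
  "extra (act E21 v) = act E21 (extra v)" "extra (act E32 v) = act E32 (extra v)"
  "extra (act E43 v) = act E43 (extra v)" "extra (act E12 v) = act E12 (extra v)"
  "extra (act H1 v) = act H1 (extra v)" "extra (act H2 v) = act H2 (extra v)"
  "extra (act H3 v) = act H3 (extra v) + scale 4 (extra v)"
  by (rule extra_eqI, rule eq_by_functionals,
      simp add: minor_commute theta_commute minor_extra minor_linear theta_linear
        linear_functional_simps algebra_simps)+

text \<open>As \<open>E23\<close> does not commute with \<open>c\<close>, the commutation is checked
  on \<open>v0\<close>, where both sides vanish by \<open>E23_q\<close>, and carried along
  \<open>U(n_-)\<close>, using that \<open>f\<close> commutes with \<open>H2\<close>.\<close>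

lemma extra_E23: "extra (act E23 v) = act E23 (extra v)"
proof (induction v rule: lower_induct)
  case base
  then show ?case by (simp add: extra_v0 E23_q extra_zero)
next
  case (lower x v)
  then show ?case by (auto simp: extra_commute normal_order extra_linear)
qed (simp_all add: extra_linear act_linear)

lemma E12_q: "act E12 q = 0"
  using extra_commute(4)[of v0] by (simp add: extra_v0 extra_zero)

lemma ad_extra_zero: "x \<in> {E21, E32, E43, E12, E23} \<Longrightarrow> ad x extra = 0"
  by (auto simp: ad_def fun_eq_iff extra_commute extra_E23)

lemma bracket_table_E34:
  "lie_bracket H3 E34 = lie_scale 2 E34" "lie_bracket E43 E34 = - H3"
  "lie_bracket E21 E34 = 0" "lie_bracket E32 E34 = 0"
  unfolding basis_defs
  by (transfer; simp add: vec_eq_iff all_index matrix_matrix_mult_def sum_index)+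

lemma ad_power_zero: "((ad x) ^^ n) 0 = 0"
  by (induction n) (simp_all only: funpow.simps id_apply o_apply ad_zero)

lemma ad_apply: "ad x f v = act x (f v) - f (act x v)"
  by (simp add: ad_def)

lemma ad_zero_commute:
  assumes "ad x f = 0"
  shows "f (act x v) = act x (f v)"
proof -
  have "ad x f v = 0" by (simp only: assms zero_fun_apply)
  then show ?thesis by (simp add: ad_apply)
qed

lemma ad_H3_power:
  "ad H3 (((ad E34) ^^ n) extra) = End_scale (2 * of_nat n - 4) (((ad E34) ^^ n) extra)"
proof (induction n)
  case 0
  show ?case by (simp add: ad_def fun_eq_iff extra_commute End_scale_def)
next
  case (Suc n)
  let ?g = "((ad E34) ^^ n) extra"
  have g: "?g \<in> End" by (rule ad_power_End[OF extra_End])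
  have "2 * of_nat (Suc n) - 4 = (2 * of_nat n - 4) + (2 :: complex)" by simp
  moreover have "ad H3 (ad E34 ?g) = ad E34 (ad H3 ?g) + End_scale 2 (ad E34 ?g)"
    using ad_bracket[OF g, of H3 E34] by (simp add: bracket_table_E34 ad_scale_left[OF g])
  ultimately show ?case
    by (simp only: funpow.simps o_apply Suc ad_scale_right)
      (simp only: End_scale_def fun_eq_iff plus_fun_apply scale_left_distrib, simp)
qed

text \<open>The sl2 formula for the lowest weight vector \<open>f\<close> of weight -4. The factor
  vanishes at \<open>n = 4\<close>, which makes the fifth power commute with
  \<open>E43\<close>.\<close>

lemma ad_E43_power:
  "ad E43 (((ad E34) ^^ Suc n) extra) = End_scale (of_nat (Suc n) * (4 - of_nat n)) (((ad E34) ^^ n) extra)"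
proof (induction n)
  case 0
  have "ad E43 (ad E34 extra) = - ad H3 extra + ad E34 (ad E43 extra)"
    using ad_bracket[OF extra_End, of E43 E34] ad_neg_left[OF extra_End, of H3]
    by (simp add: bracket_table_E34)
  then show ?case
    using ad_H3_power[of 0] by (simp add: ad_extra_zero ad_zero) (simp add: End_scale_def fun_eq_iff)
next
  case (Suc n)
  let ?g = "((ad E34) ^^ Suc n) extra"
  have g: "?g \<in> End" by (rule ad_power_End[OF extra_End])
  have *: "of_nat (Suc (Suc n)) * (4 - of_nat (Suc n))
      = of_nat (Suc n) * (4 - of_nat n) - (2 * of_nat (Suc n) - (4 :: complex))"
    by (simp add: algebra_simps)
  have "ad E43 (ad E34 ?g) = ad E34 (ad E43 ?g) - ad H3 ?g"
    using ad_bracket[OF g, of E43 E34] ad_neg_left[OF g, of H3]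
    by (simp add: bracket_table_E34 algebra_simps)
  also have "\<dots> = End_scale (of_nat (Suc n) * (4 - of_nat n)) ?g - End_scale (2 * of_nat (Suc n) - 4) ?g"
    unfolding Suc ad_H3_power ad_scale_right by simp
  also have "\<dots> = End_scale (of_nat (Suc (Suc n)) * (4 - of_nat (Suc n))) ?g"
    unfolding * by (simp only: End_scale_def fun_eq_iff minus_apply scale_left_diff_distrib) simp
  finally show ?case by simp
qed

text \<open>\<open>(ad E34)\<^sup>5 f\<close> still commutes with \<open>n\<^sub>-\<close>, so it vanishes because it kills \<open>v\<^sub>0\<close>.\<close>

lemma ad_E34_extra: "((ad E34) ^^ 5) extra = 0"
proof -
  let ?h = "((ad E34) ^^ 5) extra"
  have h: "?h \<in> End" by (rule ad_power_End[OF extra_End])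
  have "ad E43 ?h = 0"
    using ad_E43_power[of 4] by (simp add: End_scale_def fun_eq_iff)
  moreover have "ad x ?h = 0" if "x \<in> {E21, E32}" for x
  proof -
    have "ad x ?h = ((ad E34) ^^ 5) (ad x extra)"
      by (rule ad_power_commute[OF extra_End]) (use that bracket_table_E34 in auto)
    also have "\<dots> = ((ad E34) ^^ 5) 0" using that ad_extra_zero[of x] by auto
    also have "\<dots> = 0" by (rule ad_power_zero)
    finally show ?thesis .
  qed
  ultimately have "ad x ?h = 0" if "x \<in> {E21, E32, E43}" for x using that by blast
  note lower = this
  have commute: "?h (act x v) = act x (?h v)" if "x \<in> {E21, E32, E43}" for x v
    by (rule ad_zero_commute) (rule lower[OF that])
  have "(((ad E34) ^^ n) extra) v0 = ((act E34) ^^ n) q" for n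
  proof (induction n)
    case (Suc n)
    have "(((ad E34) ^^ n) extra) 0 = 0"
      using End_diff[OF ad_power_End[OF extra_End], of n E34 0 0] by simp
    moreover have "ad E34 g v0 = act E34 (g v0) - g 0" for g by (simp add: ad_def)
    ultimately show ?case by (simp only: funpow.simps o_apply Suc) simp
  qed (simp add: extra_v0)
  from this[of 5] have top: "?h v0 = 0"
    by (simp add: numeral_eq_Suc E34_q)
  have "?h v = 0" for v
  proof (induction v rule: lower_induct)
    case base
    show ?case by (rule top)
  next
    case (lower x v)
    then show ?case by (simp add: commute)
  next
    case (add u v)
    then show ?case using h unfolding End_iff by (metis add.right_neutral)
  next
    case (scale c v)
    then show ?case using h unfolding End_iff by (metis scale_zero_right)
  qed
  then show ?thesis by (simp only: fun_eq_iff zero_fun_apply) simp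
qed

lemma extra_locally_finite: "extra \<in> locally_finite_End"
proof (rule generated_locally_finite[OF extra_End])
  have br: "lie_bracket E12 E23 = E13" "lie_bracket E32 E21 = E31" "lie_bracket E43 E32 = E42"
    "lie_bracket E43 E31 = E41"
    unfolding basis_defs
    by (transfer; simp add: vec_eq_iff all_index matrix_matrix_mult_def sum_index)+
  have br_zero: "ad (lie_bracket x y) extra = 0" if "ad x extra = 0" "ad y extra = 0" for x y
    by (simp only: ad_bracket[OF extra_End] that ad_zero) simp
  have e: "ad E13 extra = 0" "ad E31 extra = 0" "ad E42 extra = 0" "ad E41 extra = 0"
    using br_zero[of E12 E23] br_zero[of E32 E21] br_zero[of E43 E32] br_zero[of E43 E31]
    by (simp_all add: br ad_extra_zero)
  show "ad x extra = 0" if "x \<in> {E12, E13, E23, E21, E31, E41, E32, E42, E43}" for x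
    using that by (elim insertE emptyE; simp only: ad_extra_zero e insert_iff simp_thms)
  show "\<exists>k. ad x extra = End_scale k extra" if "x \<in> {H1, H2, H3}" for x
  proof -
    have "ad H1 extra = End_scale 0 extra" "ad H2 extra = End_scale 0 extra"
      "ad H3 extra = End_scale (- 4) extra"
      by (simp_all add: ad_def fun_eq_iff extra_commute End_scale_def)
    then show ?thesis using that by auto
  qed
  show "((ad E34) ^^ 5) extra = 0"
    by (rule ad_E34_extra)
qed

end

section \<open>Dividing by a root vector\<close>

definition ring_ad :: "'a::ring \<Rightarrow> 'a \<Rightarrow> 'a"
  where "ring_ad a r = a * r - r * a"

lemma ring_ad_power_zero: "(ring_ad a ^^ n) 0 = 0"
  by (induction n) (simp_all add: ring_ad_def)

lemma ring_ad_power_add: "(ring_ad a ^^ n) (r + s) = (ring_ad a ^^ n) r + (ring_ad a ^^ n) s"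
  by (induction n) (simp_all add: ring_ad_def algebra_simps)

text \<open>By the Leibniz rule, with one of the two exponents dropping at each step.\<close>

lemma ring_ad_nilpotent_mult:
  assumes "(ring_ad a ^^ m) r = 0" "(ring_ad a ^^ n) s = 0"
  shows "(ring_ad a ^^ (m + n)) (r * s) = 0"
  using assms
proof (induction "m + n" arbitrary: m n r s)
  case 0
  then show ?case by simp
next
  case (Suc k)
  show ?case
  proof (cases m)
    case 0
    then show ?thesis using Suc.prems by (simp add: ring_ad_power_zero)
  next
    case m: (Suc m')
    show ?thesis
    proof (cases n)
      case 0
      then show ?thesis using Suc.prems by (simp add: ring_ad_power_zero)
    next
      case n: (Suc n')
      have k: "k = m' + n" "k = m + n'" using Suc.hyps(2) m n by auto
      have "(ring_ad a ^^ m') (ring_ad a r) = 0" "(ring_ad a ^^ n') (ring_ad a s) = 0"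
        using Suc.prems unfolding m n by (simp_all add: funpow_swap1)
      then have "(ring_ad a ^^ k) (ring_ad a r * s) = 0" "(ring_ad a ^^ k) (r * ring_ad a s) = 0"
        using Suc.hyps(1)[OF k(1)] Suc.hyps(1)[OF k(2)] Suc.prems k by simp_all
      moreover have "ring_ad a (r * s) = ring_ad a r * s + r * ring_ad a s"
        by (simp add: ring_ad_def algebra_simps)
      moreover have "m + n = Suc k" using Suc.hyps(2) by simp
      ultimately show ?thesis by (simp only: funpow_Suc_right o_apply ring_ad_power_add) simp
    qed
  qed
qed

text \<open>The matrix E21 has square zero, and each term of the triple commutator contains it twice
  in a row.\<close>

lemma bracket_E21_cube: "lie_bracket E21 (lie_bracket E21 (lie_bracket E21 (x :: 4 sl))) = 0"
  unfolding basis_defs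
  by transfer (simp add: vec_eq_iff all_index matrix_matrix_mult_def sum_index)

lemma uea_gen_zero: "uea_gen 0 = 0"
  using uea_gen_add[of 0 0] by simp

context lie_module
begin

lemma uea_const_commute: "uea_const c * u = u * (uea_const c :: 'g uea)"
proof -
  have "free_const c * p = p * free_const c" for p :: "'g free_alg"
    by (induction p rule: free_alg_induct)
      (simp_all add: free_const_def mult_single mult.commute distrib_left distrib_right)
  then show ?thesis by (induction u) (simp add: uea_const.abs_eq times_uea.abs_eq)
qed

end

text \<open>Constants and generators are killed by powers of \<open>ad E21\<close>; products and
  sums inherit this.\<close>

lemma (in sl4_module) ad_E21_locally_nilpotent:
  "\<exists>n. (ring_ad (uea_gen E21) ^^ n) (u :: 4 sl uea) = 0"
proof -
  let ?d = "ring_ad (uea_gen E21 :: 4 sl uea)"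
  have const: "(?d ^^ 1) (uea_const c) = 0" for c
    by (simp add: ring_ad_def uea_const_commute)
  have "?d (uea_gen x) = uea_gen (lie_bracket E21 x)" for x
    by (simp add: ring_ad_def uea_gen_bracket)
  then have gen: "(?d ^^ 3) (uea_gen x) = 0" for x
    by (simp add: numeral_3_eq_3 bracket_E21_cube uea_gen_zero)
  have word: "\<exists>n. (?d ^^ n) (abs_uea (Poly_Mapping.single (Word xs) c)) = 0" for xs c
  proof (induction xs)
    case Nil
    have "abs_uea (Poly_Mapping.single (Word []) c) = (uea_const c :: 4 sl uea)"
      by (simp add: uea_const.abs_eq free_const_def zero_word_def)
    then show ?case using const[of c] by (intro exI[of _ 1]) simp
  next
    case (Cons x xs)
    have w: "Word (x # xs) = Word [x] + Word xs" by (simp add: plus_word_def)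
    have "abs_uea (Poly_Mapping.single (Word (x # xs)) c)
        = uea_gen x * abs_uea (Poly_Mapping.single (Word xs) c)"
      by (simp add: w uea_gen.abs_eq free_gen_def times_uea.abs_eq mult_single)
    moreover obtain n where "(?d ^^ n) (abs_uea (Poly_Mapping.single (Word xs) c)) = 0"
      using Cons by auto
    ultimately show ?case using ring_ad_nilpotent_mult[OF gen, of n _ x] by (intro exI[of _ "3 + n"]) simp
  qed
  have "\<exists>n. (?d ^^ n) (abs_uea p) = 0" for p
  proof (induction p rule: free_alg_induct)
    case (single w c)
    show ?case using word[of "letters w" c] by simp
  next
    case (add p q)
    then obtain m n where mn: "(?d ^^ m) (abs_uea p) = 0" "(?d ^^ n) (abs_uea q) = 0" by auto
    have "(?d ^^ (m + n)) (abs_uea (p + q)) = (?d ^^ (n + m)) (abs_uea p) + (?d ^^ (m + n)) (abs_uea q)"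
      by (simp add: plus_uea.abs_eq[symmetric] ring_ad_power_add add.commute)
    also have "\<dots> = 0"
      unfolding funpow_add o_apply mn ring_ad_power_zero by simp
    finally show ?case ..
  qed
  then show ?thesis by (induction u) simp
qed

context lie_module
begin

lemma submodule_uea_act:
  assumes "submodule N" "v \<in> N"
  shows "uea_act u v \<in> N"
proof -
  have N: "subspace N" "\<And>x v. v \<in> N \<Longrightarrow> act x v \<in> N" using assms(1) by (auto simp: submodule_def)
  have "foldr act xs v \<in> N" for xs by (induction xs) (simp_all add: assms(2) N(2))
  then have "uea_act (abs_uea p) v \<in> N" for p
    unfolding uea_act_abs free_act_def word_act_def
    by (intro subspace_sum[OF N(1)] subspace_scale[OF N(1)])
  then show ?thesis by (induction u)
qed

end

text \<open>Here \<open>quot v\<close> plays the role of \<open>E21\<^sup>-\<^sup>1 v\<close>.\<close>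

locale E21_extension =
  L: highest_weight_rt scale act v0 + G: sl4_module gscale gact
  for scale :: "complex \<Rightarrow> 'v::ab_group_add \<Rightarrow> 'v" and act :: "4 sl \<Rightarrow> 'v \<Rightarrow> 'v" and v0
    and gscale :: "complex \<Rightarrow> 'w::ab_group_add \<Rightarrow> 'w" and gact :: "4 sl \<Rightarrow> 'w \<Rightarrow> 'w" +
  fixes embed :: "'v \<Rightarrow> 'w" and quot :: "'v \<Rightarrow> 'w"
  assumes embed_add: "embed (v + w) = embed v + embed w"
    and embed_scale: "embed (scale c v) = gscale c (embed v)"
    and embed_act: "embed (act x v) = gact x (embed v)"
    and inj_embed: "inj embed"
    and inj_E21: "inj (gact E21)"
    and E21_quot: "gact E21 (quot v) = embed v"
begin

lemma embed_zero: "embed 0 = 0"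
  using embed_add[of 0 0] by simp

lemma embed_minus: "embed (- v) = - embed v"
  using embed_scale[of "-1" v] by simp

lemma embed_diff: "embed (v - w) = embed v - embed w"
  using embed_add[of v "- w"] by (simp add: embed_minus)

lemmas embed_linear = embed_add embed_scale embed_zero embed_minus embed_diff

lemma E21_cancel: "gact E21 z = gact E21 z' \<Longrightarrow> z = z'"
  using inj_E21 by (auto dest: injD)

lemma E21_eq_zero: "gact E21 z = 0 \<Longrightarrow> z = 0"
  using E21_cancel[of z 0] by simp

lemma embed_eq_zero: "embed v = 0 \<Longrightarrow> v = 0"
  using injD[OF inj_embed, of v 0] embed_zero by simp

lemma embed_uea_act: "embed (L.uea_act u v) = G.uea_act u (embed v)"
proof -
  have word: "embed (L.word_act w v) = G.word_act w (embed v)" for w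
  proof -
    have "embed (foldr act xs v) = foldr gact xs (embed v)" for xs
      by (induction xs) (simp_all add: embed_act)
    then show ?thesis by (simp add: L.word_act_def G.word_act_def)
  qed
  have "embed (L.free_act p v) = G.free_act p (embed v)" for p
    by (induction p rule: L.free_alg_induct)
      (simp_all add: L.free_act_single G.free_act_single L.free_act_add G.free_act_add embed_linear word)
  then show ?thesis by (induction u) (simp add: L.uea_act_abs G.uea_act_abs)
qed

text \<open>Commuting \<open>E21\<close> past \<open>r\<close> repeatedly moves \<open>quot m\<close> into the image of \<open>embed\<close>.\<close>

lemma annihilator_acts_zero_on_quot:
  assumes "\<And>v. L.uea_act r v = 0"
  shows "G.uea_act r (quot m) = 0"
proof -
  let ?a = "uea_gen E21 :: 4 sl uea"
  let ?d = "ring_ad ?a"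
  have "G.uea_act r (quot m) = 0" if "(?d ^^ n) r = 0" "\<And>v. L.uea_act r v = 0" for n r
    using that
  proof (induction n arbitrary: r)
    case 0
    then have "r = 0" by simp
    moreover have "G.uea_act (0 :: 4 sl uea) z = 0" for z using G.uea_act_diff[of 0 0 z] by simp
    ultimately show ?case by simp
  next
    case (Suc n)
    have "L.uea_act (?d r) v = 0" for v
      by (simp add: ring_ad_def L.uea_act_diff L.uea_act_mult Suc.prems(2) L.uea_act_gen)
    then have "G.uea_act (?d r) (quot m) = 0"
      using Suc.prems(1) by (intro Suc.IH) (simp_all add: funpow_swap1)
    moreover have "G.uea_act r (embed m) = 0"
      by (simp add: embed_uea_act[symmetric] Suc.prems(2) embed_zero)
    ultimately have "gact E21 (G.uea_act r (quot m)) = 0"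
      by (simp add: ring_ad_def G.uea_act_diff G.uea_act_mult G.uea_act_gen E21_quot)
    then show ?case by (rule E21_eq_zero)
  qed
  then show ?thesis using L.ad_E21_locally_nilpotent[of r] assms by blast
qed

text \<open>The commutator of \<open>E21\<close> and \<open>u\<close> annihilates \<open>L\<close>,
  hence also \<open>quot m\<close>. So \<open>u\<close> commutes with \<open>E21\<close> there, and
  \<open>E21\<close> can be cancelled.\<close>

lemma uea_act_quot:
  assumes "\<And>v. L.uea_act u (act E21 v) = act E21 (L.uea_act u v)"
  shows "G.uea_act u (quot m) = quot (L.uea_act u m)"
proof -
  let ?a = "uea_gen E21 :: 4 sl uea"
  have "G.uea_act (?a * u - u * ?a) (quot m) = 0"
    by (rule annihilator_acts_zero_on_quot)
      (simp add: L.uea_act_diff L.uea_act_mult L.uea_act_gen assms)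
  then have "gact E21 (G.uea_act u (quot m)) = G.uea_act u (embed m)"
    by (simp add: G.uea_act_diff G.uea_act_mult G.uea_act_gen E21_quot)
  also have "\<dots> = gact E21 (quot (L.uea_act u m))"
    by (simp add: E21_quot embed_uea_act)
  finally show ?thesis by (rule E21_cancel)
qed

text \<open>Division by \<open>E21\<close> adds the first simple root to the weight: 2 on
  \<open>H1\<close>, -1 on \<open>H2\<close>, 0 on \<open>H3\<close>.\<close>

lemma quot_H1:
  assumes "act H1 m = scale (- 2) m"
  shows "gact H1 (quot m) = 0"
proof (rule E21_eq_zero)
  have "gact H1 (gact E21 (quot m)) = gact E21 (gact H1 (quot m)) - gscale 2 (gact E21 (quot m))"
    by (simp add: G.normal_order)
  then show "gact E21 (gact H1 (quot m)) = 0"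
    by (simp add: E21_quot embed_act[symmetric] assms embed_linear)
qed

lemma quot_H2:
  assumes "act H2 m = scale k m"
  shows "gact H2 (quot m) = gscale (k - 1) (quot m)"
proof (rule E21_cancel)
  have "gact H2 (gact E21 (quot m)) = gact E21 (gact H2 (quot m)) + gact E21 (quot m)"
    by (simp add: G.normal_order)
  then show "gact E21 (gact H2 (quot m)) = gact E21 (gscale (k - 1) (quot m))"
    by (simp add: E21_quot embed_act[symmetric] assms embed_linear G.act_linear
        G.scale_left_diff_distrib)
qed

lemma quot_H3:
  assumes "act H3 m = scale k m"
  shows "gact H3 (quot m) = gscale k (quot m)"
proof (rule E21_cancel)
  have "gact H3 (gact E21 (quot m)) = gact E21 (gact H3 (quot m))"
    by (simp add: G.normal_order)
  then show "gact E21 (gact H3 (quot m)) = gact E21 (gscale k (quot m))"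
    by (simp add: E21_quot embed_act[symmetric] assms embed_scale G.act_scale_right)
qed

text \<open>Moving \<open>E12\<close> past \<open>E21\<close> leaves a term with \<open>H1\<close>,
  which is 0 because the weight -2 of \<open>m\<close> was shifted to 0.\<close>

lemma quot_E12:
  assumes "act E12 m = 0" "act H1 m = scale (- 2) m"
  shows "gact E12 (quot m) = 0"
proof (rule E21_eq_zero)
  have "gact E12 (gact E21 (quot m)) = gact E21 (gact E12 (quot m)) + gact H1 (quot m)"
    by (simp add: G.normal_order)
  then show "gact E21 (gact E12 (quot m)) = 0"
    by (simp add: E21_quot embed_act[symmetric] assms quot_H1 embed_zero)
qed

lemma quot_E23_E34:
  "act E23 m = 0 \<Longrightarrow> gact E23 (quot m) = 0" "act E34 m = 0 \<Longrightarrow> gact E34 (quot m) = 0"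
proof -
  have "gact E23 (gact E21 (quot m)) = gact E21 (gact E23 (quot m))"
    "gact E34 (gact E21 (quot m)) = gact E21 (gact E34 (quot m))"
    by (simp_all add: G.normal_order)
  then show "act E23 m = 0 \<Longrightarrow> gact E23 (quot m) = 0" "act E34 m = 0 \<Longrightarrow> gact E34 (quot m) = 0"
    by (auto intro!: E21_eq_zero simp: E21_quot embed_act[symmetric] embed_zero)
qed

text \<open>Its weight (0, 0, -1, 1) is \<open>t(rho) - rho\<close>.\<close>

definition v1 :: 'w
  where "v1 = quot v0"

lemma v1_simps [simp]:
  "gact E12 v1 = 0" "gact E23 v1 = 0" "gact E34 v1 = 0"
  "gact H1 v1 = 0" "gact H2 v1 = v1" "gact H3 v1 = gscale (- 2) v1" "gact E21 v1 = embed v0"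
  using quot_H2[of v0 2] quot_H3[of v0 "- 2"]
  by (simp_all add: v1_def quot_E12 quot_E23_E34 quot_H1 E21_quot)

lemma v1_nonzero: "v1 \<noteq> 0"
proof
  assume "v1 = 0"
  then have "embed v0 = 0" using v1_simps(7) by simp
  then show False using embed_eq_zero L.v0_nonzero by blast
qed

lemma singular_v1: "G.singular 0 1 (- 2) v1"
  by (simp add: G.singular_def)

lemma E21_v1:
  "gact E21 (gact E43 v1) = embed (act E43 v0)"
  "gact E21 (gact E43 (gact E43 v1)) = embed (act E43 (act E43 v0))"
  "gact E21 (gact E43 (gact E43 (gact E43 v1))) = embed (act E43 (act E43 (act E43 v0)))"
proof -
  have "gact E21 (gact E43 z) = gact E43 (gact E21 z)" for z by (simp add: G.normal_order)
  then show "gact E21 (gact E43 v1) = embed (act E43 v0)"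
    "gact E21 (gact E43 (gact E43 v1)) = embed (act E43 (act E43 v0))"
    "gact E21 (gact E43 (gact E43 (gact E43 v1))) = embed (act E43 (act E43 (act E43 v0)))"
    by (simp_all only: v1_simps embed_act)
qed

lemmas test_functional = E21_v1 G.act_linear G.normal_order G.linear_functional_simps
  L.act_linear L.normal_order embed_act[symmetric] embed_linear algebra_simps

text \<open>This is \<open>relation_W\<close> divided by \<open>E21\<close> twice.\<close>

lemma relation_v1: "gscale 2 (gact E42 v1) + gact E32 (gact E43 v1) = 0" (is "?e = 0")
proof -
  have "gact E21 (gact E21 ?e) = embed (act E32 (act E21 (act E43 v0)) - scale 2 (act E31 (act E43 v0))
    + scale 2 (act E42 (act E21 v0)) - scale 4 (act E41 v0))"
    by (rule G.eq_by_functionals) (simp add: test_functional)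
  also have "\<dots> = 0" by (simp only: L.relation_W embed_zero)
  finally show ?thesis by (rule E21_eq_zero[OF E21_eq_zero])
qed

text \<open>Apply \<open>E21\<close> to \<open>relation_v1\<close>; its brackets with
  \<open>E42\<close> and \<open>E32\<close> give the left side, and the rest lies in the image of
  \<open>embed\<close>.\<close>

lemma relation_v1_embed:
  "gscale 2 (gact E41 v1) + gact E31 (gact E43 v1)
    = embed (scale 2 (act E42 v0) + act E32 (act E43 v0))" (is "?l = ?r")
proof -
  have "?r - ?l = gact E21 (gscale 2 (gact E42 v1) + gact E32 (gact E43 v1))"
    by (rule G.eq_by_functionals) (simp add: test_functional)
  also have "\<dots> = 0" by (simp only: relation_v1 G.act_zero_right)
  finally show ?thesis by simp
qed

text \<open>Multiples of the two relations for \<open>v1\<close> reduce all monomials of this weight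
  without \<open>E21\<close> to the single vector \<open>b\<close>, modulo the image of
  \<open>embed\<close>.\<close>

lemma monomial_reduction:
  defines "b \<equiv> gact E41 (gact E42 (gact E43 v1))"
  shows "gact E32 (gact E41 (gact E43 (gact E43 v1))) = gscale (- 3) b"
    and "gact E31 (gact E42 (gact E43 (gact E43 v1)))
      = gscale (- 3) b + embed (scale 3 (act E42 (act E42 (act E43 v0))) + act E32 (act E42 (act E43 (act E43 v0))))"
    and "gact E31 (gact E32 (gact E43 (gact E43 (gact E43 v1))))
      = gscale 12 b + embed (scale 4 (act E32 (act E42 (act E43 (act E43 v0))))
        + act E32 (act E32 (act E43 (act E43 (act E43 v0)))))"
proof -
  let ?R1 = "gscale 2 (gact E42 v1) + gact E32 (gact E43 v1)"
  let ?R3 = "gscale 2 (gact E41 v1) + gact E31 (gact E43 v1)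
    - embed (scale 2 (act E42 v0) + act E32 (act E43 v0))"
  have R3: "?R3 = 0" by (simp only: relation_v1_embed) simp
  have "gact E32 (gact E41 (gact E43 (gact E43 v1))) - gscale (- 3) b = gact E41 (gact E43 ?R1)"
    unfolding b_def by (rule G.eq_by_functionals) (simp add: test_functional)
  then show 1: "gact E32 (gact E41 (gact E43 (gact E43 v1))) = gscale (- 3) b"
    by (simp only: relation_v1 G.act_zero_right right_minus_eq)
  have "gact E31 (gact E42 (gact E43 (gact E43 v1))) - (gscale (- 3) b
      + embed (scale 3 (act E42 (act E42 (act E43 v0))) + act E32 (act E42 (act E43 (act E43 v0)))))
    = gact E42 (gact E43 ?R3)"
    unfolding b_def by (rule G.eq_by_functionals) (simp add: test_functional)
  then show "gact E31 (gact E42 (gact E43 (gact E43 v1)))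
      = gscale (- 3) b + embed (scale 3 (act E42 (act E42 (act E43 v0))) + act E32 (act E42 (act E43 (act E43 v0))))"
    by (simp only: R3 G.act_zero_right right_minus_eq)
  have "gact E31 (gact E32 (gact E43 (gact E43 (gact E43 v1)))) - (gscale 12 b
      + embed (scale 4 (act E32 (act E42 (act E43 (act E43 v0))))
        + act E32 (act E32 (act E43 (act E43 (act E43 v0))))))
    = gact E32 (gact E43 (gact E43 ?R3)) - gscale 4 (gact E41 (gact E43 ?R1))"
    unfolding b_def by (rule G.eq_by_functionals) (simp add: test_functional)
  then show "gact E31 (gact E32 (gact E43 (gact E43 (gact E43 v1))))
      = gscale 12 b + embed (scale 4 (act E32 (act E42 (act E43 (act E43 v0))))
        + act E32 (act E32 (act E43 (act E43 (act E43 v0)))))"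
    by (simp only: R3 relation_v1 G.act_zero_right right_minus_eq G.scale_zero_right diff_0_right)
qed


lemma E43_power_v1_nonzero: "((gact E43) ^^ n) v1 \<noteq> 0"
  by (rule G.sl2_power_nonzero[of E34 _ H3 "- 2" E43])
    (simp_all only: v1_simps v1_nonzero G.normal_order G.act_linear two_not_nat not_False_eq_True)

text \<open>Used to see the coefficient of \<open>b\<close>: \<open>E12\<close> does not kill
  \<open>b\<close>, whereas it kills the embedded monomials.\<close>

lemma reduced_monomial_raise:
  "gact E12 (gact E41 (gact E42 (gact E43 v1))) = - gact E42 (gact E42 (gact E43 v1))"
  "gact E42 (gact E42 (gact E43 v1)) \<noteq> 0"
proof -
  show "gact E12 (gact E41 (gact E42 (gact E43 v1))) = - gact E42 (gact E42 (gact E43 v1))"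
    by (rule G.eq_by_functionals) (simp add: test_functional)
  have "gact E23 (gact E23 (gact E42 (gact E42 (gact E43 v1)))) = gscale 2 (((gact E43) ^^ 3) v1)"
    by (rule G.eq_by_functionals) (simp add: test_functional numeral_3_eq_3)
  then show "gact E42 (gact E42 (gact E43 v1)) \<noteq> 0"
    using E43_power_v1_nonzero[of 3] by auto
qed

end

section \<open>Vectors of the weight of \<open>E43^2 E42^2 v0\<close> killed by
  \<open>E23\<close>\<close>

context highest_weight_rt
begin

text \<open>Applying \<open>E23\<close>, and \<open>E23\<close> after \<open>E34\<close>, gives the
  independent equations \<open>x = 5 * y\<close> and \<open>10 * x = 48 * y\<close>.\<close>

lemma independent_monomials:
  assumes "scale x (act E42 (act E43 (act E43 v0))) + scale y (act E32 (act E43 (act E43 (act E43 v0)))) = 0"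
    (is "?z = 0")
  shows "x = 0" "y = 0"
proof -
  have "act E23 ?z = scale (5 * y - x) (((act E43) ^^ 3) v0)"
    by (rule eq_by_functionals) (simp add: test_functional numeral_3_eq_3)
  then have 1: "x = 5 * y"
    using E43_power_nonzero[of 3] by (simp only: assms act_zero_right) (metis scale_eq_0_iff right_minus_eq)
  have "act E23 (act E34 ?z) = scale (10 * x - 48 * y) (((act E43) ^^ 2) v0)"
    by (rule eq_by_functionals) (simp add: test_functional numeral_2_eq_2)
  then have 2: "10 * x = 48 * y"
    using E43_power_nonzero[of 2] by (simp only: assms act_zero_right) (metis scale_eq_0_iff right_minus_eq)
  show "y = 0" using 1 2 by simp
  then show "x = 0" using 1 by simp
qed

lemma no_E23_invariant:
  assumes "l = scale x (act E42 (act E42 (act E43 v0))) + scale y (act E32 (act E42 (act E43 (act E43 v0))))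
      + scale z (act E32 (act E32 (act E43 (act E43 (act E43 v0)))))"
    and "act E23 l = 0"
  shows "l = 0"
proof -
  have "act E23 l = scale (3 * y - 2 * x) (act E42 (act E43 (act E43 v0)))
      + scale (8 * z - y) (act E32 (act E43 (act E43 (act E43 v0))))"
    unfolding assms(1) by (rule eq_by_functionals) (simp add: test_functional)
  then have "3 * y - 2 * x = 0" "8 * z - y = 0"
    using independent_monomials[of "3 * y - 2 * x" "8 * z - y"] assms(2) by simp_all
  then have xy: "x = 12 * z" "y = 8 * z" by algebra+
  \<comment> \<open>The only candidates left are the multiples of \<open>E43\<close> applied to the
    vector of \<open>relation_Z\<close>.\<close>
  have "l = scale z (act E43 (scale 6 (act E42 (act E42 v0)) + scale 6 (act E32 (act E42 (act E43 v0)))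
    + act E32 (act E32 (act E43 (act E43 v0)))))"
    unfolding assms(1) xy by (rule eq_by_functionals) (simp add: test_functional)
  also have "\<dots> = 0" by (simp only: relation_Z act_zero_right scale_zero_right)
  finally show ?thesis .
qed

end

text \<open>The content (1, 2, 3) is that of \<open>q\<close> below \<open>v0\<close>, hence of
  \<open>quot q\<close> below \<open>v1\<close>.\<close>

lemma content_solutions:
  assumes "root_content e = (1, 2, 3)"
  shows "e \<in> {(0, 0, 0, 2, 1, 1), (0, 1, 0, 1, 1, 2), (0, 2, 0, 0, 1, 3), (1, 0, 0, 1, 0, 2),
    (1, 1, 0, 0, 0, 3), (0, 0, 1, 1, 0, 1), (0, 1, 1, 0, 0, 2)}"
proof -
  obtain a b c d i j where e: "e = (a, b, c, d, i, j)" by (cases e)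
  then have *: "a + c + i = 1" "a + b + c + d = 2" "c + d + j = 3" using assms by auto
  then consider "a = 1" "c = 0" "i = 0" | "a = 0" "c = 1" "i = 0" | "a = 0" "c = 0" "i = 1"
    by linarith
  then show ?thesis
  proof cases
    case 1
    then have "b = 0 \<and> d = 1 \<and> j = 2 \<or> b = 1 \<and> d = 0 \<and> j = 3" using * by linarith
    then show ?thesis using 1 by (auto simp: e)
  next
    case 2
    then have "b = 0 \<and> d = 1 \<and> j = 1 \<or> b = 1 \<and> d = 0 \<and> j = 2" using * by linarith
    then show ?thesis using 2 by (auto simp: e)
  next
    case 3
    then have "b = 0 \<and> d = 2 \<and> j = 1 \<or> b = 1 \<and> d = 1 \<and> j = 2 \<or> b = 2 \<and> d = 0 \<and> j = 3"
      using * by linarith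
    then show ?thesis using 3 by (auto simp: e)
  qed
qed

section \<open>The contradiction for \<open>E21^-1 q\<close>\<close>

context E21_extension
begin

lemma extra_not_in_image: "L.uea_act u \<noteq> L.extra"
proof
  assume u: "L.uea_act u = L.extra"
  define m where "m = quot L.q"
  have "G.uea_act u v1 = m"
    using uea_act_quot[of u v0] by (simp add: u L.extra_commute L.extra_v0 v1_def m_def)
  moreover have "G.uea_act u v1 \<in> G.lower_closure v1"
    by (rule G.submodule_uea_act[OF G.submodule_lower_closure[OF singular_v1] G.lower_closure.base])
  ultimately have m_closure: "m \<in> G.lower_closure v1" by simp
  have m_weight: "G.has_weight m 0 1 (- 6)"
    using quot_H1[OF L.cartan_q(1)] quot_H2[OF L.cartan_q(2)] quot_H3[OF L.cartan_q(3)]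
    by (simp add: G.has_weight_def m_def)
  have m_E12: "gact E12 m = 0" unfolding m_def by (rule quot_E12[OF L.E12_q L.cartan_q(1)])
  have m_E23: "gact E23 m = 0" unfolding m_def by (rule quot_E23_E34(1)[OF L.E23_q])
  have v1_weight: "G.has_weight v1 0 1 (- 2)" by (simp add: G.has_weight_def)
  obtain F c where F: "finite F" "m = (\<Sum>e\<in>F. gscale (c e) (G.pbw v1 e))"
    and wt: "\<forall>e\<in>F. \<forall>n1 n2 n3. root_content e = (n1, n2, n3) \<longrightarrow>
      0 = 0 - 2 * (of_nat n1 :: complex) + of_nat n2 \<and>
      1 = 1 + (of_nat n1 :: complex) - 2 * of_nat n2 + of_nat n3
      \<and> - 6 = - 2 + of_nat n2 - 2 * (of_nat n3 :: complex)"
    using G.lower_closure_weight[OF v1_weight m_closure m_weight] by (elim exE conjE) (rule that)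
  let ?S = "{(0, 0, 0, 2, 1, 1), (0, 1, 0, 1, 1, 2), (0, 2, 0, 0, 1, 3), (1, 0, 0, 1, 0, 2),
    (1, 1, 0, 0, 0, 3), (0, 0, 1, 1, 0, 1), (0, 1, 1, 0, 0, 2)} :: exponents set"
  have "F \<subseteq> ?S"
  proof
    fix e assume e: "e \<in> F"
    obtain n1 n2 n3 where n: "root_content e = (n1, n2, n3)" by (cases "root_content e")
    from wt e n have "0 = 0 - 2 * of_nat n1 + (of_nat n2 :: complex)"
      "1 = 1 + of_nat n1 - 2 * of_nat n2 + (of_nat n3 :: complex)"
      "- 6 = - 2 + of_nat n2 - 2 * (of_nat n3 :: complex)" by blast+
    \<comment> \<open>The weight equations are rewritten without subtraction, so that they descend
      to natural numbers; their only solution is (1, 2, 3).\<close>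
    then have "of_nat n2 = (of_nat (2 * n1) :: complex)"
      "of_nat (n1 + n3) = (of_nat (2 * n2) :: complex)" "of_nat (n2 + 4) = (of_nat (2 * n3) :: complex)"
      by (simp_all add: algebra_simps)
    then have "n2 = 2 * n1" "n1 + n3 = 2 * n2" "n2 + 4 = 2 * n3" by (simp_all only: of_nat_eq_iff)
    then have "root_content e = (1, 2, 3)" using n by simp
    then show "e \<in> ?S" by (rule content_solutions)
  qed
  define k where "k e = (if e \<in> F then c e else 0)" for e
  have "m = (\<Sum>e\<in>?S. gscale (k e) (G.pbw v1 e))"
    unfolding F(2) k_def using \<open>F \<subseteq> ?S\<close>
    by (intro sum.mono_neutral_cong_left) auto
  then have m: "m = gscale (k (0, 0, 0, 2, 1, 1)) (G.pbw v1 (0, 0, 0, 2, 1, 1))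
    + (gscale (k (0, 1, 0, 1, 1, 2)) (G.pbw v1 (0, 1, 0, 1, 1, 2))
    + (gscale (k (0, 2, 0, 0, 1, 3)) (G.pbw v1 (0, 2, 0, 0, 1, 3))
    + (gscale (k (1, 0, 0, 1, 0, 2)) (G.pbw v1 (1, 0, 0, 1, 0, 2))
    + (gscale (k (1, 1, 0, 0, 0, 3)) (G.pbw v1 (1, 1, 0, 0, 0, 3))
    + (gscale (k (0, 0, 1, 1, 0, 1)) (G.pbw v1 (0, 0, 1, 1, 0, 1))
    + gscale (k (0, 1, 1, 0, 0, 2)) (G.pbw v1 (0, 1, 1, 0, 0, 2)))))))"
    by simp
  define b where "b = gact E41 (gact E42 (gact E43 v1))"
  define l where "l x y z = scale x (act E42 (act E42 (act E43 v0)))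
    + scale y (act E32 (act E42 (act E43 (act E43 v0))))
    + scale z (act E32 (act E32 (act E43 (act E43 (act E43 v0)))))" for x y z
  have pbw: "G.pbw v1 (0, 0, 0, 2, 1, 1) = embed (act E42 (act E42 (act E43 v0)))"
    "G.pbw v1 (0, 1, 0, 1, 1, 2) = embed (act E32 (act E42 (act E43 (act E43 v0))))"
    "G.pbw v1 (0, 2, 0, 0, 1, 3) = embed (act E32 (act E32 (act E43 (act E43 (act E43 v0)))))"
    "G.pbw v1 (1, 0, 0, 1, 0, 2) = gscale (- 3) b
      + embed (scale 3 (act E42 (act E42 (act E43 v0))) + act E32 (act E42 (act E43 (act E43 v0))))"
    "G.pbw v1 (1, 1, 0, 0, 0, 3) = gscale 12 b + embed (scale 4 (act E32 (act E42 (act E43 (act E43 v0))))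
        + act E32 (act E32 (act E43 (act E43 (act E43 v0)))))"
    "G.pbw v1 (0, 0, 1, 1, 0, 1) = b" "G.pbw v1 (0, 1, 1, 0, 0, 2) = gscale (- 3) b"
    using monomial_reduction by (simp_all add: numeral_2_eq_2 numeral_3_eq_3 E21_v1 embed_act b_def)
  obtain r x y z where rm: "m = gscale r b + embed (l x y z)"
  proof
    let ?k1 = "k (0, 0, 0, 2, 1, 1)" and ?k2 = "k (0, 1, 0, 1, 1, 2)" and ?k3 = "k (0, 2, 0, 0, 1, 3)"
      and ?k4 = "k (1, 0, 0, 1, 0, 2)" and ?k5 = "k (1, 1, 0, 0, 0, 3)"
      and ?k6 = "k (0, 0, 1, 1, 0, 1)" and ?k7 = "k (0, 1, 1, 0, 0, 2)"
    show "m = gscale (12 * ?k5 + ?k6 - 3 * ?k4 - 3 * ?k7) b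
      + embed (l (?k1 + 3 * ?k4) (?k2 + ?k4 + 4 * ?k5) (?k3 + ?k5))"
      unfolding m pbw l_def
      by (rule G.eq_by_functionals)
        (simp add: G.linear_functional_simps G.act_linear embed_linear algebra_simps)
  qed
  \<comment> \<open>The factors of \<open>l\<close> commute with \<open>E12\<close>, so
    \<open>E12 m = 0\<close> concerns the multiple of \<open>b\<close> alone and forces
    \<open>r = 0\<close>.\<close>
  have "act E12 (l x y z) = 0"
    unfolding l_def by (rule L.eq_by_functionals) (simp add: L.test_functional)
  then have "gscale r (gact E42 (gact E42 (gact E43 v1))) = 0"
    using m_E12 reduced_monomial_raise(1)
    by (simp add: rm b_def G.act_linear embed_act[symmetric] embed_zero)
  then have "r = 0" using reduced_monomial_raise(2) by simp
  then have ml: "m = embed (l x y z)" by (simp add: rm)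
  then have "act E23 (l x y z) = 0"
    using m_E23 by (simp add: embed_act[symmetric] embed_eq_zero)
  then have "l x y z = 0"
    by (rule L.no_E23_invariant[OF l_def])
  then have "embed L.q = 0"
    using E21_quot[of L.q] ml by (simp add: m_def embed_zero)
  then show False using embed_eq_zero L.q_nonzero by blast
qed

end

section \<open>Germs of sequences as a localization\<close>

definition eventually_equal :: "(nat \<Rightarrow> 'a) \<Rightarrow> (nat \<Rightarrow> 'a) \<Rightarrow> bool"
  where "eventually_equal s t \<longleftrightarrow> (\<exists>N. \<forall>i\<ge>N. s i = t i)"

lemma eventually_equalI: "(\<And>i. N \<le> i \<Longrightarrow> s i = t i) \<Longrightarrow> eventually_equal s t"
  by (auto simp: eventually_equal_def)

lemma equivp_eventually_equal: "equivp (eventually_equal :: (nat \<Rightarrow> 'b) \<Rightarrow> _)"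
proof (rule equivpI)
  show "reflp (eventually_equal :: (nat \<Rightarrow> 'b) \<Rightarrow> _)" by (simp add: reflp_def eventually_equal_def)
  show "symp (eventually_equal :: (nat \<Rightarrow> 'b) \<Rightarrow> _)" unfolding symp_def eventually_equal_def by metis
  show "transp (eventually_equal :: (nat \<Rightarrow> 'b) \<Rightarrow> _)"
  proof (rule transpI)
    fix r s t :: "nat \<Rightarrow> 'b"
    assume "eventually_equal r s" "eventually_equal s t"
    then obtain M N where "\<forall>i\<ge>M. r i = s i" "\<forall>i\<ge>N. s i = t i"
      by (auto simp: eventually_equal_def)
    then show "eventually_equal r t" by (intro eventually_equalI[of "max M N"]) simp
  qed
qed

quotient_type 'a germ = "nat \<Rightarrow> 'a" / eventually_equal
  by (rule equivp_eventually_equal)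

instantiation germ :: (ab_group_add) ab_group_add
begin

lift_definition zero_germ :: "'a germ" is "\<lambda>_. 0" .

lift_definition plus_germ :: "'a germ \<Rightarrow> 'a germ \<Rightarrow> 'a germ" is "\<lambda>s t i. s i + t i"
proof -
  fix s s' t t' :: "nat \<Rightarrow> 'a"
  assume "eventually_equal s s'" "eventually_equal t t'"
  then obtain M N where "\<forall>i\<ge>M. s i = s' i" "\<forall>i\<ge>N. t i = t' i"
    by (auto simp: eventually_equal_def)
  then show "eventually_equal (\<lambda>i. s i + t i) (\<lambda>i. s' i + t' i)"
    by (intro eventually_equalI[of "max M N"]) simp
qed

lift_definition uminus_germ :: "'a germ \<Rightarrow> 'a germ" is "\<lambda>s i. - s i"
  by (auto simp: eventually_equal_def)

definition minus_germ :: "'a germ \<Rightarrow> 'a germ \<Rightarrow> 'a germ"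
  where "minus_germ s t = s + - t"

instance
proof
  fix r s t :: "'a germ"
  show "r + s + t = r + (s + t)" "r + s = s + r" "0 + r = r" "- r + r = 0"
    by (transfer, simp add: eventually_equal_def algebra_simps)+
  show "r - s = r + - s" by (rule minus_germ_def)
qed

end

context highest_weight_rt
begin

text \<open>
  The sequence \<open>s\<close> stands for an element \<open>x\<close> of the localization at \<open>E21\<close> with \<open>E21\<^sup>i x = s i\<close> for
  large \<open>i\<close>.  The action is obtained by moving \<open>E21\<^sup>i\<close> past the acting Lie algebra element.
\<close>

lift_definition germ_scale :: "complex \<Rightarrow> 'v germ \<Rightarrow> 'v germ" is "\<lambda>c s i. scale c (s i)"
  by (auto simp: eventually_equal_def)

lift_definition germ_act :: "4 sl \<Rightarrow> 'v germ \<Rightarrow> 'v germ"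
  is "\<lambda>x s i. act x (s i) + scale (of_nat i) (act (lie_bracket E21 x) (s (i - 1)))
    + scale (of_nat i * (of_nat i - 1) / 2) (act (lie_bracket E21 (lie_bracket E21 x)) (s (i - 2)))"
proof -
  fix x and s t :: "nat \<Rightarrow> 'v"
  assume "eventually_equal s t"
  then obtain N where "\<forall>i\<ge>N. s i = t i" by (auto simp: eventually_equal_def)
  then show "eventually_equal
    (\<lambda>i. act x (s i) + scale (of_nat i) (act (lie_bracket E21 x) (s (i - 1)))
      + scale (of_nat i * (of_nat i - 1) / 2) (act (lie_bracket E21 (lie_bracket E21 x)) (s (i - 2))))
    (\<lambda>i. act x (t i) + scale (of_nat i) (act (lie_bracket E21 x) (t (i - 1)))
      + scale (of_nat i * (of_nat i - 1) / 2) (act (lie_bracket E21 (lie_bracket E21 x)) (t (i - 2))))"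
    by (intro eventually_equalI[of "N + 2"]) simp
qed

lift_definition germ_embed :: "'v \<Rightarrow> 'v germ" is "\<lambda>v i. ((act E21) ^^ i) v" .

text \<open>The shifted exponent encodes \<open>E21^i E21^-1 v\<close>; the wrong value at
  \<open>i = 0\<close> does not affect the germ.\<close>

lift_definition germ_quot :: "'v \<Rightarrow> 'v germ" is "\<lambda>v i. ((act E21) ^^ (i - 1)) v" .

lemma bracket_derivation:
  "lie_bracket x (lie_bracket y z) = lie_bracket (lie_bracket x y) z + lie_bracket y (lie_bracket x (z :: 4 sl))"
proof -
  have anti: "lie_bracket a b = - lie_bracket b a" for a b :: "4 sl"
  proof -
    have "lie_bracket b a + lie_bracket a b = 0"
      using bracket_self[of "a + b"] unfolding bracket_add_left bracket_add_right
      by (simp add: bracket_self add.commute)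
    then show ?thesis by (simp add: eq_neg_iff_add_eq_0 add.commute)
  qed
  have neg: "lie_bracket a (- b) = - lie_bracket a b" for a b :: "4 sl"
  proof -
    have "lie_bracket a 0 = 0" using bracket_add_right[of a 0 0] by simp
    then show ?thesis using bracket_add_right[of a b "- b"] by (simp add: eq_neg_iff_add_eq_0 add.commute)
  qed
  show ?thesis
    using jacobi[of x y z] anti[of z "lie_bracket x y"] anti[of z x] neg[of y "lie_bracket x z"]
    by (simp add: algebra_simps add_eq_0_iff)
qed

text \<open>Here \<open>d\<close> is a derivation with cube zero. Expanding
  \<open>d^3 [x, y] = 0\<close> gives the third identity up to a factor 3; one more \<open>d\<close>
  gives the fourth up to a factor 6.\<close>

lemma act_bracket_E21_products:
  fixes x y defines "d \<equiv> lie_bracket (E21 :: 4 sl)"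
  shows "act (d (lie_bracket x y)) v = act (d x) (act y v) - act y (act (d x) v)
      + act x (act (d y) v) - act (d y) (act x v)"
    "act (d (d (lie_bracket x y))) v = act (d (d x)) (act y v) - act y (act (d (d x)) v)
      + scale 2 (act (d x) (act (d y) v) - act (d y) (act (d x) v))
      + act x (act (d (d y)) v) - act (d (d y)) (act x v)"
    "act (d (d x)) (act (d y) v) + act (d x) (act (d (d y)) v)
      = act (d y) (act (d (d x)) v) + act (d (d y)) (act (d x) v)"
    "act (d (d x)) (act (d (d y)) v) = act (d (d y)) (act (d (d x)) v)"
proof -
  have d: "d (lie_bracket a b) = lie_bracket (d a) b + lie_bracket a (d b)" for a b
    unfolding d_def by (rule bracket_derivation)
  have add: "d (a + b) = d a + d b" for a b by (simp add: d_def bracket_add_right)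
  have d3: "d (d (d a)) = 0" for a by (simp add: d_def bracket_E21_cube)
  have zero: "lie_bracket 0 a = 0" "lie_bracket a 0 = 0" for a :: "4 sl"
    using bracket_add_left[of 0 0 a] bracket_add_right[of a 0 0] by simp_all
  show "act (d (lie_bracket x y)) v = act (d x) (act y v) - act y (act (d x) v)
      + act x (act (d y) v) - act (d y) (act x v)"
    by (simp add: d act_add_left act_bracket)
  show "act (d (d (lie_bracket x y))) v = act (d (d x)) (act y v) - act y (act (d (d x)) v)
      + scale 2 (act (d x) (act (d y) v) - act (d y) (act (d x) v))
      + act x (act (d (d y)) v) - act (d (d y)) (act x v)"
    by (rule eq_by_functionals)
      (simp add: d add act_add_left act_bracket linear_functional_simps algebra_simps)
  let ?U = "lie_bracket (d (d x)) (d y)" and ?W = "lie_bracket (d x) (d (d y))"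
    and ?Q = "lie_bracket (d (d x)) (d (d y))"
  have T: "?U + ?U + ?U + (?W + ?W + ?W) = 0"
  proof -
    have "d (d (d (lie_bracket x y))) = ?U + ?U + ?U + (?W + ?W + ?W)"
      by (simp add: d add d3 zero algebra_simps)
    then show ?thesis by (simp add: d3)
  qed
  have "d (?U + ?U + ?U + (?W + ?W + ?W)) = ?Q + ?Q + ?Q + (?Q + ?Q + ?Q)"
    by (simp add: d add d3 zero)
  then have Q: "?Q + ?Q + ?Q + (?Q + ?Q + ?Q) = 0"
    unfolding T by (simp add: d_def zero)
  have "scale 3 (act (d (d x)) (act (d y) v) + act (d x) (act (d (d y)) v)
        - (act (d y) (act (d (d x)) v) + act (d (d y)) (act (d x) v)))
      = act (?U + ?U + ?U + (?W + ?W + ?W)) v"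
    by (rule eq_by_functionals)
      (simp add: act_add_left act_bracket linear_functional_simps algebra_simps)
  then show "act (d (d x)) (act (d y) v) + act (d x) (act (d (d y)) v)
      = act (d y) (act (d (d x)) v) + act (d (d y)) (act (d x) v)"
    by (simp add: T act_zero_left)
  have "scale 6 (act (d (d x)) (act (d (d y)) v) - act (d (d y)) (act (d (d x)) v))
      = act (?Q + ?Q + ?Q + (?Q + ?Q + ?Q)) v"
    by (rule eq_by_functionals)
      (simp add: act_add_left act_bracket linear_functional_simps algebra_simps)
  then show "act (d (d x)) (act (d (d y)) v) = act (d (d y)) (act (d (d x)) v)"
    by (simp add: Q act_zero_left)
qed

text \<open>\<open>A n x\<close> models the conjugate of \<open>x\<close> by \<open>E21^n\<close>, a
  polynomial in \<open>n\<close>, with \<open>u0\<close>, \<open>u1\<close>, ... as the entries at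
  indices \<open>n\<close>, \<open>n - 1\<close>, .... Conjugation respects brackets; the mixed
  terms in \<open>u3\<close> and \<open>u4\<close> cancel by the last two identities above.\<close>

lemma twisted_bracket:
  fixes n :: complex
  defines "d \<equiv> lie_bracket (E21 :: 4 sl)"
  defines "A \<equiv> \<lambda>n x a b c. act x a + scale n (act (d x) b) + scale (n * (n - 1) / 2) (act (d (d x)) c)"
  shows "A n (lie_bracket x y) u0 u1 u2
    = A n x (A n y u0 u1 u2) (A (n - 1) y u1 u2 u3) (A (n - 2) y u2 u3 u4)
      - A n y (A n x u0 u1 u2) (A (n - 1) x u1 u2 u3) (A (n - 2) x u2 u3 u4)"
proof (rule eq_by_functionals)
  fix \<phi> :: "'v \<Rightarrow> complex" assume \<phi>: "linear_functional \<phi>"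
  note lin = linear_functional_simps[OF \<phi>]
  note b = act_bracket_E21_products[of x y, folded d_def]
  have 3: "\<phi> (act (d (d x)) (act (d y) u3)) + \<phi> (act (d x) (act (d (d y)) u3))
      = \<phi> (act (d y) (act (d (d x)) u3)) + \<phi> (act (d (d y)) (act (d x) u3))"
    using arg_cong[OF b(3)[of u3], of \<phi>] by (simp only: lin)
  show "\<phi> (A n (lie_bracket x y) u0 u1 u2)
    = \<phi> (A n x (A n y u0 u1 u2) (A (n - 1) y u1 u2 u3) (A (n - 2) y u2 u3 u4)
      - A n y (A n x u0 u1 u2) (A (n - 1) x u1 u2 u3) (A (n - 2) x u2 u3 u4))"
    unfolding A_def b(1) b(2) act_bracket act_add_right act_scale_right lin b(4)[of u4]
    using 3 by (simp add: field_simps) algebra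
qed

lemma germ_act_bracket:
  "germ_act (lie_bracket x y) s = germ_act x (germ_act y s) - germ_act y (germ_act x s)"
  unfolding minus_germ_def
proof transfer
  fix x y and s :: "nat \<Rightarrow> 'v"
  let ?d = "lie_bracket (E21 :: 4 sl)"
  let ?A = "\<lambda>x s i. act x (s i) + scale (of_nat i) (act (?d x) (s (i - 1)))
    + scale (of_nat i * (of_nat i - 1) / 2) (act (?d (?d x)) (s (i - 2)))"
  show "eventually_equal (?A (lie_bracket x y) s) (\<lambda>i. ?A x (?A y s) i + - ?A y (?A x s) i)"
  \<comment> \<open>Two actions shift the index by at most 4, so no subtraction is truncated from
    here on.\<close>
  proof (rule eventually_equalI[of 4])
    fix i :: nat assume "4 \<le> i"
    then have i: "of_nat (i - 1) = (of_nat i - 1 :: complex)" "of_nat (i - 2) = (of_nat i - 2 :: complex)"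
      "i - 1 - 1 = i - 2" "i - 1 - 2 = i - 3" "i - 2 - 1 = i - 3" "i - 2 - 2 = i - 4"
      by (simp_all add: of_nat_diff)
    show "?A (lie_bracket x y) s i = ?A x (?A y s) i + - ?A y (?A x s) i"
      using twisted_bracket[where n = "of_nat i" and x = x and y = y and ?u0.0 = "s i"
          and ?u1.0 = "s (i - 1)" and ?u2.0 = "s (i - 2)" and ?u3.0 = "s (i - 3)" and ?u4.0 = "s (i - 4)"]
      by (simp only: i diff_conv_add_uminus[symmetric])
  qed
qed


text \<open>The expansion of \<open>E21^i x\<close> as the sum of
  \<open>binom(i,k) (ad E21)^k(x) E21^(i-k)\<close>, which stops at \<open>k = 2\<close> because
  \<open>ad E21\<close> has cube zero.\<close>

lemma germ_embed_act: "germ_embed (act x v) = germ_act x (germ_embed v)"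
proof transfer
  fix x v
  let ?d = "lie_bracket (E21 :: 4 sl)" and ?p = "\<lambda>i. ((act E21) ^^ i) v"
  have d3: "act E21 (act (?d (?d y)) u) = act (?d (?d y)) (act E21 u)" for y u
    using bracket_E21_cube[of y] act_bracket[of E21 "?d (?d y)" u] by (simp add: act_zero_left)
  have swap: "act E21 (act y u) = act y (act E21 u) + act (?d y) u" for y u
    by (rule act_swap)
  have main: "((act E21) ^^ Suc (Suc i)) (act x v) = act x (?p (Suc (Suc i)))
    + scale (of_nat (Suc (Suc i))) (act (?d x) (?p (Suc i)))
    + scale (of_nat (Suc (Suc i)) * (of_nat (Suc (Suc i)) - 1) / 2) (act (?d (?d x)) (?p i))" for i
  proof (induction i)
    case 0
    show ?case
      by (rule eq_by_functionals)
        (simp add: swap[of x] swap[of "?d x"] d3 act_add_right linear_functional_simps algebra_simps)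
  next
    case (Suc i)
    show ?case
      by (subst funpow.simps(2), subst o_apply, subst Suc, rule eq_by_functionals)
        (simp add: swap[of x] swap[of "?d x"] d3 act_add_right act_scale_right linear_functional_simps
          field_simps)
  qed
  show "eventually_equal (\<lambda>i. ((act E21) ^^ i) (act x v))
    (\<lambda>i. act x (?p i) + scale (of_nat i) (act (?d x) (?p (i - 1)))
      + scale (of_nat i * (of_nat i - 1) / 2) (act (?d (?d x)) (?p (i - 2))))"
  proof (rule eventually_equalI[of 2])
    fix i :: nat assume "2 \<le> i"
    then obtain j where "i = Suc (Suc j)" by (metis add_2_eq_Suc le_Suc_ex)
    then show "((act E21) ^^ i) (act x v) = act x (?p i) + scale (of_nat i) (act (?d x) (?p (i - 1)))
      + scale (of_nat i * (of_nat i - 1) / 2) (act (?d (?d x)) (?p (i - 2)))"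
      using main[of j] by simp
  qed
qed

lemma germ_sl4_module: "sl4_module germ_scale germ_act"
proof unfold_locales
  fix x y :: "4 sl" and s t :: "'v germ" and c c' :: complex
  show "germ_scale c (s + t) = germ_scale c s + germ_scale c t"
    by transfer (simp add: eventually_equal_def scale_right_distrib)
  show "germ_scale (c + c') s = germ_scale c s + germ_scale c' s"
    by transfer (simp add: eventually_equal_def scale_left_distrib)
  show "germ_scale c (germ_scale c' s) = germ_scale (c * c') s"
    by transfer (simp add: eventually_equal_def)
  show "germ_scale 1 s = s"
    by transfer (simp add: eventually_equal_def)
  show "germ_act x (s + t) = germ_act x s + germ_act x t"
    by transfer (simp add: eventually_equal_def act_add_right scale_right_distrib add_ac)
  show "germ_act x (germ_scale c s) = germ_scale c (germ_act x s)"
    by transfer (simp add: eventually_equal_def act_scale_right scale_right_distrib mult.commute)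
  show "germ_act (x + y) s = germ_act x s + germ_act y s"
    by transfer (simp add: eventually_equal_def bracket_add_right act_add_left scale_right_distrib add_ac)
  show "germ_act (lie_scale c x) s = germ_scale c (germ_act x s)"
    by transfer (simp add: eventually_equal_def bracket_scale_right act_scale_left scale_right_distrib
        mult.commute)
  show "germ_act (lie_bracket x y) s = germ_act x (germ_act y s) - germ_act y (germ_act x s)"
    by (rule germ_act_bracket)
qed

lemma germ_extension: "E21_extension scale act v0 germ_scale germ_act germ_embed germ_quot"
proof -
  interpret G: sl4_module germ_scale germ_act by (rule germ_sl4_module)
  have power_add: "((act E21) ^^ i) (v + w) = ((act E21) ^^ i) v + ((act E21) ^^ i) w"
    and power_scale: "((act E21) ^^ i) (scale c v) = scale c (((act E21) ^^ i) v)" for i v w c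
    by (rule power_linear)+
  have inj: "u = v" if "act E21 u = act E21 v" for u v
    using inj_E21 that by (auto dest: injD)
  have inj_power: "u = v" if "((act E21) ^^ i) u = ((act E21) ^^ i) v" for i u v
    using that by (induction i) (auto dest: inj)
  have br: "lie_bracket E21 (E21 :: 4 sl) = 0" by (rule bracket_self)
  \<comment> \<open>The correction terms vanish, so \<open>E21\<close> acts entry by entry and its
    injectivity on \<open>L\<close> passes to germs.\<close>
  have E21: "germ_act E21 (abs_germ s) = abs_germ (\<lambda>i. act E21 (s i))" for s
  proof -
    have "lie_bracket E21 0 = (0 :: 4 sl)" using bracket_add_right[of E21 0 0] by simp
    then show ?thesis by (simp add: germ_act.abs_eq br act_zero_left)
  qed
  show ?thesis
  proof unfold_locales
    fix v w :: 'v and c :: complex and x :: "4 sl"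
    show "germ_embed (v + w) = germ_embed v + germ_embed w"
      by transfer (simp add: eventually_equal_def power_add)
    show "germ_embed (scale c v) = germ_scale c (germ_embed v)"
      by transfer (simp add: eventually_equal_def power_scale)
    show "germ_embed (act x v) = germ_act x (germ_embed v)"
      by (rule germ_embed_act)
    show "inj germ_embed"
    proof (rule injI)
      fix u v assume "germ_embed u = germ_embed v"
      then have "eventually_equal (\<lambda>i. ((act E21) ^^ i) u) (\<lambda>i. ((act E21) ^^ i) v)"
        by transfer
      then obtain N where "((act E21) ^^ N) u = ((act E21) ^^ N) v"
        by (auto simp: eventually_equal_def)
      then show "u = v" by (rule inj_power)
    qed
    show "inj (germ_act E21)"
    proof (rule injI)
      fix s t assume st: "germ_act E21 s = germ_act E21 t"
      obtain s' t' where *: "s = abs_germ s'" "t = abs_germ t'" by (metis Quotient3_abs_rep Quotient3_germ)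
      then have "eventually_equal (\<lambda>i. act E21 (s' i)) (\<lambda>i. act E21 (t' i))"
        using st by (simp add: E21 germ.abs_eq_iff)
      then have "eventually_equal s' t'"
        unfolding eventually_equal_def using inj by blast
      then show "s = t" by (simp add: * germ.abs_eq_iff)
    qed
    show "germ_act E21 (germ_quot v) = germ_embed v"
      unfolding germ_quot.abs_eq germ_embed.abs_eq E21 germ.abs_eq_iff
    proof (rule eventually_equalI[of 1])
      fix i :: nat assume "1 \<le> i"
      then show "act E21 (((act E21) ^^ (i - 1)) v) = ((act E21) ^^ i) v"
        by (cases i) simp_all
    qed
  qed
qed

lemma not_kostant_positive: "\<not> kostant_positive"
proof
  assume kostant_positive
  then obtain C where "C \<in> uea_mod_Ann" "natural_map C = extra"
    using extra_locally_finite unfolding kostant_positive_def by blast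
  then obtain u where "uea_act u = extra"
    by (auto simp: uea_mod_Ann_def quotient_def natural_map_coset)
  then show False
    using E21_extension.extra_not_in_image[OF germ_extension] by blast
qed

end

section \<open>The weight \<open>rt(rho) - rho\<close> in coordinates\<close>

lemma half_sum_components:
  "(half_sum_positive_roots :: complex^4) $ 0 = 3 / 2" "(half_sum_positive_roots :: complex^4) $ 1 = 1 / 2"
  "(half_sum_positive_roots :: complex^4) $ 2 = - 1 / 2" "(half_sum_positive_roots :: complex^4) $ 3 = - 3 / 2"
proof -
  let ?e = "\<lambda>i. axis i 1 :: complex^4"
  have "(positive_roots :: (complex^4) set)
      = {?e 0 - ?e 1, ?e 0 - ?e 2, ?e 0 - ?e 3, ?e 1 - ?e 2, ?e 1 - ?e 3, ?e 2 - ?e 3}"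
    unfolding positive_roots_def set_eq_iff
    by (simp add: ex_index less_index)
  moreover have "(\<Sum>\<alpha>\<in>\<dots>. \<alpha>) = (?e 0 - ?e 1) + ((?e 0 - ?e 2) + ((?e 0 - ?e 3) + ((?e 1 - ?e 2)
      + ((?e 1 - ?e 3) + (?e 2 - ?e 3)))))"
    by (simp add: vec_eq_iff all_index axis_def)
  ultimately show "(half_sum_positive_roots :: complex^4) $ 0 = 3 / 2"
    "(half_sum_positive_roots :: complex^4) $ 1 = 1 / 2"
    "(half_sum_positive_roots :: complex^4) $ 2 = - 1 / 2" "(half_sum_positive_roots :: complex^4) $ 3 = - 3 / 2"
    by (simp_all add: half_sum_positive_roots_def axis_def)
qed

theorem theorem12:
  fixes scl :: "complex \<Rightarrow> 'v::ab_group_add \<Rightarrow> 'v"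
    and act :: "4 sl \<Rightarrow> 'v \<Rightarrow> 'v"
  assumes "simple_highest_weight_module scl act
             (weyl_act (refl_r \<circ> refl_t) half_sum_positive_roots - half_sum_positive_roots)"
  shows "\<not> lie_module.kostant_positive scl act"
proof -
  let ?mu = "weyl_act (refl_r \<circ> refl_t) half_sum_positive_roots - half_sum_positive_roots :: complex^4"
  from assms obtain v where module: "lie_module scl act" and simple: "lie_module.simple_module scl act"
    and v: "v \<noteq> 0" "\<And>x. strictly_upper_sl x \<Longrightarrow> act x v = 0"
      "\<And>h. diagonal_sl h \<Longrightarrow> act h v = scl (weight_eval ?mu h) v"
    unfolding simple_highest_weight_module_def highest_weight_module_def by blast
  interpret sl4_module scl act using module by (simp add: sl4_module_def)
  have inv: "inv (refl_r \<circ> refl_t) = refl_r \<circ> refl_t"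
    by (rule inv_unique_comp) (simp_all add: fun_eq_iff all_index refl_r_def refl_t_def transpose_def)
  have mu: "?mu $ 0 = - 1" "?mu $ 1 = 1" "?mu $ 2 = - 1" "?mu $ 3 = 1"
    unfolding weyl_act_def inv
    by (simp_all add: half_sum_components refl_r_def refl_t_def transpose_def)
  have "strictly_upper_sl E12" "strictly_upper_sl E23" "strictly_upper_sl E34"
    unfolding strictly_upper_sl_def basis_defs
    by (transfer; simp add: all_index less_index)+
  moreover have "diagonal_sl H1" "diagonal_sl H2" "diagonal_sl H3"
    unfolding diagonal_sl_def basis_defs by (transfer; simp add: all_index)+
  moreover have "weight_eval ?mu H1 = - 2" "weight_eval ?mu H2 = 2" "weight_eval ?mu H3 = - 2"
    unfolding weight_eval_def sum_index mu basis_defs by (transfer; simp)+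
  ultimately have "singular (- 2) 2 (- 2) v"
    using v by (simp add: singular_def)
  then interpret highest_weight_rt scl act v
    using simple v(1) by unfold_locales
  show ?thesis by (rule not_kostant_positive)
qed

end
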